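(* Let $\Omega\subseteq\mathbb{R}^d$ be an open set, and assume that $\lambda$ is an eigenvalue of $H_\Omega$ of finite algebraic multiplicity (in other words, $\lambda$ is an isolated point of the spectrum of $H_\Omega$ and an eigenvalue of $H_\Omega$ of finite multiplicity). Then the eigenspace of $H_\Omega$ corresponding to $\lambda$ is a subspace of $L_p(\Omega)$ for all $p\in[1,\infty]$.
   Context: For an open set $\Omega\subseteq\mathbb{R}^d$, $H_\Omega$ denotes the Dirichlet Laplacian on $\Omega$, i.e. the Friedrichs extension of $-\Delta$ on $C_c^\infty(\Omega)$ in $L_2(\Omega)$ (self-adjoint, non-negative, form domain $H_0^1(\Omega)$, form $\int_\Omega\nabla u\cdot\overline{\nabla v}\,dx$). *)

theory Defs
  imports "HOL-Analysis.Analysis"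
begin

text \<open>
  Elements of function spaces on \<open>\<Omega>\<close> are represented by total functions that are considered up to
  equality almost everywhere with respect to \<^term>\<open>lebesgue_on \<Omega>\<close>; values outside \<open>\<Omega>\<close> are
  irrelevant. All the spaces below are closed under modification on null sets.
\<close>

definition Lp_space :: "'a::euclidean_space set \<Rightarrow> ennreal \<Rightarrow> ('a \<Rightarrow> complex) set" where
  "Lp_space \<Omega> p =
     {f \<in> borel_measurable (lebesgue_on \<Omega>).
        if p = \<infinity> then \<exists>C. AE x in lebesgue_on \<Omega>. norm (f x) \<le> C
        else integrable (lebesgue_on \<Omega>) (\<lambda>x. norm (f x) powr enn2real p)}"

definition L2_norm :: "'a::euclidean_space set \<Rightarrow> ('a \<Rightarrow> complex) \<Rightarrow> real" where
  "L2_norm \<Omega> f = sqrt (LINT x|lebesgue_on \<Omega>. (norm (f x))\<^sup>2)"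

definition L2_inner :: "'a::euclidean_space set \<Rightarrow> ('a \<Rightarrow> complex) \<Rightarrow> ('a \<Rightarrow> complex) \<Rightarrow> complex" where
  "L2_inner \<Omega> f g = (LINT x|lebesgue_on \<Omega>. f x * cnj (g x))"

definition partial_deriv :: "'a::euclidean_space \<Rightarrow> ('a \<Rightarrow> complex) \<Rightarrow> 'a \<Rightarrow> complex" where
  "partial_deriv b f x = frechet_derivative f (at x) b"

primrec Ck :: "nat \<Rightarrow> ('a::euclidean_space \<Rightarrow> complex) \<Rightarrow> bool" where
  "Ck 0 f \<longleftrightarrow> continuous_on UNIV f"
| "Ck (Suc k) f \<longleftrightarrow> f differentiable_on UNIV \<and> (\<forall>b\<in>Basis. Ck k (partial_deriv b f))"

text \<open>The space \<open>C\<^sub>c\<^sup>\<infinity>(\<Omega>)\<close>, its elements being extended by zero to the whole space.\<close>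

definition test_functions :: "'a::euclidean_space set \<Rightarrow> ('a \<Rightarrow> complex) set" where
  "test_functions \<Omega> =
     {\<phi>. (\<forall>k. Ck k \<phi>) \<and> compact (closure {x. \<phi> x \<noteq> 0}) \<and> closure {x. \<phi> x \<noteq> 0} \<subseteq> \<Omega>}"

definition has_weak_partial ::
    "'a::euclidean_space set \<Rightarrow> 'a \<Rightarrow> ('a \<Rightarrow> complex) \<Rightarrow> ('a \<Rightarrow> complex) \<Rightarrow> bool" where
  "has_weak_partial \<Omega> b u g \<longleftrightarrow>
     (\<forall>\<phi>\<in>test_functions \<Omega>.
        (LINT x|lebesgue_on \<Omega>. u x * partial_deriv b \<phi> x) = - (LINT x|lebesgue_on \<Omega>. g x * \<phi> x))"

text \<open>
  Weak derivatives are unique only up to null sets, hence the choice of a representative. It is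
  meaningful only if some weak derivative in \<open>L\<^sub>2(\<Omega>)\<close> exists, as it does for elements of \<open>H\<^sup>1(\<Omega>)\<close>.
\<close>

definition weak_partial ::
    "'a::euclidean_space set \<Rightarrow> 'a \<Rightarrow> ('a \<Rightarrow> complex) \<Rightarrow> 'a \<Rightarrow> complex" where
  "weak_partial \<Omega> b u = (SOME g. g \<in> Lp_space \<Omega> 2 \<and> has_weak_partial \<Omega> b u g)"

definition H1 :: "'a::euclidean_space set \<Rightarrow> ('a \<Rightarrow> complex) set" where
  "H1 \<Omega> = {u \<in> Lp_space \<Omega> 2. \<forall>b\<in>Basis. \<exists>g\<in>Lp_space \<Omega> 2. has_weak_partial \<Omega> b u g}"

text \<open>The closure of \<open>C\<^sub>c\<^sup>\<infinity>(\<Omega>)\<close> in \<open>H\<^sup>1(\<Omega>)\<close>.\<close>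

definition H1_0 :: "'a::euclidean_space set \<Rightarrow> ('a \<Rightarrow> complex) set" where
  "H1_0 \<Omega> =
     {u \<in> H1 \<Omega>. \<exists>\<phi>::nat \<Rightarrow> 'a \<Rightarrow> complex.
        (\<forall>n. \<phi> n \<in> test_functions \<Omega>) \<and>
        (\<lambda>n. L2_norm \<Omega> (\<lambda>x. \<phi> n x - u x)) \<longlonglongrightarrow> 0 \<and>
        (\<forall>b\<in>Basis. (\<lambda>n. L2_norm \<Omega> (\<lambda>x. partial_deriv b (\<phi> n) x - weak_partial \<Omega> b u x)) \<longlonglongrightarrow> 0)}"

definition dirichlet_form ::
    "'a::euclidean_space set \<Rightarrow> ('a \<Rightarrow> complex) \<Rightarrow> ('a \<Rightarrow> complex) \<Rightarrow> complex" where
  "dirichlet_form \<Omega> u v =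
     (LINT x|lebesgue_on \<Omega>. (\<Sum>b\<in>Basis. weak_partial \<Omega> b u x * cnj (weak_partial \<Omega> b v x)))"

text \<open>
  The graph of the Dirichlet Laplacian. By definition of the Friedrichs extension, this is the
  operator associated with the closure of the form \<open>(\<phi>, \<psi>) \<mapsto> \<langle>-\<Delta>\<phi>, \<psi>\<rangle>\<close> on \<open>C\<^sub>c\<^sup>\<infinity>(\<Omega>)\<close>; that closure is
  the Dirichlet form with form domain \<open>H\<^sup>1\<^sub>0(\<Omega>)\<close>.
\<close>

definition dirichlet_laplacian ::
    "'a::euclidean_space set \<Rightarrow> (('a \<Rightarrow> complex) \<times> ('a \<Rightarrow> complex)) set" where
  "dirichlet_laplacian \<Omega> =
     {(u, f). u \<in> H1_0 \<Omega> \<and> f \<in> Lp_space \<Omega> 2 \<and>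
        (\<forall>v\<in>H1_0 \<Omega>. dirichlet_form \<Omega> u v = L2_inner \<Omega> f v)}"

text \<open>
  Spectral notions for an operator \<open>A\<close> in \<open>L\<^sub>2(\<Omega>)\<close> given by its graph. In the resolvent set, the
  norm estimate expresses both injectivity of \<open>A - z\<close> and boundedness of its inverse.
\<close>

definition resolvent_set ::
    "'a::euclidean_space set \<Rightarrow> (('a \<Rightarrow> complex) \<times> ('a \<Rightarrow> complex)) set \<Rightarrow> complex set" where
  "resolvent_set \<Omega> A =
     {z. (\<forall>g\<in>Lp_space \<Omega> 2. \<exists>(u, f)\<in>A. AE x in lebesgue_on \<Omega>. f x - z * u x = g x) \<and>
         (\<exists>C. \<forall>(u, f)\<in>A. L2_norm \<Omega> u \<le> C * L2_norm \<Omega> (\<lambda>x. f x - z * u x))}"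

definition spectrum ::
    "'a::euclidean_space set \<Rightarrow> (('a \<Rightarrow> complex) \<times> ('a \<Rightarrow> complex)) set \<Rightarrow> complex set" where
  "spectrum \<Omega> A = - resolvent_set \<Omega> A"

definition eigenspace ::
    "'a::euclidean_space set \<Rightarrow> (('a \<Rightarrow> complex) \<times> ('a \<Rightarrow> complex)) set \<Rightarrow> complex
      \<Rightarrow> ('a \<Rightarrow> complex) set" where
  "eigenspace \<Omega> A z = {u. \<exists>f. (u, f) \<in> A \<and> (AE x in lebesgue_on \<Omega>. f x = z * u x)}"

definition eigenvalue ::
    "'a::euclidean_space set \<Rightarrow> (('a \<Rightarrow> complex) \<times> ('a \<Rightarrow> complex)) set \<Rightarrow> complex \<Rightarrow> bool" where
  "eigenvalue \<Omega> A z \<longleftrightarrow> (\<exists>u\<in>eigenspace \<Omega> A z. \<not> (AE x in lebesgue_on \<Omega>. u x = 0))"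

text \<open>The eigenspace, modulo equality almost everywhere, is spanned by finitely many elements.\<close>

definition finite_multiplicity ::
    "'a::euclidean_space set \<Rightarrow> (('a \<Rightarrow> complex) \<times> ('a \<Rightarrow> complex)) set \<Rightarrow> complex \<Rightarrow> bool" where
  "finite_multiplicity \<Omega> A z \<longleftrightarrow>
     (\<exists>B. finite B \<and> B \<subseteq> eigenspace \<Omega> A z \<and>
        (\<forall>u\<in>eigenspace \<Omega> A z. \<exists>c. AE x in lebesgue_on \<Omega>. u x = (\<Sum>w\<in>B. c w * w x)))"

end

(*
  An eigenfunction u for the eigenvalue l >= 0 is both integrable and bounded, hence in every L_p.

  Boundedness: testing the eigenvalue equation with u psi shows that |u|^2, extended by zero, satisfies
  Delta |u|^2 + 2 l |u|^2 >= 0 on the whole space in the sense of distributions. Testing with heat kernels,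
  the Gaussian averages of |u|^2, multiplied by exp (2 l t), increase with the time t. So the averages of
  |u|^2 over small cubes are bounded.

  Integrability: let w be a bounded weight of polynomial type with |grad w|, |Delta w| <= eta w. Then
  (H - l) (w u) = - 2 grad w . grad u - u Delta w has norm O(eta) |w u|, by Caccioppoli's inequality. Since l
  is isolated in the spectrum, |v - P v| <= C |(H - l) v| for the projection P to the eigenspace, so w u is
  close to P (w u). On the finite-dimensional eigenspace 1/w is uniformly close to 1, so that <w u, P (w u)> is
  close to <u, P (w u)>. Together |w u| <= 2 |u| with a constant that does not depend on the bound of w,
  and in the limit u decays polynomially in the L_2 sense, with any exponent.
*)
theory Submission
  imports Defs "HOL-Computational_Algebra.Polynomial"
begin

section \<open>Isolated points of the spectrum of a symmetric operator\<close>

text \<open>The gap estimate comes from quadratic forms instead of a spectral resolution. For a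
  bounded symmetric B with 0 isolated, |B v - \<tau> v| >= |\<tau>| |v| for small \<tau>; this
  yields a gap on the range of B^2, and a geometric iteration then reaches the kernel. Since H - l
  is unbounded, B is built from its resolvent at a nearby point.

  The weight is w = ((1 + e^2 |x|^2) / (1 + r^2 |x|^2))^k. The parameter e is fixed first, by two
  demands: the commutator must cost at most a quarter of the gap constant, and 1 - 1/w must have
  norm at most 1/4 on the eigenspace. The parameter r keeps w bounded, so that w u stays in the
  operator domain; the final bound does not depend on it, and it tends to 0 at the end. Polynomial
  growth suffices: for k = d the function (1 + e^2 |x|^2)^(-k) is square integrable, so u is a
  product of two L_2 functions.

  As \<open>\<Omega>\<close> is an arbitrary open set, elements of H^1_0 are only added or
  multiplied by smooth factors with bounded gradient, which preserves the Dirichlet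
  condition.\<close>

text \<open>This is Q^2 <= L Q, read off from the nonnegative form of Q at v - Q v / L. A small
  value of the form therefore forces Q v to be small, so approximate minimisers are approximate
  kernel vectors.\<close>

lemma psd_norm_le:
  fixes Q :: "'h::real_inner \<Rightarrow> 'h"
  assumes lin: "bounded_linear Q" and sym: "\<And>x y. Q x \<bullet> y = x \<bullet> Q y"
    and psd: "\<And>x. 0 \<le> Q x \<bullet> x" and L: "\<And>x. norm (Q x) \<le> L * norm x" "L > 0"
  shows "(norm (Q v))\<^sup>2 \<le> L * (Q v \<bullet> v)"
proof -
  interpret Q: bounded_linear Q by (rule lin)
  define s where "s = 1 / L"
  have s: "s > 0" "s * L = 1" using L(2) by (simp_all add: s_def)
  have "0 \<le> Q (v - s *\<^sub>R Q v) \<bullet> (v - s *\<^sub>R Q v)" by (rule psd)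
  also have "\<dots> = Q v \<bullet> v - 2 * s * (Q v \<bullet> Q v) + s * s * (Q (Q v) \<bullet> Q v)"
    by (simp add: Q.diff Q.scaleR inner_diff_left inner_diff_right sym[of "Q v" v] algebra_simps)
  also have "Q (Q v) \<bullet> Q v \<le> L * (Q v \<bullet> Q v)"
  proof -
    have "Q (Q v) \<bullet> Q v \<le> norm (Q (Q v)) * norm (Q v)" by (rule norm_cauchy_schwarz)
    also have "\<dots> \<le> L * norm (Q v) * norm (Q v)" by (intro mult_right_mono L) auto
    finally show ?thesis by (simp add: dot_square_norm power2_eq_square mult.assoc)
  qed
  finally have "0 \<le> Q v \<bullet> v - 2 * s * (Q v \<bullet> Q v) + s * s * (L * (Q v \<bullet> Q v))"
    using s by (simp add: mult_left_mono)
  moreover have "s * s * (L * (Q v \<bullet> Q v)) = s * (Q v \<bullet> Q v)"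
    using s(2) by (metis mult.assoc mult.left_commute mult_1_left)
  ultimately have "s * (Q v \<bullet> Q v) \<le> Q v \<bullet> v" by simp
  then have "L * (s * (Q v \<bullet> Q v)) \<le> L * (Q v \<bullet> v)" using L(2) by simp
  then show ?thesis using s by (simp add: dot_square_norm mult.commute mult.left_commute mult.assoc[symmetric])
qed

text \<open>
  If the best lower bound \<open>m\<close> of \<open>B - \<tau>\<close> were below \<open>\<bar>\<tau>\<bar>\<close>, the form of
  \<open>(B - \<tau>)\<^sup>2 - m\<^sup>2 = (B - \<tau> - m) (B - \<tau> + m)\<close> would be nonnegative with infimum \<open>0\<close> on the unit sphere,
  although both factors are bounded below.
\<close>

lemma symmetric_dist_spectrum:
  fixes B :: "'h::real_inner \<Rightarrow> 'h"
  assumes lin: "bounded_linear B" and sym: "\<And>x y. B x \<bullet> y = x \<bullet> B y"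
    and bb: "\<And>\<tau>. 0 < \<bar>\<tau>\<bar> \<Longrightarrow> \<bar>\<tau>\<bar> < \<delta> \<Longrightarrow> \<exists>c>0. \<forall>v. c * norm v \<le> norm (B v - \<tau> *\<^sub>R v)"
    and \<tau>: "2 * \<bar>\<tau>\<bar> \<le> \<delta>"
  shows "\<bar>\<tau>\<bar> * norm v \<le> norm (B v - \<tau> *\<^sub>R v)"
proof (rule ccontr)
  interpret B: bounded_linear B by (rule lin)
  assume neg: "\<not> ?thesis"
  define K where "K x = B x - \<tau> *\<^sub>R x" for x
  have Klin: "bounded_linear K" unfolding K_def
    by (intro bounded_linear_sub lin bounded_linear_scaleR_right)
  interpret K: bounded_linear K by (rule Klin)
  have Ksym: "K x \<bullet> y = x \<bullet> K y" for x y
    by (simp add: K_def inner_diff_left inner_diff_right sym)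
  have "v \<noteq> 0" using neg by auto
  define m where "m = (INF x\<in>sphere 0 1. norm (K x))"
  have "v /\<^sub>R norm v \<in> sphere 0 1" using \<open>v \<noteq> 0\<close> by simp
  then have ne: "sphere (0::'h) 1 \<noteq> {}" by blast
  have bdd: "bdd_below ((\<lambda>x. norm (K x)) ` sphere 0 1)" by (rule bdd_belowI[of _ 0]) auto
  have m0: "0 \<le> m" unfolding m_def using ne by (intro cINF_greatest) auto
  have mle: "m * norm x \<le> norm (K x)" for x
  proof (cases "x = 0")
    case False
    then have "m \<le> norm (K (x /\<^sub>R norm x))" unfolding m_def by (intro cINF_lower[OF bdd]) auto
    also have "\<dots> = norm (K x) / norm x" by (simp add: K.scaleR divide_inverse_commute)
    finally show ?thesis using False by (simp add: field_simps)
  qed auto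
  have mlt: "m < \<bar>\<tau>\<bar>"
  proof -
    have "m * norm v \<le> norm (K v)" by (rule mle)
    also have "\<dots> < \<bar>\<tau>\<bar> * norm v" using neg by (simp add: K_def)
    finally show ?thesis using \<open>v \<noteq> 0\<close> by simp
  qed
  \<comment> \<open>\<open>\<tau> + m\<close> and \<open>\<tau> - m\<close> are nonzero because
    \<open>m < \<bar>\<tau>\<bar>\<close>, and smaller than \<open>\<delta>\<close> in modulus
    because \<open>2 * \<bar>\<tau>\<bar> \<le> \<delta>\<close>. So both factors of Q are bounded
    below.\<close>
  obtain c1 where c1: "c1 > 0" "\<And>v. c1 * norm v \<le> norm (B v - (\<tau> + m) *\<^sub>R v)"
    using bb[of "\<tau> + m"] mlt m0 \<tau> by (auto simp: abs_if split: if_splits)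
  obtain c2 where c2: "c2 > 0" "\<And>v. c2 * norm v \<le> norm (B v - (\<tau> - m) *\<^sub>R v)"
    using bb[of "\<tau> - m"] mlt m0 \<tau> by (auto simp: abs_if split: if_splits)
  define Q where "Q x = K (K x) - m\<^sup>2 *\<^sub>R x" for x
  have Qlin: "bounded_linear Q" unfolding Q_def
    by (intro bounded_linear_sub bounded_linear_compose[OF Klin Klin] bounded_linear_scaleR_right)
  have Qsym: "Q x \<bullet> y = x \<bullet> Q y" for x y
    by (simp add: Q_def inner_diff_left inner_diff_right Ksym)
  have Qx: "Q x \<bullet> x = (norm (K x))\<^sup>2 - m\<^sup>2 * (norm x)\<^sup>2" for x
    by (simp add: Q_def inner_diff_left Ksym[of "K x" x] dot_square_norm)
  have Qpsd: "0 \<le> Q x \<bullet> x" for x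
  proof -
    have "(m * norm x)\<^sup>2 \<le> (norm (K x))\<^sup>2" using mle m0 by (intro power_mono) auto
    then show ?thesis by (simp add: Qx power_mult_distrib)
  qed
  have Qb: "c1 * c2 * norm x \<le> norm (Q x)" for x
  proof -
    have e: "Q x = B (B x - (\<tau> - m) *\<^sub>R x) - (\<tau> + m) *\<^sub>R (B x - (\<tau> - m) *\<^sub>R x)"
      by (simp add: Q_def K_def B.add B.diff B.scaleR power2_eq_square algebra_simps)
    have "c1 * (c2 * norm x) \<le> c1 * norm (B x - (\<tau> - m) *\<^sub>R x)" using c1 c2 by simp
    also have "\<dots> \<le> norm (Q x)" unfolding e by (rule c1)
    finally show ?thesis by simp
  qed
  obtain L where L: "L > 0" "\<And>x. norm (Q x) \<le> L * norm x"
    using bounded_linear.pos_bounded[OF Qlin] by (auto simp: mult.commute)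
  \<comment> \<open>By \<open>psd_norm_le\<close> the lower bound c1 c2 for Q raises the form of Q
    on the unit sphere to at least (c1 c2)^2 / L. Hence M, which exceeds m, is still a lower bound
    for K there, against the choice of m.\<close>
  define M where "M = sqrt (m\<^sup>2 + (c1 * c2)\<^sup>2 / L)"
  have "M \<le> norm (K x)" if "x \<in> sphere 0 1" for x
  proof -
    have "(c1 * c2)\<^sup>2 \<le> (norm (Q x))\<^sup>2" using Qb[of x] that c1 c2 by (intro power_mono) auto
    also have "\<dots> \<le> L * (Q x \<bullet> x)" by (rule psd_norm_le[OF Qlin Qsym Qpsd L(2) L(1)])
    also have "\<dots> = L * ((norm (K x))\<^sup>2 - m\<^sup>2)" using that by (simp add: Qx)
    finally have "m\<^sup>2 + (c1 * c2)\<^sup>2 / L \<le> (norm (K x))\<^sup>2" using L(1) by (simp add: field_simps)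
    then show ?thesis unfolding M_def by (simp add: real_le_lsqrt)
  qed
  then have "M \<le> m" unfolding m_def using ne by (intro cINF_greatest) auto
  moreover have "m < M"
  proof -
    have "m\<^sup>2 < m\<^sup>2 + (c1 * c2)\<^sup>2 / L" using c1 c2 L by simp
    then show ?thesis unfolding M_def by (rule real_less_rsqrt)
  qed
  ultimately show False by simp
qed

text \<open>
  The assumptions say that \<open>X = B\<^sup>2 - 2 s B\<close> and \<open>Y = B\<^sup>2 + 2 s B\<close> are positive. They commute, so
  \<open>X Y X + Y X Y = X Y (X + Y) = 2 B\<^sup>4 (B\<^sup>2 - 4 s\<^sup>2)\<close> is positive as well.
\<close>

lemma symmetric_gap_range:
  fixes B :: "'h::real_inner \<Rightarrow> 'h"
  assumes lin: "bounded_linear B" and sym: "\<And>x y. B x \<bullet> y = x \<bullet> B y"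
    and pm: "\<And>v. s * norm v \<le> norm (B v - s *\<^sub>R v)" "\<And>v. s * norm v \<le> norm (B v + s *\<^sub>R v)" 
    and s: "s > 0"
  shows "2 * s * norm (B (B x)) \<le> norm (B (B (B x)))"
proof -
  interpret B: bounded_linear B by (rule lin)
  define X where "X v = B (B v) - (2 * s) *\<^sub>R B v" for v
  define Y where "Y v = B (B v) + (2 * s) *\<^sub>R B v" for v
  \<comment> \<open>|B v - s v|^2 - s^2 |v|^2 is exactly the form of X; the other sign gives
    Y.\<close>
  have Xp: "0 \<le> X v \<bullet> v" for v
  proof -
    have "(s * norm v)\<^sup>2 \<le> (norm (B v - s *\<^sub>R v))\<^sup>2" using pm s by (intro power_mono) auto
    also have "\<dots> = X v \<bullet> v + (s * norm v)\<^sup>2"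
      unfolding power_mult_distrib power2_norm_eq_inner
      by (simp add: X_def sym inner_simps inner_commute algebra_simps power2_eq_square)
    finally show ?thesis by simp
  qed
  have Yp: "0 \<le> Y v \<bullet> v" for v
  proof -
    have "(s * norm v)\<^sup>2 \<le> (norm (B v + s *\<^sub>R v))\<^sup>2" using pm s by (intro power_mono) auto
    also have "\<dots> = Y v \<bullet> v + (s * norm v)\<^sup>2"
      unfolding power_mult_distrib power2_norm_eq_inner
      by (simp add: Y_def sym inner_simps inner_commute algebra_simps power2_eq_square)
    finally show ?thesis by simp
  qed
  have "0 \<le> Y (X x) \<bullet> X x + X (Y x) \<bullet> Y x" using Xp Yp by (simp add: add_nonneg_nonneg)
  also have "\<dots> = 2 * ((norm (B (B (B x))))\<^sup>2 - (2 * s * norm (B (B x)))\<^sup>2)"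
    unfolding X_def Y_def
    unfolding power_mult_distrib power2_norm_eq_inner
    by (simp add: B.diff B.add B.scaleR sym inner_simps inner_commute algebra_simps power2_eq_square)
  finally have "(2 * s * norm (B (B x)))\<^sup>2 \<le> (norm (B (B (B x))))\<^sup>2" by simp
  then show ?thesis by (rule power2_le_imp_le) simp
qed

text \<open>
  On the range of \<open>B\<^sup>2\<close> the map \<open>1 - \<alpha> B\<^sup>2\<close> is a contraction, so its iterates converge geometrically to the
  projection onto the kernel of \<open>B\<close>.
\<close>

lemma symmetric_isolated_gap:
  fixes B :: "'h::{real_inner,complete_space} \<Rightarrow> 'h"
  assumes lin: "bounded_linear B" and sym: "\<And>x y. B x \<bullet> y = x \<bullet> B y"
    and \<delta>: "\<delta> > 0"
    and bb: "\<And>\<tau>. 0 < \<bar>\<tau>\<bar> \<Longrightarrow> \<bar>\<tau>\<bar> < \<delta> \<Longrightarrow> \<exists>c>0. \<forall>v. c * norm v \<le> norm (B v - \<tau> *\<^sub>R v)"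
  shows "\<exists>c>0. \<forall>v. (\<forall>e. B e = 0 \<longrightarrow> v \<bullet> e = 0) \<longrightarrow> c * norm v \<le> norm (B v)"
proof -
  interpret B: bounded_linear B by (rule lin)
  \<comment> \<open>\<open>symmetric_dist_spectrum\<close> reaches half of the radius only; it is
    applied at s and at -s.\<close>
  define s where "s = \<delta> / 2"
  have s: "s > 0" "2 * \<bar>s\<bar> \<le> \<delta>" "2 * \<bar>-s\<bar> \<le> \<delta>" using \<delta> by (auto simp: s_def)
  have p1: "s * norm v \<le> norm (B v - s *\<^sub>R v)" for v
    using symmetric_dist_spectrum[OF lin sym bb s(2)] s(1) by auto
  have p2: "s * norm v \<le> norm (B v + s *\<^sub>R v)" for v
    using symmetric_dist_spectrum[OF lin sym bb s(3)] s(1) by auto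
  have gap: "2 * s * norm (B (B x)) \<le> norm (B (B (B x)))" for x
    by (rule symmetric_gap_range[OF lin sym p1 p2 s(1)])
  obtain L where L: "L > 0" "\<And>x. norm (B x) \<le> L * norm x"
    using B.pos_bounded by (auto simp: mult.commute)
  \<comment> \<open>Small enough for both purposes: \<alpha> L^2 <= 1 tames the quadratic term of |G
    y|^2, and 4 s^2 \<alpha> <= 1 makes q real.\<close>
  define \<alpha> where "\<alpha> = 1 / (L\<^sup>2 + 4 * s\<^sup>2)"
  have den: "L\<^sup>2 + 4 * s\<^sup>2 > 0" using L by (simp add: add_pos_nonneg)
  have a: "\<alpha> > 0" "\<alpha> * L\<^sup>2 \<le> 1" "4 * s\<^sup>2 * \<alpha> \<le> 1"
    using den by (simp_all add: \<alpha>_def)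
  define q where "q = sqrt (1 - 4 * s\<^sup>2 * \<alpha>)"
  have q: "0 \<le> q" "q < 1" using a s by (auto simp: q_def intro: real_sqrt_lt_1_iff[THEN iffD2])
  define G where "G x = x - \<alpha> *\<^sub>R B (B x)" for x
  have contr: "norm (G y) \<le> q * norm y" if "y = B (B x)" for x y
  proof -
    have n1: "2 * s * norm y \<le> norm (B y)" using gap that by simp
    have "(norm (G y))\<^sup>2 = (norm y)\<^sup>2 - 2 * \<alpha> * (norm (B y))\<^sup>2 + \<alpha>\<^sup>2 * (norm (B (B y)))\<^sup>2"
      unfolding power2_norm_eq_inner
      by (simp add: G_def sym inner_simps inner_commute algebra_simps power2_eq_square)
    \<comment> \<open>The positive last term cancels at most half of the negative middle one,
      because \<open>\<alpha> * L\<^sup>2 \<le> 1\<close>.\<close>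
    also have "(norm (B (B y)))\<^sup>2 \<le> (L * norm (B y))\<^sup>2" by (intro power_mono L) auto
    also have "\<alpha>\<^sup>2 * (L * norm (B y))\<^sup>2 = \<alpha> * (\<alpha> * L\<^sup>2) * (norm (B y))\<^sup>2"
      by (simp add: power_mult_distrib power2_eq_square)
    also have "\<alpha> * (\<alpha> * L\<^sup>2) * (norm (B y))\<^sup>2 \<le> \<alpha> * 1 * (norm (B y))\<^sup>2"
      using a by (intro mult_right_mono mult_left_mono) auto
    finally have "(norm (G y))\<^sup>2 \<le> (norm y)\<^sup>2 - \<alpha> * (norm (B y))\<^sup>2"
      using a by (simp add: mult_left_mono)
    moreover have "\<alpha> * (2 * s * norm y)\<^sup>2 \<le> \<alpha> * (norm (B y))\<^sup>2"
      using a s n1 by (intro mult_left_mono power_mono) auto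
    ultimately have "(norm (G y))\<^sup>2 \<le> (1 - 4 * s\<^sup>2 * \<alpha>) * (norm y)\<^sup>2"
      by (simp add: power_mult_distrib algebra_simps)
    also have "\<dots> = (q * norm y)\<^sup>2" using a by (simp add: q_def power_mult_distrib)
    finally show ?thesis by (rule power2_le_imp_le) (use q in simp)
  qed
  define C where "C = \<alpha> * L / (1 - q)"
  have Cpos: "C > 0" using a L q by (simp add: C_def)
  have main: "norm v \<le> C * norm (B v)" if perp: "\<And>e. B e = 0 \<Longrightarrow> v \<bullet> e = 0" for v
  proof -
    define V where "V n = (G ^^ n) v" for n
    have VS: "V (Suc n) = V n - \<alpha> *\<^sub>R B (B (V n))" for n by (simp add: V_def G_def)
    have Gc: "B (B (G x)) = G (B (B x))" for x by (simp add: G_def B.diff B.scaleR)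
    have dec: "norm (B (B (V n))) \<le> q ^ n * norm (B (B v))" for n
    proof (induction n)
      case (Suc n)
      have "norm (B (B (V (Suc n)))) = norm (G (B (B (V n))))"
        using Gc[of "V n"] by (simp add: V_def)
      also have "\<dots> \<le> q * norm (B (B (V n)))" by (rule contr[OF refl])
      also have "\<dots> \<le> q * (q ^ n * norm (B (B v)))" using q Suc by (intro mult_left_mono) auto
      finally show ?case by simp
    qed (simp add: V_def)
    define D where "D n = \<alpha> *\<^sub>R B (B (V n))" for n
    have Dn: "norm (D n) \<le> q ^ n * (\<alpha> * norm (B (B v)))" for n
      using dec[of n] a by (simp add: D_def algebra_simps)
    have gs: "(\<lambda>n. q ^ n * (\<alpha> * norm (B (B v)))) sums (1 / (1 - q) * (\<alpha> * norm (B (B v))))"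
      using q by (intro sums_mult2 geometric_sums) auto
    have Dcau: "Cauchy (\<lambda>n. \<Sum>i<n. D i)"
    proof (rule CauchyI)
      fix e :: real assume "e > 0"
      have "Cauchy (\<lambda>n. \<Sum>i<n. q ^ i * (\<alpha> * norm (B (B v))))"
        using gs unfolding sums_def by (rule LIMSEQ_imp_Cauchy)
      then obtain M where M: "\<And>m n. m \<ge> M \<Longrightarrow> n \<ge> M \<Longrightarrow>
          norm ((\<Sum>i<m. q ^ i * (\<alpha> * norm (B (B v)))) - (\<Sum>i<n. q ^ i * (\<alpha> * norm (B (B v))))) < e"
        using CauchyD[OF _ \<open>e > 0\<close>] by metis
      have aux: "norm ((\<Sum>i<m. D i) - (\<Sum>i<n. D i)) < e" if "n \<ge> M" "m \<ge> n" for m n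
      proof -
        have *: "sum f {..<m} - sum f {..<n} = sum f {n..<m}" for f :: "nat \<Rightarrow> 'x::ab_group_add"
          using sum_diff_nat_ivl[of 0 n m f] that by (simp add: lessThan_atLeast0)
        have "norm ((\<Sum>i<m. D i) - (\<Sum>i<n. D i)) \<le> (\<Sum>i=n..<m. q ^ i * (\<alpha> * norm (B (B v))))"
          unfolding * by (intro sum_norm_le Dn)
        also have "\<dots> < e" using M[of m n] that unfolding * by simp
        finally show ?thesis .
      qed
      show "\<exists>M. \<forall>m\<ge>M. \<forall>n\<ge>M. norm ((\<Sum>i<m. D i) - (\<Sum>i<n. D i)) < e"
      proof (intro exI allI impI)
        fix m n assume "M \<le> m" "M \<le> n"
        then show "norm ((\<Sum>i<m. D i) - (\<Sum>i<n. D i)) < e"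
          using aux[of n m] aux[of m n] by (cases "n \<le> m") (auto simp: norm_minus_commute)
      qed
    qed
    then obtain S where S: "D sums S" unfolding sums_def by (meson Cauchy_convergent convergentD)
    have Vsum: "V n = v - (\<Sum>i<n. D i)" for n
      by (induction n) (auto simp: VS D_def, simp add: V_def)
    have Vlim: "V \<longlonglongrightarrow> v - S" unfolding Vsum using S by (auto simp: sums_def intro: tendsto_intros)
    have "(\<lambda>n. B (B (V n))) \<longlonglongrightarrow> B (B (v - S))" by (intro B.tendsto Vlim)
    moreover have "(\<lambda>n. B (B (V n))) \<longlonglongrightarrow> 0"
    proof (rule Lim_null_comparison)
      show "\<forall>\<^sub>F n in sequentially. norm (B (B (V n))) \<le> q ^ n * norm (B (B v))" using dec by simp
      show "(\<lambda>n. q ^ n * norm (B (B v))) \<longlonglongrightarrow> 0"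
        using q by (intro tendsto_mult_left_zero LIMSEQ_power_zero) auto
    qed
    ultimately have "B (B (v - S)) = 0" by (rule LIMSEQ_unique)
    then have "B (v - S) \<bullet> B (v - S) = 0" by (simp add: sym)
    then have ker: "B (v - S) = 0" by simp
    \<comment> \<open>The limit v - S is a kernel vector, and v together with all its iterates is
      orthogonal to the kernel. So the limit is orthogonal to itself, v = S, and summing the
      increments bounds |v|.\<close>
    have Vp: "V n \<bullet> (v - S) = 0" for n
    proof (induction n)
      case 0 then show ?case using perp[OF ker] by (simp add: V_def)
    next
      case (Suc n) then show ?case by (simp add: VS inner_diff_left sym ker B.zero)
    qed
    have "(\<lambda>n. V n \<bullet> (v - S)) \<longlonglongrightarrow> (v - S) \<bullet> (v - S)" by (intro tendsto_intros Vlim)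
    then have "(v - S) \<bullet> (v - S) = 0" unfolding Vp by (simp add: LIMSEQ_const_iff)
    then have "v = S" by simp
    have "norm S \<le> 1 / (1 - q) * (\<alpha> * norm (B (B v)))"
    proof (rule LIMSEQ_le[OF tendsto_norm])
      show "(\<lambda>n. \<Sum>i<n. D i) \<longlonglongrightarrow> S" using S by (simp add: sums_def)
      show "(\<lambda>n. \<Sum>i<n. q ^ i * (\<alpha> * norm (B (B v)))) \<longlonglongrightarrow> 1 / (1 - q) * (\<alpha> * norm (B (B v)))"
        using gs by (simp add: sums_def)
      show "\<exists>N. \<forall>n\<ge>N. norm (\<Sum>i<n. D i) \<le> (\<Sum>i<n. q ^ i * (\<alpha> * norm (B (B v))))"
        by (intro exI[of _ 0] allI impI sum_norm_le Dn)
    qed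
    also have "\<dots> \<le> 1 / (1 - q) * (\<alpha> * (L * norm (B v)))"
      using q a L(2) by (intro mult_left_mono) auto
    also have "\<dots> = C * norm (B v)" by (simp add: C_def)
    finally show ?thesis using \<open>v = S\<close> by simp
  qed
  show ?thesis
  proof (intro exI[of _ "1 / C"] conjI allI impI)
    show "1 / C * norm v \<le> norm (B v)" if "\<forall>e. B e = 0 \<longrightarrow> v \<bullet> e = 0" for v
      using main[of v] that Cpos by (simp add: field_simps)
  qed (use Cpos in simp)
qed

text \<open>
  The bounded operator \<open>T + 1 / t0\<close> with \<open>T = (A - t0)\<^sup>-\<^sup>1\<close> has the kernel of \<open>A\<close> as its kernel.
\<close>

lemma symmetric_relation_gap:
  fixes A :: "('h::{real_inner,complete_space} \<times> 'h) set"
  assumes sub: "subspace A"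
    and sym: "\<And>u f v g. (u, f) \<in> A \<Longrightarrow> (v, g) \<in> A \<Longrightarrow> f \<bullet> v = u \<bullet> g"
    and \<delta>: "\<delta> > 0"
    and surj: "\<And>t g. 0 < \<bar>t\<bar> \<Longrightarrow> \<bar>t\<bar> < \<delta> \<Longrightarrow> \<exists>u. (u, g + t *\<^sub>R u) \<in> A"
    and bound: "\<And>t. 0 < \<bar>t\<bar> \<Longrightarrow> \<bar>t\<bar> < \<delta> \<Longrightarrow> \<exists>C. \<forall>u f. (u, f) \<in> A \<longrightarrow> norm u \<le> C * norm (f - t *\<^sub>R u)"
  shows "\<exists>c>0. \<forall>u f. (u, f) \<in> A \<longrightarrow> (\<forall>e. (e, 0) \<in> A \<longrightarrow> u \<bullet> e = 0) \<longrightarrow> c * norm u \<le> norm f"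
proof -
  define t0 where "t0 = \<delta> / 2"
  have t0: "t0 > 0" "0 < \<bar>t0\<bar>" "\<bar>t0\<bar> < \<delta>" using \<delta> by (auto simp: t0_def)
  define T where "T g = (SOME u. (u, g + t0 *\<^sub>R u) \<in> A)" for g
  have T: "(T g, g + t0 *\<^sub>R T g) \<in> A" for g
    unfolding T_def using surj[OF t0(2,3)] by (rule someI_ex)
  obtain C0 where C0: "\<And>u f. (u, f) \<in> A \<Longrightarrow> norm u \<le> C0 * norm (f - t0 *\<^sub>R u)"
    using bound[OF t0(2,3)] by blast
  have uniq: "u = T g" if "(u, g + t0 *\<^sub>R u) \<in> A" for u g
  proof -
    have "(u, g + t0 *\<^sub>R u) - (T g, g + t0 *\<^sub>R T g) \<in> A" using sub that T by (rule subspace_diff)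
    then show ?thesis using C0[of "u - T g" "t0 *\<^sub>R u - t0 *\<^sub>R T g"] by (simp add: scaleR_diff_right)
  qed
  have Tlin: "bounded_linear T"
  proof (rule bounded_linear_intro[where K = C0])
    show "T (x + y) = T x + T y" for x y
    proof (rule uniq[symmetric])
      show "(T x + T y, x + y + t0 *\<^sub>R (T x + T y)) \<in> A"
        using subspace_add[OF sub T T, of x y] by (simp add: algebra_simps)
    qed
    show "T (r *\<^sub>R x) = r *\<^sub>R T x" for r x
    proof (rule uniq[symmetric])
      show "(r *\<^sub>R T x, r *\<^sub>R x + t0 *\<^sub>R (r *\<^sub>R T x)) \<in> A"
        using subspace_scale[OF sub T, of r x] by (simp add: algebra_simps)
    qed
    show "norm (T x) \<le> norm x * C0" for x using C0[OF T, of x] by (simp add: mult.commute)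
  qed
  have Tsym: "T x \<bullet> y = x \<bullet> T y" for x y
    using sym[OF T T, of x y] by (simp add: inner_simps)
  interpret T: bounded_linear T by (rule Tlin)
  \<comment> \<open>On the kernel of A the resolvent T acts as -1/t0, so this shift moves the
    isolated point to 0.\<close>
  define B where "B x = T x + (1 / t0) *\<^sub>R x" for x
  have Blin: "bounded_linear B" unfolding B_def
    by (intro bounded_linear_add Tlin bounded_linear_scaleR_right)
  have Bsym: "B x \<bullet> y = x \<bullet> B y" for x y by (simp add: B_def inner_simps Tsym)
  have "\<exists>c>0. \<forall>v. (\<forall>e. B e = 0 \<longrightarrow> v \<bullet> e = 0) \<longrightarrow> c * norm v \<le> norm (B v)"
  proof (rule symmetric_isolated_gap[OF Blin Bsym])
    \<comment> \<open>Within this radius |t0 \<tau>| < 1/2, which makes k nonzero and keeps |t| <=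
      t0 = \<delta>/2.\<close>
    show "0 < 1 / (2 * t0)" using t0 by simp
    fix \<tau> :: real assume \<tau>: "0 < \<bar>\<tau>\<bar>" "\<bar>\<tau>\<bar> < 1 / (2 * t0)"
    have tt: "\<bar>t0 * \<tau>\<bar> < 1 / 2" using \<tau> t0 by (simp add: abs_mult field_simps)
    define k where "k = 1 / t0 - \<tau>"
    have k0: "k \<noteq> 0" "t0 * k = 1 - t0 * \<tau>" using tt t0 by (auto simp: k_def field_simps)
    \<comment> \<open>Chosen so that B - \<tau> = T + k = k (A - t) T. The bound for A - t then
      controls T v, and k v = (B - \<tau>) v - T v recovers v.\<close>
    define t where "t = t0 - 1 / k"
    have t_eq: "t = - t0\<^sup>2 * \<tau> / (1 - t0 * \<tau>)"
      using k0 t0 by (simp add: t_def k_def field_simps power2_eq_square)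
    have "\<bar>t\<bar> = t0 * (\<bar>t0 * \<tau>\<bar> / (1 - t0 * \<tau>))"
    proof -
      have "\<bar>1 - t0 * \<tau>\<bar> = 1 - t0 * \<tau>" using tt by linarith
      then show ?thesis unfolding t_eq using t0 by (simp add: abs_mult power2_eq_square)
    qed
    also have "\<dots> \<le> t0 * 1" using tt t0 by (intro mult_left_mono) (auto simp: divide_le_eq abs_if mult.commute split: if_splits)
    finally have t1: "\<bar>t\<bar> < \<delta>" using t0 by simp
    have t2: "0 < \<bar>t\<bar>" unfolding t_eq using \<tau> tt t0 by auto
    obtain C where C: "\<And>u f. (u, f) \<in> A \<Longrightarrow> norm u \<le> C * norm (f - t *\<^sub>R u)"
      using bound[OF t2 t1] by blast
    have est: "norm v \<le> ((1 + \<bar>C\<bar>/\<bar>k\<bar>) / \<bar>k\<bar>) * norm (B v - \<tau> *\<^sub>R v)" for v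
    proof -
      have e1: "B v - \<tau> *\<^sub>R v = T v + k *\<^sub>R v" by (simp add: B_def k_def algebra_simps)
      have e2: "v + t0 *\<^sub>R T v - t *\<^sub>R T v = (1/k) *\<^sub>R (B v - \<tau> *\<^sub>R v)"
        unfolding e1 t_def using k0 by (simp add: algebra_simps)
      have "norm (T v) \<le> C * norm ((1/k) *\<^sub>R (B v - \<tau> *\<^sub>R v))"
        using C[OF T, of v] unfolding e2 .
      also have "\<dots> \<le> \<bar>C\<bar> * norm ((1/k) *\<^sub>R (B v - \<tau> *\<^sub>R v))" by (intro mult_right_mono) auto
      finally have n1: "norm (T v) \<le> \<bar>C\<bar>/\<bar>k\<bar> * norm (B v - \<tau> *\<^sub>R v)" by simp
      have "k *\<^sub>R v = (B v - \<tau> *\<^sub>R v) - T v" by (simp add: e1)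
      then have "\<bar>k\<bar> * norm v \<le> norm (B v - \<tau> *\<^sub>R v) + norm (T v)"
        by (metis norm_scaleR norm_triangle_ineq4)
      also have "\<dots> \<le> (1 + \<bar>C\<bar>/\<bar>k\<bar>) * norm (B v - \<tau> *\<^sub>R v)" using n1 by (simp add: algebra_simps)
      finally have "norm v \<le> (1 + \<bar>C\<bar>/\<bar>k\<bar>) * norm (B v - \<tau> *\<^sub>R v) / \<bar>k\<bar>"
        using k0 by (subst pos_le_divide_eq) (simp_all add: mult.commute)
      then show ?thesis by simp
    qed
    have "(1 + \<bar>C\<bar>/\<bar>k\<bar>) / \<bar>k\<bar> > 0" using k0 by (simp add: add_pos_nonneg)
    then show "\<exists>c>0. \<forall>v. c * norm v \<le> norm (B v - \<tau> *\<^sub>R v)"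
      using est by (intro exI[of _ "1 / ((1 + \<bar>C\<bar>/\<bar>k\<bar>) / \<bar>k\<bar>)"])
        (simp add: field_simps del: divide_divide_eq_right divide_divide_eq_left)
  qed
  then obtain c where c: "c > 0" "\<And>v. (\<And>e. B e = 0 \<Longrightarrow> v \<bullet> e = 0) \<Longrightarrow> c * norm v \<le> norm (B v)"
    by blast
  obtain L where L: "L > 0" "\<And>x. norm (T x) \<le> L * norm x"
    using T.pos_bounded by (auto simp: mult.commute)
  have "c * t0 / L * norm u \<le> norm f" if uf: "(u, f) \<in> A" and perp: "\<And>e. (e, 0) \<in> A \<Longrightarrow> u \<bullet> e = 0" for u f
  proof -
    \<comment> \<open>Rewriting u through the resolvent gives B u = T f / t0, so the gap of B and
      the boundedness of T bound u by f.\<close>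
    have "u = T (f - t0 *\<^sub>R u)" by (rule uniq) (use uf in simp)
    then have "u = T f - t0 *\<^sub>R T u" by (simp add: T.diff T.scaleR)
    then have uT: "u + t0 *\<^sub>R T u = T f" by (metis diff_add_cancel)
    have Bu: "B u = (1 / t0) *\<^sub>R T f" using t0 unfolding uT[symmetric] by (simp add: B_def scaleR_add_right)
    have "c * norm u \<le> norm (B u)"
    proof (rule c(2))
      fix e assume "B e = 0"
      then have "t0 *\<^sub>R (T e + (1 / t0) *\<^sub>R e) = 0" by (simp add: B_def)
      then have "e = - (t0 *\<^sub>R T e)" using t0 by (simp add: scaleR_add_right add_eq_0_iff)
      then have "e + t0 *\<^sub>R T e = 0" by (simp add: eq_neg_iff_add_eq_0)
      then have "(T e, 0) \<in> A" using T[of e] by simp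
      then have "(-(t0 *\<^sub>R T e), 0) \<in> A" using subspace_scale[OF sub, of "(T e, 0)" "-t0"] by simp
      then show "u \<bullet> e = 0" using perp \<open>e = - (t0 *\<^sub>R T e)\<close> by simp
    qed
    also have "\<dots> \<le> (1 / t0) * (L * norm f)" unfolding Bu using t0 L by (simp add: divide_right_mono)
    finally show ?thesis using t0 L by (simp add: field_simps)
  qed
  then show ?thesis using c t0 L by (intro exI[of _ "c * t0 / L"]) auto
qed

section \<open>Square-integrable functions\<close>

definition sq_integrable :: "'a measure \<Rightarrow> ('a \<Rightarrow> complex) \<Rightarrow> bool" where
  "sq_integrable M f \<longleftrightarrow> f \<in> borel_measurable M \<and> integrable M (\<lambda>x. (norm (f x))\<^sup>2)"

lemma Lp_space_2_iff: "f \<in> Lp_space \<Omega> 2 \<longleftrightarrow> sq_integrable (lebesgue_on \<Omega>) f"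
  by (simp add: Lp_space_def sq_integrable_def)

lemma sq_integrable_measurable [measurable_dest]: "sq_integrable M f \<Longrightarrow> f \<in> borel_measurable M"
  by (simp add: sq_integrable_def)

lemma sq_integrable_bound:
  assumes g: "sq_integrable M g" and f: "f \<in> borel_measurable M"
    and le: "AE x in M. norm (f x) \<le> C * norm (g x)"
  shows "sq_integrable M f"
proof -
  have "integrable M (\<lambda>x. (norm (f x))\<^sup>2)"
  proof (rule Bochner_Integration.integrable_bound)
    show "integrable M (\<lambda>x. C\<^sup>2 * (norm (g x))\<^sup>2)" using g by (simp add: sq_integrable_def)
    show "AE x in M. norm ((norm (f x))\<^sup>2) \<le> norm (C\<^sup>2 * (norm (g x))\<^sup>2)"
      using le by eventually_elim (auto simp flip: power_mult_distrib intro!: power_mono)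
  qed (use f in measurable)
  then show ?thesis using f by (simp add: sq_integrable_def)
qed

lemma sq_integrable_zero [simp]: "sq_integrable M (\<lambda>x. 0)"
  by (simp add: sq_integrable_def)

lemma sq_integrable_cmult: "sq_integrable M f \<Longrightarrow> sq_integrable M (\<lambda>x. c * f x)"
  by (rule sq_integrable_bound[of M f _ "norm c"]) (auto simp: norm_mult)

lemma sq_integrable_minus: "sq_integrable M f \<Longrightarrow> sq_integrable M (\<lambda>x. - f x)"
  by (simp add: sq_integrable_def)

lemma borel_measurable_cnj [measurable (raw)]:
  "f \<in> borel_measurable M \<Longrightarrow> (\<lambda>x. cnj (f x)) \<in> borel_measurable M"
  by (rule measurable_compose[of f M borel cnj])
    (auto intro!: borel_measurable_continuous_onI continuous_intros)

lemma sq_integrable_cnj: "sq_integrable M f \<Longrightarrow> sq_integrable M (\<lambda>x. cnj (f x))"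
  by (rule sq_integrable_bound[of M f _ 1]) (auto dest: sq_integrable_measurable)

lemma sq_integrable_mult_integrable:
  assumes f: "sq_integrable M f" and g: "sq_integrable M g"
  shows "integrable M (\<lambda>x. f x * g x)"
proof (rule Bochner_Integration.integrable_bound)
  show "integrable M (\<lambda>x. (norm (f x))\<^sup>2 + (norm (g x))\<^sup>2)"
    using f g by (simp add: sq_integrable_def)
  have "norm (f x * g x) \<le> norm ((norm (f x))\<^sup>2 + (norm (g x))\<^sup>2)" for x
  proof -
    have "2 * norm (f x) * norm (g x) \<le> (norm (f x))\<^sup>2 + (norm (g x))\<^sup>2" by (rule sum_squares_bound)
    moreover have "0 \<le> norm (f x) * norm (g x)" by simp
    ultimately have "norm (f x) * norm (g x) \<le> (norm (f x))\<^sup>2 + (norm (g x))\<^sup>2" by linarith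
    then show ?thesis by (simp add: norm_mult)
  qed
  then show "AE x in M. norm (f x * g x) \<le> norm ((norm (f x))\<^sup>2 + (norm (g x))\<^sup>2)" by simp
qed (use f g in measurable)

lemma sq_integrable_mult_cnj_integrable:
  "sq_integrable M f \<Longrightarrow> sq_integrable M g \<Longrightarrow> integrable M (\<lambda>x. f x * cnj (g x))"
  by (rule sq_integrable_mult_integrable[OF _ sq_integrable_cnj])

lemma sq_integrable_add:
  assumes f: "sq_integrable M f" and g: "sq_integrable M g"
  shows "sq_integrable M (\<lambda>x. f x + g x)"
  unfolding sq_integrable_def
proof
  show "(\<lambda>x. f x + g x) \<in> borel_measurable M" using f g by measurable
  show "integrable M (\<lambda>x. (norm (f x + g x))\<^sup>2)"
  proof (rule Bochner_Integration.integrable_bound)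
    show "integrable M (\<lambda>x. 2 * (norm (f x))\<^sup>2 + 2 * (norm (g x))\<^sup>2)"
      using f g by (simp add: sq_integrable_def)
    have "(norm (f x + g x))\<^sup>2 \<le> 2 * (norm (f x))\<^sup>2 + 2 * (norm (g x))\<^sup>2" for x
    proof -
      have "(norm (f x + g x))\<^sup>2 \<le> (norm (f x) + norm (g x))\<^sup>2"
        by (intro power_mono norm_triangle_ineq) auto
      also have "\<dots> \<le> 2 * (norm (f x))\<^sup>2 + 2 * (norm (g x))\<^sup>2"
        using sum_squares_bound[of "norm (f x)" "norm (g x)"] by (simp add: power2_sum)
      finally show ?thesis .
    qed
    then show "AE x in M. norm ((norm (f x + g x))\<^sup>2) \<le> norm (2 * (norm (f x))\<^sup>2 + 2 * (norm (g x))\<^sup>2)"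
      by (simp add: abs_of_nonneg)
  qed (use f g in measurable)
qed

lemma sq_integrable_diff:
  "sq_integrable M f \<Longrightarrow> sq_integrable M g \<Longrightarrow> sq_integrable M (\<lambda>x. f x - g x)"
  using sq_integrable_add[of M f "\<lambda>x. - g x"] sq_integrable_minus[of M g] by simp

lemma sq_integrable_sum:
  "(\<And>i. i \<in> I \<Longrightarrow> sq_integrable M (f i)) \<Longrightarrow> sq_integrable M (\<lambda>x. \<Sum>i\<in>I. f i x)"
  by (induction I rule: infinite_finite_induct) (auto intro: sq_integrable_add)

lemma sq_integrable_bounded_mult:
  assumes "sq_integrable M f" "\<psi> \<in> borel_measurable M" "\<And>x. norm (\<psi> x) \<le> C"
  shows "sq_integrable M (\<lambda>x. \<psi> x * f x)"
  by (rule sq_integrable_bound[OF assms(1), of _ C]) (use assms in \<open>auto simp: norm_mult mult_right_mono\<close>)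

text \<open>
  Only the real Hilbert space structure of \<open>L\<^sub>2\<close> is used, the eigenvalue being real; a function on
  \<open>\<Omega>\<close> is extended by zero, because a type cannot depend on \<open>\<Omega>\<close>.
\<close>

quotient_type (overloaded) 'a l2 = "'a::euclidean_space \<Rightarrow> complex" / partial:
  "\<lambda>f g. sq_integrable lebesgue f \<and> sq_integrable lebesgue g \<and> (AE x in lebesgue. f x = g x)"
proof (rule part_equivpI)
  show "\<exists>f::'a \<Rightarrow> complex. sq_integrable lebesgue f \<and> sq_integrable lebesgue f \<and> (AE x in lebesgue. f x = f x)"
    by (intro exI[of _ "\<lambda>x. 0"]) simp
  show "symp (\<lambda>f g::'a \<Rightarrow> complex. sq_integrable lebesgue f \<and> sq_integrable lebesgue g \<and> (AE x in lebesgue. f x = g x))"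
    by (rule sympI) (auto simp: eq_commute)
  show "transp (\<lambda>f g::'a \<Rightarrow> complex. sq_integrable lebesgue f \<and> sq_integrable lebesgue g \<and> (AE x in lebesgue. f x = g x))"
  proof (rule transpI, elim conjE, intro conjI)
    fix f g h :: "'a \<Rightarrow> complex"
    assume "AE x in lebesgue. f x = g x" "AE x in lebesgue. g x = h x"
    then show "AE x in lebesgue. f x = h x" by eventually_elim simp
  qed
qed

instantiation l2 :: (euclidean_space) real_vector
begin

lift_definition zero_l2 :: "'a l2" is "\<lambda>x. 0" by simp

lift_definition plus_l2 :: "'a l2 \<Rightarrow> 'a l2 \<Rightarrow> 'a l2" is "\<lambda>f g x. f x + g x"
  by (auto intro: sq_integrable_add)

lift_definition minus_l2 :: "'a l2 \<Rightarrow> 'a l2 \<Rightarrow> 'a l2" is "\<lambda>f g x. f x - g x"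
  by (auto intro: sq_integrable_diff)

lift_definition uminus_l2 :: "'a l2 \<Rightarrow> 'a l2" is "\<lambda>f x. - f x"
  by (auto intro: sq_integrable_minus)

lift_definition scaleR_l2 :: "real \<Rightarrow> 'a l2 \<Rightarrow> 'a l2" is "\<lambda>r f x. of_real r * f x"
  by (auto intro: sq_integrable_cmult)

instance
proof
  fix x y z :: "'a l2" and a b :: real
  note sq = sq_integrable_add sq_integrable_cmult sq_integrable_minus sq_integrable_diff
  show "x + y + z = x + (y + z)" by transfer (simp add: sq add.assoc)
  show "x + y = y + x" by transfer (simp add: sq add.commute)
  show "0 + x = x" by transfer simp
  show "- x + x = 0" by transfer simp
  show "x - y = x + - y" by transfer (simp add: sq)
  show "a *\<^sub>R (x + y) = a *\<^sub>R x + a *\<^sub>R y" by transfer (simp add: sq distrib_left)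
  show "(a + b) *\<^sub>R x = a *\<^sub>R x + b *\<^sub>R x" by transfer (simp add: sq distrib_right)
  show "a *\<^sub>R b *\<^sub>R x = (a * b) *\<^sub>R x" by transfer (simp add: sq mult.assoc)
  show "1 *\<^sub>R x = x" by transfer simp
qed

end

instantiation l2 :: (euclidean_space) real_inner
begin

lift_definition inner_l2 :: "'a l2 \<Rightarrow> 'a l2 \<Rightarrow> real" is "\<lambda>f g. Re (LINT x|lebesgue. f x * cnj (g x))"
proof -
  fix f f' g g' :: "'a \<Rightarrow> complex"
  assume a: "sq_integrable lebesgue f \<and> sq_integrable lebesgue f' \<and> (AE x in lebesgue. f x = f' x)"
    "sq_integrable lebesgue g \<and> sq_integrable lebesgue g' \<and> (AE x in lebesgue. g x = g' x)"
  have "(LINT x|lebesgue. f x * cnj (g x)) = (LINT x|lebesgue. f' x * cnj (g' x))"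
    by (rule integral_cong_AE) (use a in \<open>auto intro!: borel_measurable_integrable sq_integrable_mult_cnj_integrable\<close>)
  then show "Re (LINT x|lebesgue. f x * cnj (g x)) = Re (LINT x|lebesgue. f' x * cnj (g' x))" by simp
qed

definition norm_l2 :: "'a l2 \<Rightarrow> real" where "norm_l2 x = sqrt (inner x x)"
definition sgn_l2 :: "'a l2 \<Rightarrow> 'a l2" where "sgn_l2 x = x /\<^sub>R norm x"
definition dist_l2 :: "'a l2 \<Rightarrow> 'a l2 \<Rightarrow> real" where "dist_l2 x y = norm (x - y)"
definition uniformity_l2 :: "('a l2 \<times> 'a l2) filter" where
  "uniformity_l2 = (INF e\<in>{0<..}. principal {(x, y). dist x y < e})"
definition open_l2 :: "'a l2 set \<Rightarrow> bool" where
  "open_l2 U \<longleftrightarrow> (\<forall>x\<in>U. eventually (\<lambda>(x', y). x' = x \<longrightarrow> y \<in> U) uniformity)"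

instance
proof
  fix x y z :: "'a l2" and r :: real
  show "inner x y = inner y x"
  proof transfer
    fix f g :: "'a \<Rightarrow> complex"
    have "(LINT x|lebesgue. g x * cnj (f x)) = (LINT x|lebesgue. cnj (f x * cnj (g x)))" by (simp add: mult.commute)
    also have "\<dots> = cnj (LINT x|lebesgue. f x * cnj (g x))" by (simp del: complex_cnj_mult)
    finally show "Re (LINT x|lebesgue. f x * cnj (g x)) = Re (LINT x|lebesgue. g x * cnj (f x))" by simp
  qed
  show "inner (x + y) z = inner x z + inner y z"
    by transfer (simp add: distrib_right sq_integrable_mult_cnj_integrable)
  show "inner (r *\<^sub>R x) y = r * inner x y"
    by transfer (simp add: mult.assoc)
  have sq: "Re (LINT x|lebesgue. f x * cnj (f x)) = (LINT x|lebesgue. (norm (f x))\<^sup>2)" for f :: "'a \<Rightarrow> complex"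
    by (simp add: complex_norm_square[symmetric] flip: of_real_power)
  show "0 \<le> inner x x" by transfer (simp only: sq, simp)
  show "inner x x = 0 \<longleftrightarrow> x = 0"
    by transfer (simp only: sq, simp add: sq_integrable_def integral_nonneg_eq_0_iff_AE)
qed (simp_all add: norm_l2_def sgn_l2_def dist_l2_def uniformity_l2_def open_l2_def)

end

section \<open>Calculus with representatives of L_2 classes\<close>

lemma abs_l2_cases:
  obtains f where "sq_integrable lebesgue f" "x = abs_l2 f"
  by (induction x rule: l2.abs_induct) auto

lemma abs_l2_eq_iff:
  "sq_integrable lebesgue f \<Longrightarrow> sq_integrable lebesgue g \<Longrightarrow>
    abs_l2 f = abs_l2 g \<longleftrightarrow> (AE x in lebesgue. f x = g x)"
  using Quotient3_rel[OF Quotient3_l2, of f g] by blast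

lemma abs_l2_add: "sq_integrable lebesgue f \<Longrightarrow> sq_integrable lebesgue g \<Longrightarrow>
    abs_l2 (\<lambda>x. f x + g x) = abs_l2 f + abs_l2 g"
  by (simp add: plus_l2.abs_eq)

lemma abs_l2_diff: "sq_integrable lebesgue f \<Longrightarrow> sq_integrable lebesgue g \<Longrightarrow>
    abs_l2 (\<lambda>x. f x - g x) = abs_l2 f - abs_l2 g"
  by (simp add: minus_l2.abs_eq)

lemma abs_l2_scaleR: "sq_integrable lebesgue f \<Longrightarrow> abs_l2 (\<lambda>x. of_real r * f x) = r *\<^sub>R abs_l2 f"
  by (simp add: scaleR_l2.abs_eq)

lemma abs_l2_zero: "abs_l2 (\<lambda>x. 0) = 0"
  by (simp add: zero_l2_def)

lemma abs_l2_inner: "sq_integrable lebesgue f \<Longrightarrow> sq_integrable lebesgue g \<Longrightarrow>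
    abs_l2 f \<bullet> abs_l2 g = Re (LINT x|lebesgue. f x * cnj (g x))"
  by (simp add: inner_l2.abs_eq)

lemma abs_l2_norm2: "sq_integrable lebesgue f \<Longrightarrow> (norm (abs_l2 f))\<^sup>2 = (LINT x|lebesgue. (norm (f x))\<^sup>2)"
  by (simp add: power2_norm_eq_inner abs_l2_inner complex_norm_square[symmetric] flip: of_real_power)

lemma abs_l2_norm: "sq_integrable lebesgue f \<Longrightarrow> norm (abs_l2 f) = sqrt (LINT x|lebesgue. (norm (f x))\<^sup>2)"
  using abs_l2_norm2[of f] by (metis norm_ge_zero real_sqrt_unique)

lemma abs_l2_nn_norm: "sq_integrable lebesgue f \<Longrightarrow>
   (\<integral>\<^sup>+ x. ennreal ((norm (f x))\<^sup>2) \<partial>lebesgue) = ennreal ((norm (abs_l2 f))\<^sup>2)"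
  unfolding abs_l2_norm2 by (rule nn_integral_eq_integral) (auto simp: sq_integrable_def)

text \<open>The Riesz-Fischer argument. The sums of |f (n+1) - f n| have norm at most 2, so monotone
  convergence makes them finite almost everywhere and f n converges pointwise; Fatou's lemma then
  estimates the distance to the pointwise limit.\<close>

lemma l2_convergent_of_summable_steps:
  fixes X :: "nat \<Rightarrow> 'a::euclidean_space l2"
  assumes step: "\<And>n. norm (X (Suc n) - X n) \<le> (1/2)^n"
  shows "convergent X"
proof -
  have "\<forall>n. \<exists>f. sq_integrable lebesgue f \<and> X n = abs_l2 f" by (meson abs_l2_cases)
  then obtain f where f: "\<And>n. sq_integrable lebesgue (f n)" and Xf: "\<And>n. X n = abs_l2 (f n)" by metis
  have [measurable]: "\<And>n. f n \<in> borel_measurable lebesgue" using f sq_integrable_measurable by blast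
  \<comment> \<open>The moduli are taken as complex functions so that they have classes in
    \<open>l2\<close> and its triangle inequality applies to their sums.\<close>
  define D where "D n x = complex_of_real (norm (f (Suc n) x - f n x))" for n x
  have D: "sq_integrable lebesgue (D n)" for n
    unfolding D_def[abs_def]
    by (rule sq_integrable_bound[where g = "\<lambda>x. f (Suc n) x - f n x" and C = 1])
      (auto intro!: sq_integrable_diff f)
  have Dn: "norm (abs_l2 (D n)) \<le> (1/2)^n" for n
    using step[of n] unfolding Xf abs_l2_diff[OF f f, symmetric]
    by (simp add: abs_l2_norm D f sq_integrable_diff) (simp add: D_def)
  define G where "G N x = (\<Sum>n<N. D n x)" for N x
  have G: "sq_integrable lebesgue (G N)" for N
    unfolding G_def by (intro sq_integrable_sum D)
  have G2: "norm (abs_l2 (G N)) \<le> 2" for N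
  proof -
    have "norm (abs_l2 (G N)) \<le> (\<Sum>n<N. (1/2)^n)"
    proof (induction N)
      case 0 then show ?case by (simp add: G_def abs_l2_zero)
    next
      case (Suc N)
      have "abs_l2 (G (Suc N)) = abs_l2 (G N) + abs_l2 (D N)"
        using abs_l2_add[OF G D, of N N] by (simp add: G_def[abs_def])
      then show ?case using Suc Dn[of N] norm_triangle_ineq[of "abs_l2 (G N)" "abs_l2 (D N)"] by simp
    qed
    also have "\<dots> = 2 - 2 * (1/2)^N" by (induction N) auto
    also have "\<dots> \<le> 2" by simp
    finally show ?thesis .
  qed
  define g where "g N x = (\<Sum>n<N. norm (f (Suc n) x - f n x))" for N x
  have Gg: "norm (G N x) = g N x" for N x
    by (simp add: G_def g_def D_def flip: of_real_sum) (simp add: sum_nonneg)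
  have g0: "0 \<le> g N x" for N x by (simp add: g_def sum_nonneg)
  have gint: "(\<integral>\<^sup>+x. ennreal ((g N x)\<^sup>2) \<partial>lebesgue) \<le> 4" for N
  proof -
    have "(\<integral>\<^sup>+x. ennreal ((g N x)\<^sup>2) \<partial>lebesgue) = ennreal ((norm (abs_l2 (G N)))\<^sup>2)"
      using abs_l2_nn_norm[OF G, of N] by (simp add: Gg)
    also have "\<dots> \<le> ennreal (2\<^sup>2)" by (intro ennreal_leI power_mono G2) auto
    finally show ?thesis by simp
  qed
  have [measurable]: "g N \<in> borel_measurable lebesgue" for N unfolding g_def by measurable
  have inc: "incseq (\<lambda>N x. ennreal ((g N x)\<^sup>2))"
    by (intro incseq_SucI le_funI ennreal_leI power_mono) (auto simp: g0, simp add: g_def)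
  have "(\<integral>\<^sup>+x. (SUP N. ennreal ((g N x)\<^sup>2)) \<partial>lebesgue) \<le> 4"
    by (subst nn_integral_monotone_convergence_SUP[OF inc]) (auto intro!: SUP_least gint)
  then have "AE x in lebesgue. (SUP N. ennreal ((g N x)\<^sup>2)) \<noteq> \<infinity>"
    by (intro nn_integral_noteq_infinite) (auto simp: top_unique)
  then have conv: "AE x in lebesgue. convergent (\<lambda>n. f n x)"
  proof eventually_elim
    case (elim x)
    then obtain K where K: "0 \<le> K" "(SUP N. ennreal ((g N x)\<^sup>2)) = ennreal K"
      by (metis ennreal_cases infinity_ennreal_def)
    have "g N x \<le> sqrt K" for N
    proof -
      have "ennreal ((g N x)\<^sup>2) \<le> ennreal K" unfolding K(2)[symmetric] by (rule SUP_upper) simp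
      then show ?thesis using K(1) by (simp add: real_le_rsqrt)
    qed
    then have "summable (\<lambda>n. norm (f (Suc n) x - f n x))"
      by (intro summableI_nonneg_bounded[where x = "sqrt K"]) (auto simp: g_def)
    then have "summable (\<lambda>n. f (Suc n) x - f n x)" by (rule summable_norm_cancel)
    then have "convergent (\<lambda>N. (\<Sum>n<N. f (Suc n) x - f n x))" by (simp add: summable_iff_convergent)
    then have "convergent (\<lambda>N. f N x - f 0 x)" by (simp only: sum_lessThan_telescope[of "\<lambda>n. f n x"])
    then have "convergent (\<lambda>N. (f N x - f 0 x) + f 0 x)" by (intro convergent_add convergent_const)
    then show ?case by (simp only: diff_add_cancel)
  qed
  define h where "h x = lim (\<lambda>n. f n x)" for x
  have [measurable]: "h \<in> borel_measurable lebesgue" unfolding h_def by measurable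
  have lim: "AE x in lebesgue. (\<lambda>n. f n x) \<longlonglongrightarrow> h x"
    using conv by eventually_elim (simp add: h_def convergent_LIMSEQ_iff)
  have tail: "norm (X m - X n) \<le> 2 * (1/2)^n" if "n \<le> m" for m n
  proof -
    \<comment> \<open>The subtracted term in m makes the induction over m close.\<close>
    have "norm (X m - X n) \<le> 2 * (1/2)^n - 2 * (1/2)^m"
      using that
    proof (induction m rule: dec_induct)
      case (step m)
      have "norm (X (Suc m) - X n) \<le> norm (X (Suc m) - X m) + norm (X m - X n)"
        using norm_triangle_ineq[of "X (Suc m) - X m" "X m - X n"] by simp
      then show ?case using step assms[of m] by simp
    qed simp
    also have "\<dots> \<le> 2 * (1/2)^n" by simp
    finally show ?thesis .
  qed
  have fatou: "(\<integral>\<^sup>+x. ennreal ((norm (h x - f n x))\<^sup>2) \<partial>lebesgue) \<le> ennreal ((2 * (1/2)^n)\<^sup>2)" for n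
  proof -
    have "(\<integral>\<^sup>+x. ennreal ((norm (h x - f n x))\<^sup>2) \<partial>lebesgue)
        = (\<integral>\<^sup>+x. liminf (\<lambda>m. ennreal ((norm (f m x - f n x))\<^sup>2)) \<partial>lebesgue)"
    proof (rule nn_integral_cong_AE)
      show "AE x in lebesgue. ennreal ((norm (h x - f n x))\<^sup>2) = liminf (\<lambda>m. ennreal ((norm (f m x - f n x))\<^sup>2))"
        using lim
      proof eventually_elim
        case (elim x)
        have "(\<lambda>m. ennreal ((norm (f m x - f n x))\<^sup>2)) \<longlonglongrightarrow> ennreal ((norm (h x - f n x))\<^sup>2)"
          by (intro tendsto_ennrealI tendsto_intros elim)
        then show ?case by (intro lim_imp_Liminf[symmetric]) auto
      qed
    qed
    also have "\<dots> \<le> liminf (\<lambda>m. \<integral>\<^sup>+x. ennreal ((norm (f m x - f n x))\<^sup>2) \<partial>lebesgue)"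
      by (rule nn_integral_liminf) measurable
    also have "\<dots> \<le> ennreal ((2 * (1/2)^n)\<^sup>2)"
    proof (rule Liminf_le)
      show "\<forall>\<^sub>F m in sequentially. (\<integral>\<^sup>+x. ennreal ((norm (f m x - f n x))\<^sup>2) \<partial>lebesgue) \<le> ennreal ((2 * (1/2)^n)\<^sup>2)"
        using eventually_ge_at_top[of n]
      proof eventually_elim
        case (elim m)
        have "(\<integral>\<^sup>+x. ennreal ((norm (f m x - f n x))\<^sup>2) \<partial>lebesgue) = ennreal ((norm (X m - X n))\<^sup>2)"
          by (simp add: Xf abs_l2_nn_norm f sq_integrable_diff flip: abs_l2_diff)
        also have "\<dots> \<le> ennreal ((2 * (1/2)^n)\<^sup>2)" by (intro ennreal_leI power_mono tail elim) auto
        finally show ?case .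
      qed
    qed auto
    finally show ?thesis .
  qed
  have hf: "sq_integrable lebesgue (\<lambda>x. h x - f n x)" for n
    unfolding sq_integrable_def
  proof
    show "(\<lambda>x. h x - f n x) \<in> borel_measurable lebesgue" by measurable
    show "integrable lebesgue (\<lambda>x. (norm (h x - f n x))\<^sup>2)"
      by (rule integrableI_nonneg) (use fatou[of n] in \<open>auto simp: less_top[symmetric] top_unique\<close>)
  qed
  have h: "sq_integrable lebesgue h" using sq_integrable_add[OF hf[of 0] f[of 0]] by simp
  have le: "norm (abs_l2 h - X n) \<le> 2 * (1/2)^n" for n
  proof -
    have "ennreal ((norm (abs_l2 h - X n))\<^sup>2) \<le> ennreal ((2 * (1/2)^n)\<^sup>2)"
      using fatou[of n] by (simp add: Xf abs_l2_nn_norm hf h f flip: abs_l2_diff)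
    then have "(norm (abs_l2 h - X n))\<^sup>2 \<le> (2 * (1/2)^n)\<^sup>2" by (subst (asm) ennreal_le_iff) auto
    then show ?thesis by (rule power2_le_imp_le) simp
  qed
  have "(\<lambda>n. X n - abs_l2 h) \<longlonglongrightarrow> 0"
  proof (rule Lim_null_comparison)
    show "\<forall>\<^sub>F n in sequentially. norm (X n - abs_l2 h) \<le> 2 * (1/2)^n"
      by (intro always_eventually allI) (subst norm_minus_commute, rule le)
    show "(\<lambda>n. 2 * (1/2::real)^n) \<longlonglongrightarrow> 0" by (intro tendsto_mult_right_zero LIMSEQ_power_zero) simp
  qed
  then have "X \<longlonglongrightarrow> abs_l2 h" by (simp add: LIM_zero_iff)
  then show ?thesis by (rule convergentI)
qed

instance l2 :: (euclidean_space) complete_space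
proof
  fix X :: "nat \<Rightarrow> 'a l2" assume X: "Cauchy X"
  have "\<forall>n. \<exists>N. \<forall>i\<ge>N. \<forall>j\<ge>N. norm (X i - X j) < (1/2)^n"
    using CauchyD[OF X] by simp
  then obtain N where N: "\<And>n i j. i \<ge> N n \<Longrightarrow> j \<ge> N n \<Longrightarrow> norm (X i - X j) < (1/2)^n" by metis
  \<comment> \<open>The sum dominates N n, and the summand n makes r strictly increasing.\<close>
  define r where "r n = (\<Sum>i\<le>n. N i) + n" for n
  have r: "strict_mono r" unfolding strict_mono_Suc_iff r_def by simp
  have rN: "N n \<le> r n" for n
    using member_le_sum[of n "{..n}" N] by (simp add: r_def)
  have "convergent (X \<circ> r)"
  proof (rule l2_convergent_of_summable_steps)
    show "norm ((X \<circ> r) (Suc n) - (X \<circ> r) n) \<le> (1/2)^n" for n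
    proof -
      have "r n \<le> r (Suc n)" using r by (simp add: strict_mono_less_eq)
      then have "N n \<le> r (Suc n)" using rN[of n] by simp
      then show ?thesis using N[of n "r (Suc n)" "r n"] rN[of n] by simp
    qed
  qed
  then obtain l where "(X \<circ> r) \<longlonglongrightarrow> l" by (auto simp: convergent_def)
  then show "convergent X" using Cauchy_converges_subseq[OF X r] by (auto simp: convergent_def)
qed

text \<open>The default 0 for an unbounded or non-measurable multiplier makes the map total: without
  such a guard the product may leave L_2.\<close>

lift_definition mult_l2 :: "('a::euclidean_space \<Rightarrow> real) \<Rightarrow> 'a l2 \<Rightarrow> 'a l2" is
  "\<lambda>\<psi> f x. if \<psi> \<in> borel_measurable lebesgue \<and> bounded (range \<psi>) then of_real (\<psi> x) * f x else 0"
proof -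
  fix \<psi> :: "'a \<Rightarrow> real" and f g :: "'a \<Rightarrow> complex"
  assume a: "sq_integrable lebesgue f \<and> sq_integrable lebesgue g \<and> (AE x in lebesgue. f x = g x)"
  show "sq_integrable lebesgue (\<lambda>x. if \<psi> \<in> borel_measurable lebesgue \<and> bounded (range \<psi>) then of_real (\<psi> x) * f x else 0)
    \<and> sq_integrable lebesgue (\<lambda>x. if \<psi> \<in> borel_measurable lebesgue \<and> bounded (range \<psi>) then of_real (\<psi> x) * g x else 0)
    \<and> (AE x in lebesgue. (if \<psi> \<in> borel_measurable lebesgue \<and> bounded (range \<psi>) then of_real (\<psi> x) * f x else 0)
       = (if \<psi> \<in> borel_measurable lebesgue \<and> bounded (range \<psi>) then of_real (\<psi> x) * g x else 0))"
  proof (cases "\<psi> \<in> borel_measurable lebesgue \<and> bounded (range \<psi>)")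
    case True
    then obtain C where "\<And>x. norm (\<psi> x) \<le> C" by (auto simp: bounded_iff)
    then have "sq_integrable lebesgue (\<lambda>x. of_real (\<psi> x) * f x)" "sq_integrable lebesgue (\<lambda>x. of_real (\<psi> x) * g x)"
      using a True by (auto intro!: sq_integrable_bounded_mult[where C = C])
    moreover have "AE x in lebesgue. of_real (\<psi> x) * f x = of_real (\<psi> x) * g x" using a by auto
    ultimately show ?thesis using True by simp
  qed auto
qed

lemma mult_l2_abs:
  assumes "sq_integrable lebesgue f" "\<psi> \<in> borel_measurable lebesgue" "bounded (range \<psi>)"
  shows "mult_l2 \<psi> (abs_l2 f) = abs_l2 (\<lambda>x. of_real (\<psi> x) * f x)"
  using assms by (subst mult_l2.abs_eq) auto

text \<open>Realises L_2 of S as the subspace of \<open>l2\<close> of classes vanishing outside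
  S.\<close>

definition emb :: "'a::euclidean_space set \<Rightarrow> ('a \<Rightarrow> complex) \<Rightarrow> 'a l2" where
  "emb S f = abs_l2 (\<lambda>x. if x \<in> S then f x else 0)"

lemma sq_integrable_extend:
  assumes S: "S \<in> sets lebesgue" 
  shows "sq_integrable lebesgue (\<lambda>x. if x \<in> S then f x else 0) \<longleftrightarrow> sq_integrable (lebesgue_on S) f"
proof -
  have *: "(norm (if x \<in> S then f x else 0))\<^sup>2 = (if x \<in> S then (norm (f x))\<^sup>2 else 0)" for x by simp
  show ?thesis unfolding sq_integrable_def * by (simp add: borel_measurable_if Lebesgue_Measure.integrable_restrict_UNIV S)
qed

lemma emb_eq_iff:
  assumes "S \<in> sets lebesgue" "sq_integrable (lebesgue_on S) f" "sq_integrable (lebesgue_on S) g"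
  shows "emb S f = emb S g \<longleftrightarrow> (AE x in lebesgue_on S. f x = g x)"
  unfolding emb_def using assms
  by (subst abs_l2_eq_iff) (auto simp: sq_integrable_extend AE_restrict_space_iff intro!: eventually_cong)

lemma emb_add:
  assumes "S \<in> sets lebesgue" "sq_integrable (lebesgue_on S) f" "sq_integrable (lebesgue_on S) g"
  shows "emb S (\<lambda>x. f x + g x) = emb S f + emb S g"
  unfolding emb_def using assms
  by (subst abs_l2_add[symmetric]) (auto simp: sq_integrable_extend intro!: arg_cong[where f = abs_l2])

lemma emb_diff:
  assumes "S \<in> sets lebesgue" "sq_integrable (lebesgue_on S) f" "sq_integrable (lebesgue_on S) g"
  shows "emb S (\<lambda>x. f x - g x) = emb S f - emb S g"
  unfolding emb_def using assms
  by (subst abs_l2_diff[symmetric]) (auto simp: sq_integrable_extend intro!: arg_cong[where f = abs_l2])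

lemma emb_scaleR:
  assumes "S \<in> sets lebesgue" "sq_integrable (lebesgue_on S) f"
  shows "emb S (\<lambda>x. of_real r * f x) = r *\<^sub>R emb S f"
  unfolding emb_def using assms
  by (subst abs_l2_scaleR[symmetric]) (auto simp: sq_integrable_extend intro!: arg_cong[where f = abs_l2])

lemma emb_zero: "emb S (\<lambda>x. 0) = 0"
  by (simp add: emb_def abs_l2_zero)

lemma emb_inner:
  assumes S: "S \<in> sets lebesgue" and fg: "sq_integrable (lebesgue_on S) f" "sq_integrable (lebesgue_on S) g"
  shows "emb S f \<bullet> emb S g = Re (L2_inner S f g)"
proof -
  have *: "(if x \<in> S then f x else 0) * cnj (if x \<in> S then g x else 0) = (if x \<in> S then f x * cnj (g x) else 0)" for x
    by simp
  show ?thesis unfolding emb_def L2_inner_def using S fg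
    by (subst abs_l2_inner) (simp_all add: sq_integrable_extend * Lebesgue_Measure.integral_restrict_UNIV)
qed

lemma emb_norm:
  assumes S: "S \<in> sets lebesgue" and f: "sq_integrable (lebesgue_on S) f"
  shows "norm (emb S f) = L2_norm S f"
proof -
  have *: "(norm (if x \<in> S then f x else 0))\<^sup>2 = (if x \<in> S then (norm (f x))\<^sup>2 else 0)" for x by simp
  show ?thesis unfolding emb_def L2_norm_def using S f
    by (subst abs_l2_norm) (simp_all add: sq_integrable_extend * Lebesgue_Measure.integral_restrict_UNIV)
qed

lemma mult_l2_emb:
  assumes "S \<in> sets lebesgue" "sq_integrable (lebesgue_on S) f" "\<psi> \<in> borel_measurable lebesgue" "bounded (range \<psi>)"
  shows "mult_l2 \<psi> (emb S f) = emb S (\<lambda>x. of_real (\<psi> x) * f x)"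
  unfolding emb_def using assms
  by (subst mult_l2_abs) (auto simp: sq_integrable_extend intro!: arg_cong[where f = abs_l2])

lemma L2_norm_triangle:
  assumes "S \<in> sets lebesgue" "sq_integrable (lebesgue_on S) f" "sq_integrable (lebesgue_on S) g"
  shows "L2_norm S (\<lambda>x. f x + g x) \<le> L2_norm S f + L2_norm S g"
  using norm_triangle_ineq[of "emb S f" "emb S g"] assms
  by (simp add: emb_norm sq_integrable_add flip: emb_add)

lemma L2_norm_nonneg [simp]: "0 \<le> L2_norm S f"
  by (simp add: L2_norm_def)

lemma L2_norm_mono:
  assumes f: "f \<in> borel_measurable (lebesgue_on S)" and g: "sq_integrable (lebesgue_on S) g"
    and le: "AE x in lebesgue_on S. norm (f x) \<le> C * norm (g x)" and C: "C \<ge> 0"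
  shows "L2_norm S f \<le> C * L2_norm S g"
proof -
  have "(LINT x|lebesgue_on S. (norm (f x))\<^sup>2) \<le> (LINT x|lebesgue_on S. C\<^sup>2 * (norm (g x))\<^sup>2)"
  proof (rule integral_mono_AE)
    show "integrable (lebesgue_on S) (\<lambda>x. (norm (f x))\<^sup>2)"
      using sq_integrable_bound[OF g f le] by (simp add: sq_integrable_def)
    show "integrable (lebesgue_on S) (\<lambda>x. C\<^sup>2 * (norm (g x))\<^sup>2)" using g by (simp add: sq_integrable_def)
    show "AE x in lebesgue_on S. (norm (f x))\<^sup>2 \<le> C\<^sup>2 * (norm (g x))\<^sup>2"
      using le by eventually_elim (auto simp flip: power_mult_distrib intro!: power_mono)
  qed
  then have "L2_norm S f \<le> sqrt (C\<^sup>2 * (LINT x|lebesgue_on S. (norm (g x))\<^sup>2))"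
    unfolding L2_norm_def by simp
  then show ?thesis using C by (simp add: L2_norm_def real_sqrt_mult)
qed

text \<open>The inner product of \<open>l2\<close> sees only real parts. Replacing both functions by
  their moduli dominates the complex integral by a real inner product with the same norms.\<close>

lemma Cauchy_Schwarz_L2:
  assumes S: "S \<in> sets lebesgue" and fg: "sq_integrable (lebesgue_on S) f" "sq_integrable (lebesgue_on S) g"
  shows "norm (LINT x|lebesgue_on S. f x * g x) \<le> L2_norm S f * L2_norm S g"
proof -
  let ?n = "\<lambda>h x. complex_of_real (norm (h x))"
  have n: "sq_integrable (lebesgue_on S) (?n h)" if "sq_integrable (lebesgue_on S) h" for h
    by (rule sq_integrable_bound[OF that, of _ 1]) (use that in auto)
  have "norm (LINT x|lebesgue_on S. f x * g x) \<le> (LINT x|lebesgue_on S. norm (f x * g x))"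
    by (rule integral_norm_bound)
  also have "\<dots> = Re (L2_inner S (?n f) (?n g))"
    unfolding L2_inner_def by (simp add: norm_mult flip: of_real_mult)
  also have "\<dots> = emb S (?n f) \<bullet> emb S (?n g)" by (simp add: emb_inner S n fg)
  also have "\<dots> \<le> norm (emb S (?n f)) * norm (emb S (?n g))" by (rule norm_cauchy_schwarz)
  also have "\<dots> = L2_norm S f * L2_norm S g" by (simp add: emb_norm S n fg) (simp add: L2_norm_def)
  finally show ?thesis .
qed

section \<open>Smooth functions and test functions\<close>

definition smooth :: "('a::euclidean_space \<Rightarrow> complex) \<Rightarrow> bool" where
  "smooth f \<longleftrightarrow> (\<forall>k. Ck k f)"

lemma partial_deriv_eqI: "(f has_derivative D) (at x) \<Longrightarrow> partial_deriv b f x = D b"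
  unfolding partial_deriv_def by (simp add: frechet_derivative_at[symmetric])

lemma has_derivative_partial:
  "f differentiable_on UNIV \<Longrightarrow> (f has_derivative (\<lambda>b. partial_deriv b f x)) (at x)"
  unfolding partial_deriv_def by (simp add: differentiable_on_def frechet_derivative_works)

lemma differentiable_on_UNIV_I: "(\<And>x. (f has_derivative D x) (at x)) \<Longrightarrow> f differentiable_on UNIV"
  by (auto simp: differentiable_on_def differentiable_def)

lemma Ck_Suc_D: "Ck (Suc k) f \<Longrightarrow> Ck k f"
  by (induction k arbitrary: f) (auto simp: differentiable_imp_continuous_on)

lemma smooth_iff: "smooth f \<longleftrightarrow> f differentiable_on UNIV \<and> (\<forall>b\<in>Basis. smooth (partial_deriv b f))"
proof
  assume "smooth f"
  then have "Ck (Suc k) f" for k unfolding smooth_def by blast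
  then show "f differentiable_on UNIV \<and> (\<forall>b\<in>Basis. smooth (partial_deriv b f))"
    unfolding smooth_def by simp
next
  assume "f differentiable_on UNIV \<and> (\<forall>b\<in>Basis. smooth (partial_deriv b f))"
  then have "Ck (Suc k) f" for k unfolding smooth_def by simp
  then show "smooth f" unfolding smooth_def using Ck_Suc_D by blast
qed

lemma smooth_differentiable: "smooth f \<Longrightarrow> f differentiable_on UNIV"
  and smooth_partial: "smooth f \<Longrightarrow> b \<in> Basis \<Longrightarrow> smooth (partial_deriv b f)"
  using smooth_iff by blast+

lemma smooth_continuous: "smooth f \<Longrightarrow> continuous_on UNIV f"
  by (simp add: smooth_differentiable differentiable_imp_continuous_on)

lemma smooth_measurable: "smooth f \<Longrightarrow> f \<in> borel_measurable lebesgue"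
  using borel_measurable_continuous_onI[OF smooth_continuous, of f] by (simp add: measurable_completion)

lemma smooth_has_derivative: "smooth f \<Longrightarrow> (f has_derivative (\<lambda>b. partial_deriv b f x)) (at x)"
  by (simp add: smooth_differentiable has_derivative_partial)

lemma smooth_coinduct:
  assumes "f \<in> S" and diff: "\<And>f. f \<in> S \<Longrightarrow> f differentiable_on UNIV"
    and step: "\<And>f b. f \<in> S \<Longrightarrow> b \<in> Basis \<Longrightarrow> partial_deriv b f \<in> S"
  shows "smooth f"
proof -
  have "f \<in> S \<Longrightarrow> Ck k f" for k f
    by (induction k arbitrary: f) (auto simp: diff step differentiable_imp_continuous_on)
  then show ?thesis using assms(1) by (simp add: smooth_def)
qed

section \<open>Rules for partial derivatives and closure properties of smooth functions\<close>

lemma partial_deriv_const: "partial_deriv b (\<lambda>x. c) = (\<lambda>x. 0)"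
  by (rule ext, rule partial_deriv_eqI) (rule has_derivative_const)

lemma partial_deriv_add:
  assumes "f differentiable_on UNIV" "g differentiable_on UNIV"
  shows "partial_deriv b (\<lambda>x. f x + g x) = (\<lambda>x. partial_deriv b f x + partial_deriv b g x)"
  by (rule ext, rule partial_deriv_eqI)
    (intro has_derivative_add has_derivative_partial assms)

lemma partial_deriv_mult:
  assumes "f differentiable_on UNIV" "g differentiable_on UNIV"
  shows "partial_deriv b (\<lambda>x. f x * g x) = (\<lambda>x. f x * partial_deriv b g x + partial_deriv b f x * g x)"
  by (rule ext, rule partial_deriv_eqI)
    (intro has_derivative_mult has_derivative_partial assms)

lemma partial_deriv_cnj:
  assumes "f differentiable_on UNIV"
  shows "partial_deriv b (\<lambda>x. cnj (f x)) = (\<lambda>x. cnj (partial_deriv b f x))"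
  by (rule ext, rule partial_deriv_eqI)
    (intro bounded_linear.has_derivative[OF bounded_linear_cnj] has_derivative_partial assms)

lemma differentiable_cnj:
  fixes f :: "'a::euclidean_space \<Rightarrow> complex"
  shows "f differentiable_on UNIV \<Longrightarrow> (\<lambda>x. cnj (f x)) differentiable_on UNIV"
  by (rule differentiable_on_UNIV_I[OF bounded_linear.has_derivative[OF bounded_linear_cnj has_derivative_partial]])

lemma Ck_const: "Ck k (\<lambda>x. c)"
proof -
  have "smooth (\<lambda>x::'a. c)"
    by (rule smooth_coinduct[of _ "range (\<lambda>c x. c)"]) (auto simp: partial_deriv_const)
  then show ?thesis by (simp add: smooth_def)
qed

lemma Ck_add: "Ck k f \<Longrightarrow> Ck k g \<Longrightarrow> Ck k (\<lambda>x. f x + g x)"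
  by (induction k arbitrary: f g) (auto simp: partial_deriv_add intro!: continuous_intros)

lemma Ck_mult: "Ck k f \<Longrightarrow> Ck k g \<Longrightarrow> Ck k (\<lambda>x. f x * g x)"
proof (induction k arbitrary: f g)
  case (Suc k)
  have "Ck k f" "Ck k g" using Suc.prems Ck_Suc_D by blast+
  with Suc show ?case by (auto simp: partial_deriv_mult intro!: Ck_add)
qed (auto intro!: continuous_intros)

lemma Ck_cnj: "Ck k f \<Longrightarrow> Ck k (\<lambda>x. cnj (f x))"
  by (induction k arbitrary: f) (auto simp: partial_deriv_cnj differentiable_cnj intro!: continuous_intros)

text \<open>The derivative of 1/f contains 1/f itself only undifferentiated, and there the induction
  hypothesis supplies the order k.\<close>

lemma Ck_inverse: "Ck k f \<Longrightarrow> (\<And>x. f x \<noteq> 0) \<Longrightarrow> Ck k (\<lambda>x. inverse (f x))"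
proof (induction k)
  case (Suc k)
  have f: "f differentiable_on UNIV" "\<And>b. b \<in> Basis \<Longrightarrow> Ck k (partial_deriv b f)" using Suc.prems by auto
  have d: "((\<lambda>x. inverse (f x)) has_derivative (\<lambda>h. - (inverse (f x) * partial_deriv h f x * inverse (f x)))) (at x)" for x
    using Deriv.has_derivative_inverse[OF Suc.prems(2) has_derivative_partial[OF f(1)]] .
  have inv: "Ck k (\<lambda>x. inverse (f x))" using Suc Ck_Suc_D by blast
  have "Ck k (partial_deriv b (\<lambda>x. inverse (f x)))" if b: "b \<in> Basis" for b
  proof -
    have "partial_deriv b (\<lambda>x. inverse (f x)) = (\<lambda>x. (-1) * (inverse (f x) * partial_deriv b f x * inverse (f x)))"
      by (rule ext) (simp add: partial_deriv_eqI[OF d])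
    then show ?thesis using inv f(2)[OF b] by (simp only:) (intro Ck_mult Ck_const)
  qed
  then show ?case using differentiable_on_UNIV_I[OF d] by simp
qed (auto intro!: continuous_intros)

lemma smooth_const [simp]: "smooth (\<lambda>x. c)"
  by (simp add: smooth_def Ck_const)

lemma smooth_add: "smooth f \<Longrightarrow> smooth g \<Longrightarrow> smooth (\<lambda>x. f x + g x)"
  by (simp add: smooth_def Ck_add)

lemma smooth_mult: "smooth f \<Longrightarrow> smooth g \<Longrightarrow> smooth (\<lambda>x. f x * g x)"
  by (simp add: smooth_def Ck_mult)

lemma smooth_inverse: "smooth f \<Longrightarrow> (\<And>x. f x \<noteq> 0) \<Longrightarrow> smooth (\<lambda>x. inverse (f x))"
  by (simp add: smooth_def Ck_inverse)

lemma smooth_diff: "smooth f \<Longrightarrow> smooth g \<Longrightarrow> smooth (\<lambda>x. f x - g x)"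
  using smooth_add[of f "\<lambda>x. (-1) * g x"] smooth_mult[of "\<lambda>x. -1" g] by simp

lemma smooth_sum: "(\<And>i. i \<in> I \<Longrightarrow> smooth (f i)) \<Longrightarrow> smooth (\<lambda>x. \<Sum>i\<in>I. f i x)"
  by (induction I rule: infinite_finite_induct) (auto intro: smooth_add)

lemma smooth_prod: "(\<And>i. i \<in> I \<Longrightarrow> smooth (f i)) \<Longrightarrow> smooth (\<lambda>x. \<Prod>i\<in>I. f i x)"
  by (induction I rule: infinite_finite_induct) (auto intro: smooth_mult)

lemma smooth_power: "smooth f \<Longrightarrow> smooth (\<lambda>x. f x ^ n)"
  by (induction n) (auto intro: smooth_mult)

lemma smooth_inner: "smooth (\<lambda>x. of_real (x \<bullet> c))"
proof -
  have d: "((\<lambda>x. of_real (x \<bullet> c) :: complex) has_derivative (\<lambda>h. of_real (h \<bullet> c))) (at x)" for x :: 'a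
    by (intro derivative_intros)
  show ?thesis unfolding smooth_iff[of "\<lambda>x. of_real (x \<bullet> c)"]
  proof (intro conjI ballI)
    fix b :: 'a
    have "partial_deriv b (\<lambda>x. of_real (x \<bullet> c)) = (\<lambda>x. of_real (b \<bullet> c))"
      by (rule ext) (rule partial_deriv_eqI[OF d])
    then show "smooth (partial_deriv b (\<lambda>x. of_real (x \<bullet> c)))" by simp
  qed (rule differentiable_on_UNIV_I[OF d])
qed

text \<open>The map s sends the index of a member to the index of its derivative, so the chain rule
  stays inside the family and induction on the order applies to all members at once. It serves
  \<open>flat\<close>, indexed by polynomials, and exp, with a single index.\<close>

lemma smooth_compose_family:
  fixes F :: "'i \<Rightarrow> real \<Rightarrow> real"
  assumes F: "\<And>i t. (F i has_real_derivative F (s i) t) (at t)"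
    and q: "smooth (\<lambda>x. of_real (q x))"
  shows "smooth (\<lambda>x. of_real (F i (q x)))"
proof -
  have qd: "(q has_derivative (\<lambda>h. Re (partial_deriv h (\<lambda>x. of_real (q x)) x))) (at x)" for x
    using has_derivative_Re[OF smooth_has_derivative[OF q]] by simp
  have qr: "partial_deriv b (\<lambda>x. of_real (q x)) x = of_real (Re (partial_deriv b (\<lambda>x. of_real (q x)) x))" for b x
    using has_derivative_of_real[OF qd, of x] by (rule partial_deriv_eqI)
  have d: "((\<lambda>x. of_real (F i (q x)) :: complex) has_derivative
      (\<lambda>h. of_real (F (s i) (q x)) * partial_deriv h (\<lambda>x. of_real (q x)) x)) (at x)" for i x
  proof -
    have "((\<lambda>x. F i (q x)) has_derivative (\<lambda>h. Re (partial_deriv h (\<lambda>x. of_real (q x)) x) * F (s i) (q x))) (at x)"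
      using has_derivative_compose[OF qd, of "F i" "(*) (F (s i) (q x))"] F[of i "q x"]
      by (simp add: has_field_derivative_def mult.commute)
    from has_derivative_of_real[OF this] show ?thesis
      by (subst qr) (simp add: mult.commute)
  qed
  have "Ck k (\<lambda>x. of_real (F i (q x)))" for k i
  proof (induction k arbitrary: i)
    case 0 then show ?case
      using differentiable_imp_continuous_on[OF differentiable_on_UNIV_I[OF d]] by simp
  next
    case (Suc k)
    have "partial_deriv b (\<lambda>x. of_real (F i (q x))) = (\<lambda>x. of_real (F (s i) (q x)) * partial_deriv b (\<lambda>x. of_real (q x)) x)" for b
      by (rule ext) (rule partial_deriv_eqI[OF d])
    then show ?case using differentiable_on_UNIV_I[OF d] Suc smooth_partial[OF q]
      by (simp add: Ck_mult smooth_def)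
  qed
  then show ?thesis by (simp add: smooth_def)
qed

text \<open>This family is closed under differentiation, which gives smoothness of its members at \<open>0\<close>.\<close>

definition flat :: "real poly \<Rightarrow> real \<Rightarrow> real" where
  "flat p t = (if t \<le> 0 then 0 else poly p (inverse t) * exp (- inverse t))"

lemma poly_exp_tendsto_0: "((\<lambda>s::real. poly p s * exp (- s)) \<longlongrightarrow> 0) at_top"
proof -
  have "((\<lambda>s::real. \<Sum>i\<le>degree p. coeff p i * (s ^ i / exp s)) \<longlongrightarrow> (\<Sum>i\<le>degree p. coeff p i * 0)) at_top"
    by (intro tendsto_intros tendsto_power_div_exp_0)
  then show ?thesis
    by (simp add: poly_altdef exp_minus divide_inverse sum_distrib_right mult.assoc)
qed

text \<open>For t > 0 the derivative of p(1/t) exp(-1/t) is t^(-2) (p - p')(1/t) exp(-1/t), and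
  t^(-2) is the polynomial s^2 at s = 1/t. At 0 the right difference quotient tends to 0 because the
  exponential beats every polynomial.\<close>

lemma flat_deriv: "(flat p has_real_derivative flat ([:0, 0, 1:] * (p - pderiv p)) t) (at t)"
proof -
  consider "t < 0" | "t = 0" | "t > 0" by linarith
  then show ?thesis
  proof cases
    case 1
    have "(flat p has_real_derivative 0) (at t)"
      by (rule has_field_derivative_transform_within_open[OF DERIV_const[of 0], where S = "{..<0}"])
        (use 1 in \<open>auto simp: flat_def\<close>)
    then show ?thesis using 1 by (simp add: flat_def)
  next
    case 2
    have "((\<lambda>h. flat p h / h) \<longlongrightarrow> 0) (at 0)"
    proof (rule filterlim_split_at)
      show "((\<lambda>h. flat p h / h) \<longlongrightarrow> 0) (at_left 0)"
        by (rule tendsto_eventually) (auto simp: flat_def eventually_at_filter)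
      have "((\<lambda>h. poly ([:0, 1:] * p) (inverse h) * exp (- inverse h)) \<longlongrightarrow> 0) (at_right 0)"
        by (rule filterlim_compose[OF poly_exp_tendsto_0 filterlim_inverse_at_top_right])
      then show "((\<lambda>h. flat p h / h) \<longlongrightarrow> 0) (at_right 0)"
        by (rule Lim_transform_eventually)
          (auto simp: flat_def eventually_at_filter divide_inverse)
    qed
    then have "(flat p has_real_derivative 0) (at 0)" by (simp add: DERIV_def flat_def)
    then show ?thesis using 2 by (simp add: flat_def)
  next
    case 3
    have "((\<lambda>t. poly p (inverse t) * exp (- inverse t)) has_real_derivative
        poly (pderiv p) (inverse t) * (- (inverse t * inverse t)) * exp (- inverse t)
        + poly p (inverse t) * (exp (- inverse t) * (inverse t * inverse t))) (at t)"
      using 3 by (auto intro!: derivative_eq_intros DERIV_chain2[OF poly_DERIV] simp: power2_eq_square divide_inverse)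
    then have "(flat p has_real_derivative
        poly (pderiv p) (inverse t) * (- (inverse t * inverse t)) * exp (- inverse t)
        + poly p (inverse t) * (exp (- inverse t) * (inverse t * inverse t))) (at t)"
      by (rule has_field_derivative_transform_within_open[where S = "{0<..}"])
        (use 3 in \<open>auto simp: flat_def\<close>)
    then show ?thesis using 3 by (simp add: flat_def algebra_simps)
  qed
qed

text \<open>A product over the coordinates of flat functions of the signed distances to the two
  faces. It vanishes exactly off the open box, so its support is contained in the closed one, and
  later the closed box has to lie in the domain.\<close>

lemma exists_test_function_box:
  fixes a c :: "'a::euclidean_space"
  obtains H :: "'a \<Rightarrow> real" where "smooth (\<lambda>x. of_real (H x))" "\<And>x. 0 \<le> H x" "\<And>x. H x > 0 \<longleftrightarrow> x \<in> box a c"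
proof
  define H where "H x = (\<Prod>b\<in>Basis. flat 1 (x \<bullet> b - a \<bullet> b) * flat 1 (c \<bullet> b - x \<bullet> b))" for x :: 'a
  have "smooth (\<lambda>x. \<Prod>b\<in>Basis. of_real (flat 1 (x \<bullet> b - a \<bullet> b)) * of_real (flat 1 (c \<bullet> b - x \<bullet> b)))"
    by (intro smooth_prod smooth_mult smooth_compose_family[where F = flat, OF flat_deriv];
        simp; intro smooth_diff smooth_inner smooth_const)
  then show "smooth (\<lambda>x. of_real (H x))" by (simp add: H_def)
  have f0: "0 \<le> flat 1 t" "flat 1 t > 0 \<longleftrightarrow> t > 0" "flat 1 t \<noteq> 0 \<longleftrightarrow> t > 0" for t by (auto simp: flat_def)
  show H0: "0 \<le> H x" for x unfolding H_def by (intro prod_nonneg mult_nonneg_nonneg f0)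
  have "H x > 0 \<longleftrightarrow> H x \<noteq> 0" for x using H0[of x] by auto
  also have "H x \<noteq> 0 \<longleftrightarrow> x \<in> box a c" for x
    by (auto simp: H_def f0 mem_box)
  finally show "H x > 0 \<longleftrightarrow> x \<in> box a c" for x .
qed

section \<open>Test functions: products, supports and integrability\<close>

lemma test_functions_smooth: "\<phi> \<in> test_functions \<Omega> \<Longrightarrow> smooth \<phi>"
  by (simp add: test_functions_def smooth_def)

lemma test_functions_mult:
  assumes "\<phi> \<in> test_functions \<Omega>" "smooth \<psi>"
  shows "(\<lambda>x. \<psi> x * \<phi> x) \<in> test_functions \<Omega>"
proof -
  have sub: "closure {x. \<psi> x * \<phi> x \<noteq> 0} \<subseteq> closure {x. \<phi> x \<noteq> 0}" by (intro closure_mono) auto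
  have K: "compact (closure {x. \<phi> x \<noteq> 0})" "closure {x. \<phi> x \<noteq> 0} \<subseteq> \<Omega>"
    using assms(1) by (auto simp: test_functions_def)
  have "compact (closure {x. \<psi> x * \<phi> x \<noteq> 0})"
    using compact_Int_closed[OF K(1) closed_closure[of "{x. \<psi> x * \<phi> x \<noteq> 0}"]] sub
    by (simp add: Int_absorb1)
  then show ?thesis using sub K(2) smooth_mult[OF assms(2) test_functions_smooth[OF assms(1)]]
    unfolding test_functions_def smooth_def by blast
qed

lemma test_functions_cnj: "\<phi> \<in> test_functions \<Omega> \<Longrightarrow> (\<lambda>x. cnj (\<phi> x)) \<in> test_functions \<Omega>"
  by (simp add: test_functions_def Ck_cnj)

lemma test_functions_partial_zero:
  assumes "\<phi> \<in> test_functions \<Omega>" "x \<notin> closure {x. \<phi> x \<noteq> 0}"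
  shows "partial_deriv b \<phi> x = 0"
proof -
  define K where "K = closure {x. \<phi> x \<noteq> 0}"
  have K: "open (- K)" "x \<in> - K"
    using assms(2) unfolding K_def by (auto intro!: open_Compl[OF closed_closure])
  have "0 = \<phi> y" if "y \<in> - K" for y
    using that closure_subset[of "{x. \<phi> x \<noteq> 0}"] unfolding K_def[symmetric] by auto
  with has_derivative_const[of 0] K have "(\<phi> has_derivative (\<lambda>h. 0)) (at x)"
    by (rule has_derivative_transform_within_open)
  then show ?thesis by (rule partial_deriv_eqI)
qed

lemma sq_integrable_compact_support:
  assumes f: "continuous_on UNIV f" and K: "compact K" and z: "\<And>x. x \<notin> K \<Longrightarrow> f x = 0" and S: "S \<in> sets lebesgue"
  shows "sq_integrable (lebesgue_on S) f"
proof -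
  have fm: "f \<in> borel_measurable lebesgue"
    using borel_measurable_continuous_onI[OF f] by (simp add: measurable_completion)
  obtain C where C: "\<And>x. x \<in> K \<Longrightarrow> norm (f x) \<le> C"
    using compact_imp_bounded[OF compact_continuous_image[OF continuous_on_subset[OF f] K]]
    by (auto simp: bounded_iff)
  have "sq_integrable (lebesgue_on UNIV) f"
    unfolding sq_integrable_def lebesgue_on_UNIV_eq
  proof
    show "integrable lebesgue (\<lambda>x. (norm (f x))\<^sup>2)"
    proof (rule Bochner_Integration.integrable_bound)
      have "integrable lebesgue (indicator K :: _ \<Rightarrow> real)"
        using lmeasurable_compact[OF K] unfolding fmeasurable_def by (intro integrable_real_indicator) blast+
      then show "integrable lebesgue (\<lambda>x. C\<^sup>2 * indicator K x :: real)" by simp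
      show "AE x in lebesgue. norm ((norm (f x))\<^sup>2) \<le> norm (C\<^sup>2 * indicator K x :: real)"
        using C z by (intro AE_I2) (auto simp: indicator_def intro!: power_mono)
    qed (use fm in measurable)
  qed (rule fm)
  then have "integrable lebesgue (\<lambda>x. (norm (f x))\<^sup>2)"
    by (simp add: sq_integrable_def lebesgue_on_UNIV_eq)
  then have "integrable (lebesgue_on S) (\<lambda>x. (norm (f x))\<^sup>2)"
    using S by (subst integrable_restrict_space) (simp, rule integrable_mult_indicator)
  then show ?thesis
    using measurable_restrict_space1[OF fm] by (simp add: sq_integrable_def)
qed

lemma test_functions_sq_integrable:
  assumes "\<phi> \<in> test_functions \<Omega>" "S \<in> sets lebesgue"
  shows "sq_integrable (lebesgue_on S) \<phi>"
    and "b \<in> Basis \<Longrightarrow> sq_integrable (lebesgue_on S) (partial_deriv b \<phi>)"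
proof -
  have K: "compact (closure {x. \<phi> x \<noteq> 0})" using assms by (simp add: test_functions_def)
  show "sq_integrable (lebesgue_on S) \<phi>"
    by (rule sq_integrable_compact_support[OF smooth_continuous[OF test_functions_smooth[OF assms(1)]] K _ assms(2)])
      (use closure_subset[of "{x. \<phi> x \<noteq> 0}"] in auto)
  show "b \<in> Basis \<Longrightarrow> sq_integrable (lebesgue_on S) (partial_deriv b \<phi>)"
    by (rule sq_integrable_compact_support[OF smooth_continuous[OF smooth_partial[OF test_functions_smooth[OF assms(1)]]] K _ assms(2)])
      (auto intro: test_functions_partial_zero[OF assms(1)])
qed

section \<open>Weak derivatives\<close>

lemma open_in_sets_lebesgue: "open S \<Longrightarrow> S \<in> sets lebesgue"
  by (simp add: sets_completionI_sets)

text \<open>On a bounded box L_2 lies in L_1, as multiplication by the indicator shows; this makes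
  Lebesgue's differentiation theorem available.\<close>

lemma sq_integrable_absolutely_integrable:
  fixes f :: "'a::euclidean_space \<Rightarrow> complex"
  assumes "sq_integrable lebesgue f"
  shows "f absolutely_integrable_on cbox a b"
proof -
  have "sq_integrable lebesgue (\<lambda>x. indicator (cbox a b) x :: complex)"
    unfolding sq_integrable_def
  proof
    show "integrable lebesgue (\<lambda>x. (norm (indicator (cbox a b) x :: complex))\<^sup>2)"
    proof -
      have "integrable lebesgue (indicator (cbox a b) :: 'a \<Rightarrow> real)"
        using lmeasurable_cbox[of a b] unfolding fmeasurable_def by (intro integrable_real_indicator) blast+
      moreover have "(norm (indicator (cbox a b) x :: complex))\<^sup>2 = indicator (cbox a b) x" for x
        by (simp add: indicator_def)
      ultimately show ?thesis by simp
    qed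
    show "(indicator (cbox a b) :: 'a \<Rightarrow> complex) \<in> borel_measurable lebesgue"
      by (intro borel_measurable_indicator) (simp add: sets_completionI_sets)
  qed
  from sq_integrable_mult_integrable[OF this assms]
  have "integrable lebesgue (\<lambda>x. indicator (cbox a b) x * f x)" .
  moreover have "indicator (cbox a b) x * f x = indicator (cbox a b) x *\<^sub>R f x" for x
    by (simp add: indicator_def)
  ultimately show ?thesis unfolding set_integrable_def by simp
qed

text \<open>Test functions increasing to the indicator of an open box show that g has integral 0
  over every closed box inside \<open>\<Omega>\<close>. By Lebesgue differentiation g is almost
  everywhere the limit of its averages over shrinking cubes, hence 0.\<close>

lemma fundamental_lemma:
  fixes g :: "'a::euclidean_space \<Rightarrow> complex"
  assumes \<Omega>: "open \<Omega>" and g: "sq_integrable (lebesgue_on \<Omega>) g"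
    and zero: "\<And>\<phi>. \<phi> \<in> test_functions \<Omega> \<Longrightarrow> (LINT x|lebesgue_on \<Omega>. g x * \<phi> x) = 0"
  shows "AE x in lebesgue_on \<Omega>. g x = 0"
proof -
  have \<Omega>m: "\<Omega> \<in> sets lebesgue" using \<Omega> by (rule open_in_sets_lebesgue)
  define G where "G x = (if x \<in> \<Omega> then g x else 0)" for x
  have G: "sq_integrable lebesgue G" unfolding G_def[abs_def] using g \<Omega>m by (simp add: sq_integrable_extend)
  have Gai: "G absolutely_integrable_on cbox c d" for c d by (rule sq_integrable_absolutely_integrable[OF G])
  have Gm: "G \<in> borel_measurable lebesgue" using G by (rule sq_integrable_measurable)
  have avg: "integral (cbox c d) G = 0" if sub: "cbox c d \<subseteq> \<Omega>" for c d
  proof -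
    obtain H :: "'a \<Rightarrow> real" where H: "smooth (\<lambda>x. of_real (H x))" "\<And>x. 0 \<le> H x" "\<And>x. H x > 0 \<longleftrightarrow> x \<in> box c d"
      using exists_test_function_box[of c d] by blast
    \<comment> \<open>H / (H + 1/(n+1)) is smooth because its denominator is positive, takes values
      between 0 and 1, vanishes where H does, and tends to 1 where H > 0.\<close>
    define \<eta> where "\<eta> n x = complex_of_real (H x) * inverse (complex_of_real (H x) + of_real (1 / real (Suc n)))" for n x
    have pos: "H x + 1 / real (Suc n) > 0" for n x using H(2)[of x] by (simp add: add_nonneg_pos)
    have \<eta>r: "\<eta> n x = of_real (H x / (H x + 1 / real (Suc n)))" for n x
      unfolding \<eta>_def by (simp only: divide_inverse of_real_mult of_real_inverse of_real_add)
    have "complex_of_real (H x) + of_real (1 / real (Suc n)) \<noteq> 0" for n x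
      using pos[of x n] by (simp only: of_real_add[symmetric] of_real_eq_0_iff)
    then have sm: "smooth (\<eta> n)" for n unfolding \<eta>_def[abs_def]
      by (intro smooth_mult smooth_inverse smooth_add smooth_const H(1))
    have \<eta>0: "\<eta> n x \<noteq> 0 \<longleftrightarrow> x \<in> box c d" for n x
      unfolding \<eta>r of_real_eq_0_iff divide_eq_0_iff using pos[of x n] H(2)[of x] H(3)[of x] by auto
    have cl: "closure {x. \<eta> n x \<noteq> 0} \<subseteq> cbox c d" for n
      unfolding \<eta>0 Collect_mem_eq by (intro closure_minimal box_subset_cbox closed_cbox)
    have "compact (closure {x. \<eta> n x \<noteq> 0})" for n
      using compact_Int_closed[OF compact_cbox closed_closure[of "{x. \<eta> n x \<noteq> 0}"], of c d] cl[of n]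
      by (simp only: Int_absorb1)
    then have tf: "\<eta> n \<in> test_functions \<Omega>" for n
      using sm[of n] cl[of n] sub unfolding test_functions_def smooth_def by blast
    have eq0: "(LINT x|lebesgue. G x * \<eta> n x) = 0" for n
    proof -
      have "(LINT x|lebesgue. G x * \<eta> n x) = (LINT x|lebesgue. (if x \<in> \<Omega> then g x * \<eta> n x else 0))"
        by (rule Bochner_Integration.integral_cong) (auto simp: G_def)
      also have "\<dots> = (LINT x|lebesgue_on \<Omega>. g x * \<eta> n x)"
        by (rule Lebesgue_Measure.integral_restrict_UNIV[OF \<Omega>m])
      finally show ?thesis using zero[OF tf] by simp
    qed
    have "(\<lambda>n. LINT x|lebesgue. G x * \<eta> n x) \<longlonglongrightarrow> (LINT x|lebesgue. indicator (box c d) x *\<^sub>R G x)"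
    proof (rule integral_dominated_convergence)
      show "integrable lebesgue (\<lambda>x. indicator (cbox c d) x *\<^sub>R norm (G x))"
        using Bochner_Integration.integrable_norm[OF Gai[of c d, unfolded set_integrable_def]] by simp
      show "AE x in lebesgue. (\<lambda>n. G x * \<eta> n x) \<longlonglongrightarrow> indicator (box c d) x *\<^sub>R G x"
      proof (rule AE_I2)
        fix x show "(\<lambda>n. G x * \<eta> n x) \<longlonglongrightarrow> indicator (box c d) x *\<^sub>R G x"
        proof (cases "x \<in> box c d")
          case True
          then have "H x > 0" using H(3) by blast
          then have "(\<lambda>n. G x * of_real (H x / (H x + 1 / real (Suc n)))) \<longlonglongrightarrow> G x * of_real (H x / (H x + 0))"
            by (intro tendsto_intros LIMSEQ_Suc[OF lim_1_over_n]) auto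
          then show ?thesis using True \<open>H x > 0\<close> by (simp add: \<eta>r)
        next
          case False
          then have "\<eta> n x = 0" for n using \<eta>0 by blast
          then show ?thesis using False by simp
        qed
      qed
      fix n
      show "AE x in lebesgue. norm (G x * \<eta> n x) \<le> indicator (cbox c d) x *\<^sub>R norm (G x)"
      proof (rule AE_I2)
        fix x
        have "norm (\<eta> n x) \<le> 1" unfolding \<eta>r norm_of_real using pos[of x n] H(2)[of x] by simp
        moreover have "\<eta> n x = 0" if "x \<notin> cbox c d" using that \<eta>0[of n x] box_subset_cbox by blast
        ultimately show "norm (G x * \<eta> n x) \<le> indicator (cbox c d) x *\<^sub>R norm (G x)"
          by (auto simp: norm_mult indicator_def mult_left_le)
      qed
      show "(\<lambda>x. G x * \<eta> n x) \<in> borel_measurable lebesgue"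
        by (intro borel_measurable_times Gm smooth_measurable sm)
      show "(\<lambda>x. indicator (box c d) x *\<^sub>R G x) \<in> borel_measurable lebesgue"
        by (intro borel_measurable_scaleR borel_measurable_indicator Gm open_in_sets_lebesgue open_box)
    qed
    then have "(LINT x|lebesgue. indicator (box c d) x *\<^sub>R G x) = 0"
      unfolding eq0 by (simp add: LIMSEQ_const_iff)
    moreover have "set_integrable lebesgue (box c d) G"
      by (rule set_integrable_subset[OF Gai[of c d]]) (auto simp: box_subset_cbox)
    ultimately have "integral (box c d) G = 0"
      using set_lebesgue_integral_eq_integral(2)[of "box c d" G] unfolding set_lebesgue_integral_def by simp
    then show ?thesis by (simp add: integral_open_interval)
  qed
  have "G integrable_on cbox c d" for c d
    using Gai[of c d] set_lebesgue_integral_eq_integral(1) by blast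
  then obtain N where N: "negligible N" "\<And>x e. \<lbrakk>x \<notin> N; 0 < e\<rbrakk> \<Longrightarrow>
      \<exists>d>0. \<forall>h. 0 < h \<and> h < d \<longrightarrow> norm (integral (cbox x (x + h *\<^sub>R One)) G /\<^sub>R h ^ DIM('a) - G x) < e"
    using integrable_ccontinuous_explicit[of G] by metis
  have Gz: "G x = 0" if x: "x \<in> \<Omega>" "x \<notin> N" for x
  proof (rule ccontr)
    assume "G x \<noteq> 0"
    then obtain d where d: "d > 0" "\<And>h. 0 < h \<Longrightarrow> h < d \<Longrightarrow>
        norm (integral (cbox x (x + h *\<^sub>R One)) G /\<^sub>R h ^ DIM('a) - G x) < norm (G x)"
      using N(2)[OF x(2), of "norm (G x)"] by auto
    obtain r where r: "r > 0" "cball x r \<subseteq> \<Omega>" using \<Omega> x(1) open_contains_cball by blast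
    \<comment> \<open>A cube of side h with corner x lies within distance h d of x, so side r/d
      keeps it inside the ball of radius r; d/2 refers to the radius d given by
      differentiation.\<close>
    define h where "h = min (d / 2) (r / DIM('a))"
    have h: "0 < h" "h < d" "h * DIM('a) \<le> r" using d r by (auto simp: h_def min_def field_simps)
    have "cbox x (x + h *\<^sub>R One) \<subseteq> cball x r"
    proof
      fix y assume y: "y \<in> cbox x (x + h *\<^sub>R One)"
      have "norm (y - x) \<le> (\<Sum>b\<in>Basis. \<bar>(y - x) \<bullet> b\<bar>)" by (rule norm_le_l1)
      also have "\<dots> \<le> (\<Sum>b\<in>(Basis::'a set). h)"
        by (rule sum_mono) (use y in \<open>auto simp: mem_box inner_diff_left inner_add_left\<close>)
      finally show "y \<in> cball x r" using h by (simp add: dist_norm norm_minus_commute mult.commute)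
    qed
    then have "integral (cbox x (x + h *\<^sub>R One)) G = 0" using avg r by blast
    then show False using d(2)[OF h(1,2)] by simp
  qed
  have "AE x in lebesgue. x \<notin> N"
    using N(1) by (intro AE_not_in) (simp add: negligible_iff_null_sets)
  then have "AE x in lebesgue. x \<in> \<Omega> \<longrightarrow> g x = 0"
    by eventually_elim (use Gz in \<open>auto simp: G_def\<close>)
  then show ?thesis using \<Omega>m by (simp add: AE_restrict_space_iff)
qed

lemma has_weak_partial_unique:
  assumes "open \<Omega>" "sq_integrable (lebesgue_on \<Omega>) g" "sq_integrable (lebesgue_on \<Omega>) h"
    and "has_weak_partial \<Omega> b u g" "has_weak_partial \<Omega> b u h"
  shows "AE x in lebesgue_on \<Omega>. g x = h x"
proof -
  have \<Omega>m: "\<Omega> \<in> sets lebesgue" using assms(1) by (rule open_in_sets_lebesgue)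
  have "AE x in lebesgue_on \<Omega>. g x - h x = 0"
  proof (rule fundamental_lemma[OF assms(1) sq_integrable_diff[OF assms(2,3)]])
    fix \<phi> assume \<phi>: "\<phi> \<in> test_functions \<Omega>"
    note i = sq_integrable_mult_integrable[OF _ test_functions_sq_integrable(1)[OF \<phi> \<Omega>m]]
    have "(LINT x|lebesgue_on \<Omega>. g x * \<phi> x) = (LINT x|lebesgue_on \<Omega>. h x * \<phi> x)"
      using assms(4,5) \<phi> unfolding has_weak_partial_def by (metis neg_equal_iff_equal)
    then show "(LINT x|lebesgue_on \<Omega>. (g x - h x) * \<phi> x) = 0"
      using i[OF assms(2)] i[OF assms(3)] by (simp add: left_diff_distrib)
  qed
  then show ?thesis by simp
qed

section \<open>The spaces H^1 and H^1_0\<close>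

lemma H1_weak_partial:
  assumes "u \<in> H1 \<Omega>" "b \<in> Basis"
  shows "sq_integrable (lebesgue_on \<Omega>) (weak_partial \<Omega> b u)" "has_weak_partial \<Omega> b u (weak_partial \<Omega> b u)"
proof -
  have "\<exists>g. g \<in> Lp_space \<Omega> 2 \<and> has_weak_partial \<Omega> b u g" using assms by (auto simp: H1_def)
  from someI_ex[OF this]
  show "sq_integrable (lebesgue_on \<Omega>) (weak_partial \<Omega> b u)" "has_weak_partial \<Omega> b u (weak_partial \<Omega> b u)"
    unfolding weak_partial_def by (simp_all add: Lp_space_2_iff)
qed

text \<open>Removes the choice behind \<open>weak_partial\<close>: any square-integrable weak
  derivative found by calculation may be substituted for it almost everywhere.\<close>

lemma weak_partial_AE_eq:
  assumes "open \<Omega>" "sq_integrable (lebesgue_on \<Omega>) g" "has_weak_partial \<Omega> b u g"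
  shows "AE x in lebesgue_on \<Omega>. weak_partial \<Omega> b u x = g x"
proof -
  have "\<exists>g. g \<in> Lp_space \<Omega> 2 \<and> has_weak_partial \<Omega> b u g" using assms by (auto simp: Lp_space_2_iff)
  from someI_ex[OF this]
  show ?thesis unfolding weak_partial_def[symmetric]
    using assms by (intro has_weak_partial_unique[of \<Omega> _ g b u]) (simp_all add: Lp_space_2_iff)
qed

lemma H1_0_sq_integrable:
  assumes "u \<in> H1_0 \<Omega>"
  shows "sq_integrable (lebesgue_on \<Omega>) u" "b \<in> Basis \<Longrightarrow> sq_integrable (lebesgue_on \<Omega>) (weak_partial \<Omega> b u)"
    "b \<in> Basis \<Longrightarrow> has_weak_partial \<Omega> b u (weak_partial \<Omega> b u)"
proof -
  have u: "u \<in> H1 \<Omega>" using assms by (simp add: H1_0_def)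
  show "sq_integrable (lebesgue_on \<Omega>) u" using u by (simp add: H1_def Lp_space_2_iff)
  show "b \<in> Basis \<Longrightarrow> sq_integrable (lebesgue_on \<Omega>) (weak_partial \<Omega> b u)"
    "b \<in> Basis \<Longrightarrow> has_weak_partial \<Omega> b u (weak_partial \<Omega> b u)"
    using H1_weak_partial[OF u] by auto
qed

lemma L2_norm_cong_AE:
  assumes "f \<in> borel_measurable (lebesgue_on S)" "g \<in> borel_measurable (lebesgue_on S)"
    "AE x in lebesgue_on S. f x = g x"
  shows "L2_norm S f = L2_norm S g"
  unfolding L2_norm_def using assms by (intro arg_cong[where f = sqrt] integral_cong_AE) auto

lemma L2_inner_tendsto:
  assumes S: "S \<in> sets lebesgue" and f: "sq_integrable (lebesgue_on S) f"
    and h: "\<And>n. sq_integrable (lebesgue_on S) (h n)" "sq_integrable (lebesgue_on S) H"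
    and lim: "(\<lambda>n. L2_norm S (\<lambda>x. h n x - H x)) \<longlonglongrightarrow> 0"
  shows "(\<lambda>n. L2_inner S f (h n)) \<longlonglongrightarrow> L2_inner S f H"
proof -
  have "(\<lambda>n. L2_inner S f (h n) - L2_inner S f H) \<longlonglongrightarrow> 0"
  proof (rule Lim_null_comparison)
    show "(\<lambda>n. L2_norm S f * L2_norm S (\<lambda>x. h n x - H x)) \<longlonglongrightarrow> 0"
      by (intro tendsto_mult_right_zero lim)
    show "\<forall>\<^sub>F n in sequentially. norm (L2_inner S f (h n) - L2_inner S f H) \<le> L2_norm S f * L2_norm S (\<lambda>x. h n x - H x)"
    proof (intro always_eventually allI)
      fix n
      have "L2_inner S f (h n) - L2_inner S f H = (LINT x|lebesgue_on S. f x * cnj (h n x - H x))"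
        unfolding L2_inner_def
        by (subst Bochner_Integration.integral_diff[symmetric])
          (auto intro!: sq_integrable_mult_cnj_integrable f h simp: algebra_simps)
      also have "norm \<dots> \<le> L2_norm S f * L2_norm S (\<lambda>x. cnj (h n x - H x))"
        by (intro Cauchy_Schwarz_L2 S f sq_integrable_cnj sq_integrable_diff h)
      also have "L2_norm S (\<lambda>x. cnj (h n x - H x)) = L2_norm S (\<lambda>x. h n x - H x)"
        unfolding L2_norm_def complex_mod_cnj ..
      finally show "norm (L2_inner S f (h n) - L2_inner S f H) \<le> L2_norm S f * L2_norm S (\<lambda>x. h n x - H x)" .
    qed
  qed
  then show ?thesis by (simp add: LIM_zero_iff)
qed

text \<open>Both sides are continuous in v with respect to the H^1 norm, so the defining identity of
  weak derivatives passes from test functions to their closure. The boundary condition is carried by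
  v alone. The definition is bilinear, hence it is used with conjugated test functions.\<close>

lemma weak_integration_by_parts:
  assumes \<Omega>: "open \<Omega>" and U: "sq_integrable (lebesgue_on \<Omega>) U" and g: "sq_integrable (lebesgue_on \<Omega>) g"
    and w: "has_weak_partial \<Omega> b U g" and v: "v \<in> H1_0 \<Omega>" and b: "b \<in> Basis"
  shows "L2_inner \<Omega> U (weak_partial \<Omega> b v) = - L2_inner \<Omega> g v"
proof -
  have \<Omega>m: "\<Omega> \<in> sets lebesgue" using \<Omega> by (rule open_in_sets_lebesgue)
  obtain \<phi> where \<phi>: "\<And>n. \<phi> n \<in> test_functions \<Omega>"
    "(\<lambda>n. L2_norm \<Omega> (\<lambda>x. \<phi> n x - v x)) \<longlonglongrightarrow> 0"
    "(\<lambda>n. L2_norm \<Omega> (\<lambda>x. partial_deriv b (\<phi> n) x - weak_partial \<Omega> b v x)) \<longlonglongrightarrow> 0"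
    using v b unfolding H1_0_def by blast
  have "L2_inner \<Omega> U (partial_deriv b (\<phi> n)) = - L2_inner \<Omega> g (\<phi> n)" for n
    using w test_functions_cnj[OF \<phi>(1)[of n]]
      partial_deriv_cnj[OF smooth_differentiable[OF test_functions_smooth[OF \<phi>(1)[of n]]]]
    unfolding has_weak_partial_def L2_inner_def by metis
  moreover have "(\<lambda>n. L2_inner \<Omega> U (partial_deriv b (\<phi> n))) \<longlonglongrightarrow> L2_inner \<Omega> U (weak_partial \<Omega> b v)"
    by (rule L2_inner_tendsto[OF \<Omega>m U _ _ \<phi>(3)])
      (auto intro: test_functions_sq_integrable[OF \<phi>(1) \<Omega>m] H1_0_sq_integrable[OF v] b)
  moreover have "(\<lambda>n. - L2_inner \<Omega> g (\<phi> n)) \<longlonglongrightarrow> - L2_inner \<Omega> g v"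
    by (intro tendsto_minus L2_inner_tendsto[OF \<Omega>m g _ _ \<phi>(2)])
      (auto intro: test_functions_sq_integrable[OF \<phi>(1) \<Omega>m] H1_0_sq_integrable[OF v])
  ultimately show ?thesis by (simp add: LIMSEQ_unique)
qed

text \<open>The product rule, obtained by testing u with \<psi> \<phi>, which is again a test
  function, and subtracting the term in which \<psi> is differentiated.\<close>

lemma has_weak_partial_mult:
  assumes \<Omega>: "open \<Omega>" and u: "sq_integrable (lebesgue_on \<Omega>) u" and g: "sq_integrable (lebesgue_on \<Omega>) g"
    and w: "has_weak_partial \<Omega> b u g" and \<psi>: "smooth \<psi>" and b: "b \<in> Basis"
  shows "has_weak_partial \<Omega> b (\<lambda>x. \<psi> x * u x) (\<lambda>x. \<psi> x * g x + partial_deriv b \<psi> x * u x)"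
  unfolding has_weak_partial_def
proof
  have \<Omega>m: "\<Omega> \<in> sets lebesgue" using \<Omega> by (rule open_in_sets_lebesgue)
  fix \<phi> assume \<phi>: "\<phi> \<in> test_functions \<Omega>"
  have t1: "(\<lambda>x. \<psi> x * \<phi> x) \<in> test_functions \<Omega>" by (rule test_functions_mult[OF \<phi> \<psi>])
  have t2: "(\<lambda>x. partial_deriv b \<psi> x * \<phi> x) \<in> test_functions \<Omega>"
    by (rule test_functions_mult[OF \<phi> smooth_partial[OF \<psi> b]])
  note sq = test_functions_sq_integrable[OF t1 \<Omega>m] test_functions_sq_integrable[OF t2 \<Omega>m]
  note int = sq_integrable_mult_integrable[OF u sq(2)[OF b]] sq_integrable_mult_integrable[OF u sq(3)]
    sq_integrable_mult_integrable[OF g sq(1)]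
  have pd: "partial_deriv b (\<lambda>x. \<psi> x * \<phi> x) = (\<lambda>x. \<psi> x * partial_deriv b \<phi> x + partial_deriv b \<psi> x * \<phi> x)"
    by (rule partial_deriv_mult[OF smooth_differentiable[OF \<psi>] smooth_differentiable[OF test_functions_smooth[OF \<phi>]]])
  have "(LINT x|lebesgue_on \<Omega>. \<psi> x * u x * partial_deriv b \<phi> x)
     = (LINT x|lebesgue_on \<Omega>. u x * partial_deriv b (\<lambda>x. \<psi> x * \<phi> x) x - u x * (partial_deriv b \<psi> x * \<phi> x))"
    unfolding pd by (simp add: algebra_simps)
  also have "\<dots> = (LINT x|lebesgue_on \<Omega>. u x * partial_deriv b (\<lambda>x. \<psi> x * \<phi> x) x)
      - (LINT x|lebesgue_on \<Omega>. u x * (partial_deriv b \<psi> x * \<phi> x))"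
    using int by (intro Bochner_Integration.integral_diff)
  also have "(LINT x|lebesgue_on \<Omega>. u x * partial_deriv b (\<lambda>x. \<psi> x * \<phi> x) x) = - (LINT x|lebesgue_on \<Omega>. g x * (\<psi> x * \<phi> x))"
    using w t1 unfolding has_weak_partial_def by blast
  also have "- (LINT x|lebesgue_on \<Omega>. g x * (\<psi> x * \<phi> x)) - (LINT x|lebesgue_on \<Omega>. u x * (partial_deriv b \<psi> x * \<phi> x))
     = - (LINT x|lebesgue_on \<Omega>. g x * (\<psi> x * \<phi> x) + u x * (partial_deriv b \<psi> x * \<phi> x))"
    using int by (subst Bochner_Integration.integral_add) auto
  also have "\<dots> = - (LINT x|lebesgue_on \<Omega>. (\<psi> x * g x + partial_deriv b \<psi> x * u x) * \<phi> x)"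
    by (simp add: algebra_simps)
  finally show "(LINT x|lebesgue_on \<Omega>. \<psi> x * u x * partial_deriv b \<phi> x)
     = - (LINT x|lebesgue_on \<Omega>. (\<psi> x * g x + partial_deriv b \<psi> x * u x) * \<phi> x)" .
qed

lemma smooth_measurable_on: "smooth \<psi> \<Longrightarrow> S \<in> sets lebesgue \<Longrightarrow> \<psi> \<in> borel_measurable (lebesgue_on S)"
  by (simp add: measurable_restrict_space1 smooth_measurable)

text \<open>If \<phi> n approximates u in H^1, then \<psi> \<phi> n approximates \<psi> u: the error
  and its derivatives are controlled by the bounds on \<psi> and its gradient. This makes weighted
  functions admissible in the eigenvalue equation.\<close>

lemma H1_0_mult:
  assumes \<Omega>: "open \<Omega>" and u: "u \<in> H1_0 \<Omega>" and \<psi>: "smooth \<psi>"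
    and bd: "\<And>x. norm (\<psi> x) \<le> C" "\<And>b x. b \<in> Basis \<Longrightarrow> norm (partial_deriv b \<psi> x) \<le> C"
  shows "(\<lambda>x. \<psi> x * u x) \<in> H1_0 \<Omega>"
    and "b \<in> Basis \<Longrightarrow> AE x in lebesgue_on \<Omega>. 
      weak_partial \<Omega> b (\<lambda>x. \<psi> x * u x) x = \<psi> x * weak_partial \<Omega> b u x + partial_deriv b \<psi> x * u x"
proof -
  have \<Omega>m: "\<Omega> \<in> sets lebesgue" using \<Omega> by (rule open_in_sets_lebesgue)
  have C: "0 \<le> C" using bd(1)[of undefined] norm_ge_zero order_trans by blast
  note us = H1_0_sq_integrable[OF u]
  note [measurable] = smooth_measurable_on[OF \<psi> \<Omega>m] 
  have [measurable]: "b \<in> Basis \<Longrightarrow> partial_deriv b \<psi> \<in> borel_measurable (lebesgue_on \<Omega>)" for b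
    using smooth_measurable_on[OF smooth_partial[OF \<psi>] \<Omega>m] by blast
  let ?D = "\<lambda>b x. \<psi> x * weak_partial \<Omega> b u x + partial_deriv b \<psi> x * u x"
  have sq: "sq_integrable (lebesgue_on \<Omega>) (\<lambda>x. \<psi> x * u x)"
    by (rule sq_integrable_bounded_mult[OF us(1) _ bd(1)]) measurable
  have sqD: "sq_integrable (lebesgue_on \<Omega>) (?D b)" if "b \<in> Basis" for b
    using that by (intro sq_integrable_add sq_integrable_bounded_mult[OF us(2) _ bd(1)]
        sq_integrable_bounded_mult[OF us(1) _ bd(2)]) measurable
  have wD: "has_weak_partial \<Omega> b (\<lambda>x. \<psi> x * u x) (?D b)" if "b \<in> Basis" for b
    by (rule has_weak_partial_mult[OF \<Omega> us(1) us(2)[OF that] us(3)[OF that] \<psi> that])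
  have AE: "AE x in lebesgue_on \<Omega>. weak_partial \<Omega> b (\<lambda>x. \<psi> x * u x) x = ?D b x" if "b \<in> Basis" for b
    by (rule weak_partial_AE_eq[OF \<Omega> sqD[OF that] wD[OF that]])
  then show "b \<in> Basis \<Longrightarrow> AE x in lebesgue_on \<Omega>. weak_partial \<Omega> b (\<lambda>x. \<psi> x * u x) x = ?D b x" .
  have H1: "(\<lambda>x. \<psi> x * u x) \<in> H1 \<Omega>"
    unfolding H1_def
  proof (intro CollectI conjI ballI)
    show "\<exists>g\<in>Lp_space \<Omega> 2. has_weak_partial \<Omega> b (\<lambda>x. \<psi> x * u x) g" if "b \<in> Basis" for b
      using sqD[OF that] wD[OF that] by (intro bexI[of _ "?D b"]) (simp_all add: Lp_space_2_iff)
  qed (simp add: Lp_space_2_iff sq)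
  obtain \<phi> where \<phi>: "\<And>n. \<phi> n \<in> test_functions \<Omega>"
    "(\<lambda>n. L2_norm \<Omega> (\<lambda>x. \<phi> n x - u x)) \<longlonglongrightarrow> 0"
    "\<And>b. b \<in> Basis \<Longrightarrow> (\<lambda>n. L2_norm \<Omega> (\<lambda>x. partial_deriv b (\<phi> n) x - weak_partial \<Omega> b u x)) \<longlonglongrightarrow> 0"
    using u unfolding H1_0_def by blast
  note \<phi>s = test_functions_sq_integrable[OF \<phi>(1) \<Omega>m]
  show "(\<lambda>x. \<psi> x * u x) \<in> H1_0 \<Omega>"
    unfolding H1_0_def
  proof (intro CollectI conjI H1 exI[of _ "\<lambda>n x. \<psi> x * \<phi> n x"] allI ballI)
    show "(\<lambda>x. \<psi> x * \<phi> n x) \<in> test_functions \<Omega>" for n by (rule test_functions_mult[OF \<phi>(1) \<psi>])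
    have n1: "L2_norm \<Omega> (\<lambda>x. \<psi> x * \<phi> n x - \<psi> x * u x) \<le> C * L2_norm \<Omega> (\<lambda>x. \<phi> n x - u x)" for n
    proof (rule L2_norm_mono[OF _ sq_integrable_diff[OF \<phi>s(1) us(1)] _ C])
      show "(\<lambda>x. \<psi> x * \<phi> n x - \<psi> x * u x) \<in> borel_measurable (lebesgue_on \<Omega>)"
        using sq_integrable_measurable[OF us(1)] sq_integrable_measurable[OF \<phi>s(1)] by measurable
      show "AE x in lebesgue_on \<Omega>. norm (\<psi> x * \<phi> n x - \<psi> x * u x) \<le> C * norm (\<phi> n x - u x)"
        by (auto simp: right_diff_distrib[symmetric] norm_mult intro!: mult_right_mono bd)
    qed
    show "(\<lambda>n. L2_norm \<Omega> (\<lambda>x. \<psi> x * \<phi> n x - \<psi> x * u x)) \<longlonglongrightarrow> 0"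
      by (rule Lim_null_comparison[where g = "\<lambda>n. C * L2_norm \<Omega> (\<lambda>x. \<phi> n x - u x)"])
        (use n1 in \<open>auto intro!: tendsto_mult_right_zero \<phi>(2)\<close>)
    fix b :: 'a assume b: "b \<in> Basis"
    have d1: "sq_integrable (lebesgue_on \<Omega>) (\<lambda>x. \<psi> x * (partial_deriv b (\<phi> n) x - weak_partial \<Omega> b u x))" for n
      by (rule sq_integrable_bounded_mult[OF sq_integrable_diff[OF \<phi>s(2)[OF b] us(2)[OF b]] _ bd(1)]) measurable
    have d2: "sq_integrable (lebesgue_on \<Omega>) (\<lambda>x. partial_deriv b \<psi> x * (\<phi> n x - u x))" for n
      using b by (intro sq_integrable_bounded_mult[OF sq_integrable_diff[OF \<phi>s(1) us(1)] _ bd(2)]) auto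
    have n2: "L2_norm \<Omega> (\<lambda>x. partial_deriv b (\<lambda>x. \<psi> x * \<phi> n x) x - weak_partial \<Omega> b (\<lambda>x. \<psi> x * u x) x)
      \<le> C * L2_norm \<Omega> (\<lambda>x. partial_deriv b (\<phi> n) x - weak_partial \<Omega> b u x) + C * L2_norm \<Omega> (\<lambda>x. \<phi> n x - u x)" for n
    proof -
      have pd: "partial_deriv b (\<lambda>x. \<psi> x * \<phi> n x) x = \<psi> x * partial_deriv b (\<phi> n) x + partial_deriv b \<psi> x * \<phi> n x" for x
        using partial_deriv_mult[OF smooth_differentiable[OF \<psi>] smooth_differentiable[OF test_functions_smooth[OF \<phi>(1)[of n]]]]
        by metis
      have "L2_norm \<Omega> (\<lambda>x. partial_deriv b (\<lambda>x. \<psi> x * \<phi> n x) x - weak_partial \<Omega> b (\<lambda>x. \<psi> x * u x) x)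
         = L2_norm \<Omega> (\<lambda>x. \<psi> x * (partial_deriv b (\<phi> n) x - weak_partial \<Omega> b u x) + partial_deriv b \<psi> x * (\<phi> n x - u x))"
      proof (rule L2_norm_cong_AE)
        show "(\<lambda>x. partial_deriv b (\<lambda>x. \<psi> x * \<phi> n x) x - weak_partial \<Omega> b (\<lambda>x. \<psi> x * u x) x) \<in> borel_measurable (lebesgue_on \<Omega>)"
          using test_functions_sq_integrable(2)[OF test_functions_mult[OF \<phi>(1) \<psi>] \<Omega>m b] H1_weak_partial(1)[OF H1 b]
          by (intro borel_measurable_diff sq_integrable_measurable)
        show "(\<lambda>x. \<psi> x * (partial_deriv b (\<phi> n) x - weak_partial \<Omega> b u x) + partial_deriv b \<psi> x * (\<phi> n x - u x)) \<in> borel_measurable (lebesgue_on \<Omega>)"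
          using d1 d2 by (intro borel_measurable_add sq_integrable_measurable)
        show "AE x in lebesgue_on \<Omega>. partial_deriv b (\<lambda>x. \<psi> x * \<phi> n x) x - weak_partial \<Omega> b (\<lambda>x. \<psi> x * u x) x =
           \<psi> x * (partial_deriv b (\<phi> n) x - weak_partial \<Omega> b u x) + partial_deriv b \<psi> x * (\<phi> n x - u x)"
          using AE[OF b] by eventually_elim (simp add: pd algebra_simps)
      qed
      also have "\<dots> \<le> L2_norm \<Omega> (\<lambda>x. \<psi> x * (partial_deriv b (\<phi> n) x - weak_partial \<Omega> b u x))
          + L2_norm \<Omega> (\<lambda>x. partial_deriv b \<psi> x * (\<phi> n x - u x))"
        by (rule L2_norm_triangle[OF \<Omega>m d1 d2])
      also have "\<dots> \<le> C * L2_norm \<Omega> (\<lambda>x. partial_deriv b (\<phi> n) x - weak_partial \<Omega> b u x) + C * L2_norm \<Omega> (\<lambda>x. \<phi> n x - u x)"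
        using b by (intro add_mono L2_norm_mono[OF sq_integrable_measurable[OF d1] sq_integrable_diff[OF \<phi>s(2)[OF b] us(2)[OF b]] _ C]
            L2_norm_mono[OF sq_integrable_measurable[OF d2] sq_integrable_diff[OF \<phi>s(1) us(1)] _ C])
          (auto simp: norm_mult intro!: mult_right_mono bd)
      finally show ?thesis .
    qed
    show "(\<lambda>n. L2_norm \<Omega> (\<lambda>x. partial_deriv b (\<lambda>x. \<psi> x * \<phi> n x) x - weak_partial \<Omega> b (\<lambda>x. \<psi> x * u x) x)) \<longlonglongrightarrow> 0"
    proof (rule Lim_null_comparison)
      show "\<forall>\<^sub>F n in sequentially. norm (L2_norm \<Omega> (\<lambda>x. partial_deriv b (\<lambda>x. \<psi> x * \<phi> n x) x - weak_partial \<Omega> b (\<lambda>x. \<psi> x * u x) x))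
        \<le> C * L2_norm \<Omega> (\<lambda>x. partial_deriv b (\<phi> n) x - weak_partial \<Omega> b u x) + C * L2_norm \<Omega> (\<lambda>x. \<phi> n x - u x)"
        using n2 by simp
      show "(\<lambda>n. C * L2_norm \<Omega> (\<lambda>x. partial_deriv b (\<phi> n) x - weak_partial \<Omega> b u x) + C * L2_norm \<Omega> (\<lambda>x. \<phi> n x - u x)) \<longlonglongrightarrow> 0"
        by (rule tendsto_eq_intros tendsto_mult_right_zero \<phi>(2) \<phi>(3)[OF b] refl)+ simp
    qed
  qed
qed

lemma dirichlet_form_eq:
  assumes "u \<in> H1_0 \<Omega>" "v \<in> H1_0 \<Omega>"
  shows "dirichlet_form \<Omega> u v = (\<Sum>b\<in>Basis. L2_inner \<Omega> (weak_partial \<Omega> b u) (weak_partial \<Omega> b v))"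
  unfolding dirichlet_form_def L2_inner_def
  by (rule Bochner_Integration.integral_sum)
    (intro sq_integrable_mult_cnj_integrable H1_0_sq_integrable assms)

section \<open>Energy identities for eigenfunctions\<close>

text \<open>\<open>D b\<close> and \<open>E b\<close> name the first and the pure second derivative
  in direction b as real functions, so the gradient of the weight is D and its Laplacian is the sum
  of the \<open>E b\<close>. The common bound C makes all products with L_2 functions square
  integrable.\<close>

definition C2_weight ::
  "('a::euclidean_space \<Rightarrow> real) \<Rightarrow> ('a \<Rightarrow> 'a \<Rightarrow> real) \<Rightarrow> ('a \<Rightarrow> 'a \<Rightarrow> real) \<Rightarrow> real \<Rightarrow> bool" where
  "C2_weight \<psi> D E C \<longleftrightarrow> smooth (\<lambda>x. of_real (\<psi> x)) \<and>
     (\<forall>b\<in>Basis. partial_deriv b (\<lambda>x. of_real (\<psi> x)) = (\<lambda>x. of_real (D b x)) \<and>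
        partial_deriv b (\<lambda>x. of_real (D b x)) = (\<lambda>x. of_real (E b x))) \<and>
     (\<forall>x. \<bar>\<psi> x\<bar> \<le> C \<and> (\<forall>b\<in>Basis. \<bar>D b x\<bar> \<le> C \<and> \<bar>E b x\<bar> \<le> C))"

lemma C2_weightD:
  assumes "C2_weight \<psi> D E C"
  shows "smooth (\<lambda>x. of_real (\<psi> x))" "\<bar>\<psi> x\<bar> \<le> C"
    and "b \<in> Basis \<Longrightarrow> smooth (\<lambda>x. of_real (D b x))" "b \<in> Basis \<Longrightarrow> smooth (\<lambda>x. of_real (E b x))"
    and "b \<in> Basis \<Longrightarrow> partial_deriv b (\<lambda>x. of_real (\<psi> x)) = (\<lambda>x. of_real (D b x))"
    and "b \<in> Basis \<Longrightarrow> partial_deriv b (\<lambda>x. of_real (D b x)) = (\<lambda>x. of_real (E b x))"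
    and "b \<in> Basis \<Longrightarrow> \<bar>D b x\<bar> \<le> C" "b \<in> Basis \<Longrightarrow> \<bar>E b x\<bar> \<le> C"
proof -
  show 1: "smooth (\<lambda>x. of_real (\<psi> x))" using assms by (simp add: C2_weight_def)
  show 2: "smooth (\<lambda>x. of_real (D b x))" if b: "b \<in> Basis"
    using smooth_partial[OF 1 b] assms b by (simp add: C2_weight_def)
  show "smooth (\<lambda>x. of_real (E b x))" if b: "b \<in> Basis"
    using smooth_partial[OF 2[OF b] b] assms b by (simp add: C2_weight_def)
qed (use assms in \<open>auto simp: C2_weight_def\<close>)

lemma smooth_real_measurable:
  assumes "smooth (\<lambda>x. of_real (\<psi> x))" "S \<in> sets lebesgue"
  shows "\<psi> \<in> borel_measurable (lebesgue_on S)"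
  using measurable_compose[OF smooth_measurable_on[OF assms] borel_measurable_Re] by simp

lemma eigenspace_iff:
  "u \<in> eigenspace \<Omega> (dirichlet_laplacian \<Omega>) z \<Longrightarrow> u \<in> H1_0 \<Omega>"
  "u \<in> eigenspace \<Omega> (dirichlet_laplacian \<Omega>) z \<Longrightarrow> v \<in> H1_0 \<Omega> \<Longrightarrow> dirichlet_form \<Omega> u v = z * L2_inner \<Omega> u v"
proof -
  assume u: "u \<in> eigenspace \<Omega> (dirichlet_laplacian \<Omega>) z"
  then obtain f where f: "u \<in> H1_0 \<Omega>" "f \<in> Lp_space \<Omega> 2"
    "\<And>v. v \<in> H1_0 \<Omega> \<Longrightarrow> dirichlet_form \<Omega> u v = L2_inner \<Omega> f v" "AE x in lebesgue_on \<Omega>. f x = z * u x"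
    by (auto simp: eigenspace_def dirichlet_laplacian_def)
  show "u \<in> H1_0 \<Omega>" by (rule f(1))
  assume v: "v \<in> H1_0 \<Omega>"
  have "dirichlet_form \<Omega> u v = L2_inner \<Omega> f v" by (rule f(3)[OF v])
  also have "\<dots> = (LINT x|lebesgue_on \<Omega>. z * (u x * cnj (v x)))"
    unfolding L2_inner_def
  proof (rule integral_cong_AE)
    show "AE x in lebesgue_on \<Omega>. f x * cnj (v x) = z * (u x * cnj (v x))"
      using f(4) by eventually_elim simp
    show "(\<lambda>x. f x * cnj (v x)) \<in> borel_measurable (lebesgue_on \<Omega>)"
      using f(2) H1_0_sq_integrable(1)[OF v] by (intro borel_measurable_times borel_measurable_cnj sq_integrable_measurable) (auto simp: Lp_space_2_iff)
    show "(\<lambda>x. z * (u x * cnj (v x))) \<in> borel_measurable (lebesgue_on \<Omega>)"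
      using H1_0_sq_integrable(1)[OF f(1)] H1_0_sq_integrable(1)[OF v]
      by (intro borel_measurable_times borel_measurable_cnj sq_integrable_measurable borel_measurable_const)
  qed
  also have "\<dots> = z * L2_inner \<Omega> u v" by (simp add: L2_inner_def)
  finally show "dirichlet_form \<Omega> u v = z * L2_inner \<Omega> u v" .
qed

lemma L2_inner_self: "L2_inner \<Omega> f f = of_real (LINT x|lebesgue_on \<Omega>. (norm (f x))\<^sup>2)"
  unfolding L2_inner_def by (simp add: complex_norm_square[symmetric] flip: of_real_power)

lemma L2_inner_cnj: "L2_inner \<Omega> g f = cnj (L2_inner \<Omega> f g)"
proof -
  have "cnj (L2_inner \<Omega> f g) = (LINT x|lebesgue_on \<Omega>. cnj (f x * cnj (g x)))"
    unfolding L2_inner_def by (simp del: complex_cnj_mult)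
  then show ?thesis by (simp add: L2_inner_def mult.commute)
qed

lemma dirichlet_form_cnj:
  assumes "u \<in> H1_0 \<Omega>" "v \<in> H1_0 \<Omega>"
  shows "dirichlet_form \<Omega> v u = cnj (dirichlet_form \<Omega> u v)"
  by (simp add: dirichlet_form_eq assms L2_inner_cnj[symmetric])

text \<open>Testing the equation with the eigenfunction itself makes z its Rayleigh
  quotient.\<close>

lemma eigenvalue_nonneg_real:
  assumes "eigenvalue \<Omega> (dirichlet_laplacian \<Omega>) z"
  shows "z = of_real (Re z)" "0 \<le> Re z"
proof -
  obtain u where u: "u \<in> eigenspace \<Omega> (dirichlet_laplacian \<Omega>) z" "\<not> (AE x in lebesgue_on \<Omega>. u x = 0)"
    using assms by (auto simp: eigenvalue_def)
  note uH = eigenspace_iff(1)[OF u(1)]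
  define N where "N = (LINT x|lebesgue_on \<Omega>. (norm (u x))\<^sup>2)"
  define M where "M = (\<Sum>b\<in>Basis. LINT x|lebesgue_on \<Omega>. (norm (weak_partial \<Omega> b u x))\<^sup>2)"
  have "N \<noteq> 0" unfolding N_def
    using u(2) H1_0_sq_integrable(1)[OF uH] by (subst integral_nonneg_eq_0_iff_AE) (auto simp: sq_integrable_def)
  then have N: "N > 0" unfolding N_def by (simp add: order_le_neq_trans[OF _ not_sym])
  have M: "M \<ge> 0" unfolding M_def by (intro sum_nonneg Bochner_Integration.integral_nonneg) simp
  have "of_real M = z * of_real N"
    using eigenspace_iff(2)[OF u(1) uH] dirichlet_form_eq[OF uH uH] by (simp add: L2_inner_self M_def N_def)
  then have z: "z = of_real (M / N)" using N by (simp add: field_simps)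
  show "z = of_real (Re z)" "0 \<le> Re z" unfolding z using M N by simp_all
qed

text \<open>The eigenvalue equation is tested with \<psi> u and the real part is taken; the product
  rule splits the form into the weighted gradient and a cross term with the gradient of
  \<psi>.\<close>

lemma weighted_energy_identity:
  assumes \<Omega>: "open \<Omega>" and u: "u \<in> eigenspace \<Omega> (dirichlet_laplacian \<Omega>) (of_real l)"
    and \<psi>: "smooth (\<lambda>x. of_real (\<psi> x))"
    and D: "\<And>b. b \<in> Basis \<Longrightarrow> partial_deriv b (\<lambda>x. of_real (\<psi> x)) = (\<lambda>x. of_real (D b x))"
    and bd: "\<And>x. \<bar>\<psi> x\<bar> \<le> C" "\<And>b x. b \<in> Basis \<Longrightarrow> \<bar>D b x\<bar> \<le> C"
  shows "l * (LINT x|lebesgue_on \<Omega>. \<psi> x * (norm (u x))\<^sup>2)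
    = (\<Sum>b\<in>Basis. (LINT x|lebesgue_on \<Omega>. \<psi> x * (norm (weak_partial \<Omega> b u x))\<^sup>2)
         + Re (L2_inner \<Omega> (\<lambda>x. of_real (D b x) * weak_partial \<Omega> b u x) u))"
proof -
  have \<Omega>m: "\<Omega> \<in> sets lebesgue" using \<Omega> by (rule open_in_sets_lebesgue)
  note uH = eigenspace_iff(1)[OF u]
  note us = H1_0_sq_integrable[OF uH]
  have \<psi>m: "\<psi> \<in> borel_measurable (lebesgue_on \<Omega>)" by (rule smooth_real_measurable[OF \<psi> \<Omega>m])
  have Dm: "D b \<in> borel_measurable (lebesgue_on \<Omega>)" if "b \<in> Basis" for b
    by (rule smooth_real_measurable[OF _ \<Omega>m]) (use smooth_partial[OF \<psi> that] D[OF that] in simp)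
  let ?v = "\<lambda>x. of_real (\<psi> x) * u x"
  have vH: "?v \<in> H1_0 \<Omega>" and vD: "\<And>b. b \<in> Basis \<Longrightarrow> AE x in lebesgue_on \<Omega>.
      weak_partial \<Omega> b ?v x = of_real (\<psi> x) * weak_partial \<Omega> b u x + of_real (D b x) * u x"
    using H1_0_mult[OF \<Omega> uH \<psi>, of C] bd D by auto
  have "L2_inner \<Omega> u ?v = of_real (LINT x|lebesgue_on \<Omega>. \<psi> x * (norm (u x))\<^sup>2)"
    unfolding L2_inner_def integral_complex_of_real[symmetric]
    by (intro Bochner_Integration.integral_cong refl) (simp add: complex_norm_square algebra_simps del: of_real_power)
  then have "dirichlet_form \<Omega> u ?v = of_real (l * (LINT x|lebesgue_on \<Omega>. \<psi> x * (norm (u x))\<^sup>2))"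
    using eigenspace_iff(2)[OF u vH] by simp
  moreover have "Re (dirichlet_form \<Omega> u ?v) = (\<Sum>b\<in>Basis. (LINT x|lebesgue_on \<Omega>. \<psi> x * (norm (weak_partial \<Omega> b u x))\<^sup>2)
         + Re (L2_inner \<Omega> (\<lambda>x. of_real (D b x) * weak_partial \<Omega> b u x) u))"
    unfolding dirichlet_form_eq[OF uH vH] Re_sum
  proof (rule sum.cong[OF refl])
    fix b :: 'a assume b: "b \<in> Basis"
    let ?w = "weak_partial \<Omega> b u"
    have s1: "sq_integrable (lebesgue_on \<Omega>) (\<lambda>x. of_real (\<psi> x) * ?w x)"
      by (rule sq_integrable_bounded_mult[OF us(2)[OF b], of _ C]) (use \<psi>m bd in auto)
    have s2: "sq_integrable (lebesgue_on \<Omega>) (\<lambda>x. of_real (D b x) * u x)"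
      by (rule sq_integrable_bounded_mult[OF us(1), of _ C]) (use Dm b bd in auto)
    have "L2_inner \<Omega> ?w (weak_partial \<Omega> b ?v)
        = (LINT x|lebesgue_on \<Omega>. ?w x * cnj (of_real (\<psi> x) * ?w x) + ?w x * cnj (of_real (D b x) * u x))"
      unfolding L2_inner_def
    proof (rule integral_cong_AE)
      show "(\<lambda>x. ?w x * cnj (weak_partial \<Omega> b ?v x)) \<in> borel_measurable (lebesgue_on \<Omega>)"
        using us(2)[OF b] H1_0_sq_integrable(2)[OF vH b]
        by (intro borel_measurable_times borel_measurable_cnj sq_integrable_measurable)
      show "(\<lambda>x. ?w x * cnj (of_real (\<psi> x) * ?w x) + ?w x * cnj (of_real (D b x) * u x)) \<in> borel_measurable (lebesgue_on \<Omega>)"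
        using us(2)[OF b] s1 s2
        by (intro borel_measurable_add borel_measurable_times[OF _ borel_measurable_cnj] sq_integrable_measurable)
      show "AE x in lebesgue_on \<Omega>. ?w x * cnj (weak_partial \<Omega> b ?v x)
          = ?w x * cnj (of_real (\<psi> x) * ?w x) + ?w x * cnj (of_real (D b x) * u x)"
        using vD[OF b] by eventually_elim (simp add: algebra_simps)
    qed
    also have "\<dots> = (LINT x|lebesgue_on \<Omega>. ?w x * cnj (of_real (\<psi> x) * ?w x))
        + (LINT x|lebesgue_on \<Omega>. ?w x * cnj (of_real (D b x) * u x))"
      by (intro Bochner_Integration.integral_add sq_integrable_mult_cnj_integrable us(2)[OF b] s1 s2)
    also have "(LINT x|lebesgue_on \<Omega>. ?w x * cnj (of_real (\<psi> x) * ?w x))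
        = of_real (LINT x|lebesgue_on \<Omega>. \<psi> x * (norm (?w x))\<^sup>2)"
      unfolding integral_complex_of_real[symmetric]
      by (intro Bochner_Integration.integral_cong refl) (simp add: complex_norm_square algebra_simps del: of_real_power)
    also have "(LINT x|lebesgue_on \<Omega>. ?w x * cnj (of_real (D b x) * u x))
        = L2_inner \<Omega> (\<lambda>x. of_real (D b x) * ?w x) u"
      unfolding L2_inner_def by (intro Bochner_Integration.integral_cong refl) simp
    finally show "Re (L2_inner \<Omega> ?w (weak_partial \<Omega> b ?v))
      = (LINT x|lebesgue_on \<Omega>. \<psi> x * (norm (?w x))\<^sup>2) + Re (L2_inner \<Omega> (\<lambda>x. of_real (D b x) * ?w x) u)"
      by simp
  qed
  ultimately show ?thesis by simp
qed

text \<open>Formally the left side integrates D b against the b-derivative of |u|^2. No derivative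
  of |u|^2 is formed: with z the inner product on the left, integration by parts gives cnj z = - z -
  (integral of E b |u|^2), and real parts are compared.\<close>

lemma gradient_term_by_parts:
  assumes \<Omega>: "open \<Omega>" and uH: "u \<in> H1_0 \<Omega>" and \<psi>: "C2_weight \<psi> D E C" and b: "b \<in> Basis"
  shows "2 * Re (L2_inner \<Omega> (\<lambda>x. of_real (D b x) * weak_partial \<Omega> b u x) u)
     = - (LINT x|lebesgue_on \<Omega>. E b x * (norm (u x))\<^sup>2)"
proof -
  have \<Omega>m: "\<Omega> \<in> sets lebesgue" using \<Omega> by (rule open_in_sets_lebesgue)
  note us = H1_0_sq_integrable[OF uH]
  note W = C2_weightD[OF \<psi>]
  let ?w = "weak_partial \<Omega> b u"
  have Dm: "D b \<in> borel_measurable (lebesgue_on \<Omega>)" by (rule smooth_real_measurable[OF W(3)[OF b] \<Omega>m])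
  have Em: "E b \<in> borel_measurable (lebesgue_on \<Omega>)" by (rule smooth_real_measurable[OF W(4)[OF b] \<Omega>m])
  have s1: "sq_integrable (lebesgue_on \<Omega>) (\<lambda>x. of_real (D b x) * u x)"
    by (rule sq_integrable_bounded_mult[OF us(1), of _ C]) (use Dm W(7)[OF b] in auto)
  have s2: "sq_integrable (lebesgue_on \<Omega>) (\<lambda>x. of_real (D b x) * ?w x)"
    by (rule sq_integrable_bounded_mult[OF us(2)[OF b], of _ C]) (use Dm W(7)[OF b] in auto)
  have s3: "sq_integrable (lebesgue_on \<Omega>) (\<lambda>x. of_real (E b x) * u x)"
    by (rule sq_integrable_bounded_mult[OF us(1), of _ C]) (use Em W(8)[OF b] in auto)
  have wp: "has_weak_partial \<Omega> b (\<lambda>x. of_real (D b x) * u x) (\<lambda>x. of_real (D b x) * ?w x + of_real (E b x) * u x)"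
    using has_weak_partial_mult[OF \<Omega> us(1) us(2)[OF b] us(3)[OF b] W(3)[OF b] b] by (simp add: W(6)[OF b])
  define z where "z = L2_inner \<Omega> (\<lambda>x. of_real (D b x) * ?w x) u"
  have "L2_inner \<Omega> (\<lambda>x. of_real (D b x) * u x) ?w = cnj z"
    unfolding z_def L2_inner_cnj[symmetric] unfolding L2_inner_def
    by (intro Bochner_Integration.integral_cong refl) simp
  moreover have "L2_inner \<Omega> (\<lambda>x. of_real (D b x) * u x) ?w
      = - L2_inner \<Omega> (\<lambda>x. of_real (D b x) * ?w x + of_real (E b x) * u x) u"
    by (rule weak_integration_by_parts[OF \<Omega> s1 sq_integrable_add[OF s2 s3] wp uH b])
  moreover have "L2_inner \<Omega> (\<lambda>x. of_real (D b x) * ?w x + of_real (E b x) * u x) u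
      = z + L2_inner \<Omega> (\<lambda>x. of_real (E b x) * u x) u"
    unfolding z_def L2_inner_def distrib_right
    by (intro Bochner_Integration.integral_add sq_integrable_mult_cnj_integrable us(1) s2 s3)
  moreover have "L2_inner \<Omega> (\<lambda>x. of_real (E b x) * u x) u = of_real (LINT x|lebesgue_on \<Omega>. E b x * (norm (u x))\<^sup>2)"
    unfolding L2_inner_def integral_complex_of_real[symmetric]
    by (intro Bochner_Integration.integral_cong refl) (simp add: complex_norm_square algebra_simps del: of_real_power)
  ultimately have "cnj z = - z - of_real (LINT x|lebesgue_on \<Omega>. E b x * (norm (u x))\<^sup>2)" by simp
  then have "Re (cnj z) = Re (- z - of_real (LINT x|lebesgue_on \<Omega>. E b x * (norm (u x))\<^sup>2))" by simp
  then show ?thesis by (simp add: z_def)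
qed

text \<open>Twice the energy identity, with the cross term integrated by parts, has the nonnegative
  remainder 2 \<psi> |grad u|^2, which is dropped. The test weight \<psi> lives on the whole space
  and need not vanish on the boundary, so the inequality passes to |u|^2 extended by zero.\<close>

lemma square_subsolution:
  assumes \<Omega>: "open \<Omega>" and u: "u \<in> eigenspace \<Omega> (dirichlet_laplacian \<Omega>) (of_real l)"
    and \<psi>: "C2_weight \<psi> D E C" and nn: "\<And>x. 0 \<le> \<psi> x"
  shows "0 \<le> (LINT x|lebesgue_on \<Omega>. ((\<Sum>b\<in>Basis. E b x) + 2 * l * \<psi> x) * (norm (u x))\<^sup>2)"
proof -
  have \<Omega>m: "\<Omega> \<in> sets lebesgue" using \<Omega> by (rule open_in_sets_lebesgue)
  note uH = eigenspace_iff(1)[OF u]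
  note us = H1_0_sq_integrable[OF uH]
  note W = C2_weightD[OF \<psi>]
  have int: "integrable (lebesgue_on \<Omega>) (\<lambda>x. f x * (norm (u x))\<^sup>2)"
    if "smooth (\<lambda>x. of_real (f x))" "\<And>x. \<bar>f x\<bar> \<le> C" for f :: "'a \<Rightarrow> real"
  proof (rule Bochner_Integration.integrable_bound)
    show "integrable (lebesgue_on \<Omega>) (\<lambda>x. C * (norm (u x))\<^sup>2)" using us(1) by (simp add: sq_integrable_def)
    show "(\<lambda>x. f x * (norm (u x))\<^sup>2) \<in> borel_measurable (lebesgue_on \<Omega>)"
      using smooth_real_measurable[OF that(1) \<Omega>m] sq_integrable_measurable[OF us(1)] by measurable
    show "AE x in lebesgue_on \<Omega>. norm (f x * (norm (u x))\<^sup>2) \<le> norm (C * (norm (u x))\<^sup>2)"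
      using that(2) by (intro AE_I2) (auto simp: abs_mult intro!: mult_right_mono intro: order_trans[OF _ abs_ge_self])
  qed
  have en: "l * (LINT x|lebesgue_on \<Omega>. \<psi> x * (norm (u x))\<^sup>2)
    = (\<Sum>b\<in>Basis. (LINT x|lebesgue_on \<Omega>. \<psi> x * (norm (weak_partial \<Omega> b u x))\<^sup>2)
         + Re (L2_inner \<Omega> (\<lambda>x. of_real (D b x) * weak_partial \<Omega> b u x) u))"
    by (rule weighted_energy_identity[OF \<Omega> u W(1) W(5) W(2) W(7)])
  have "2 * l * (LINT x|lebesgue_on \<Omega>. \<psi> x * (norm (u x))\<^sup>2)
    = (\<Sum>b\<in>Basis. 2 * (LINT x|lebesgue_on \<Omega>. \<psi> x * (norm (weak_partial \<Omega> b u x))\<^sup>2)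
         - (LINT x|lebesgue_on \<Omega>. E b x * (norm (u x))\<^sup>2))"
    unfolding mult.assoc[of 2 l] en sum_distrib_left
    by (rule sum.cong) (simp_all add: distrib_left gradient_term_by_parts[OF \<Omega> uH \<psi>])
  also have "\<dots> \<ge> (\<Sum>b\<in>Basis. - (LINT x|lebesgue_on \<Omega>. E b x * (norm (u x))\<^sup>2))"
    using nn by (intro sum_mono) simp
  finally have "0 \<le> (\<Sum>b\<in>Basis. LINT x|lebesgue_on \<Omega>. E b x * (norm (u x))\<^sup>2)
      + 2 * l * (LINT x|lebesgue_on \<Omega>. \<psi> x * (norm (u x))\<^sup>2)"
    by (simp add: sum_negf)
  also have "\<dots> = (LINT x|lebesgue_on \<Omega>. (\<Sum>b\<in>Basis. E b x * (norm (u x))\<^sup>2) + 2 * l * (\<psi> x * (norm (u x))\<^sup>2))"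
    using int[OF W(1) W(2)] int[OF W(4) W(8)]
    by (subst Bochner_Integration.integral_add) (auto simp: Bochner_Integration.integral_sum)
  also have "\<dots> = (LINT x|lebesgue_on \<Omega>. ((\<Sum>b\<in>Basis. E b x) + 2 * l * \<psi> x) * (norm (u x))\<^sup>2)"
    by (simp add: algebra_simps sum_distrib_right)
  finally show ?thesis .
qed

section \<open>Boundedness of eigenfunctions\<close>

text \<open>Differentiation under the integral sign: on the convex set S the bound B for f' also
  bounds the difference quotients, so dominated convergence applies along every sequence tending to
  t.\<close>

lemma has_real_derivative_integral:
  fixes f f' :: "real \<Rightarrow> 'a \<Rightarrow> real"
  assumes S: "open S" "convex S" "t \<in> S"
    and int: "\<And>s. s \<in> S \<Longrightarrow> integrable M (f s)"
    and der: "\<And>s x. s \<in> S \<Longrightarrow> ((\<lambda>s. f s x) has_real_derivative f' s x) (at s)"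
    and bd: "\<And>s x. s \<in> S \<Longrightarrow> \<bar>f' s x\<bar> \<le> B x" and B: "integrable M B"
    and m: "f' t \<in> borel_measurable M"
  shows "((\<lambda>s. \<integral>x. f s x \<partial>M) has_real_derivative (\<integral>x. f' t x \<partial>M)) (at t)"
proof -
  have "((\<lambda>s. (\<integral>x. f s x \<partial>M)) has_real_derivative (\<integral>x. f' t x \<partial>M)) (at t within S)"
    unfolding has_field_derivative_iff tendsto_at_iff_sequentially comp_def
  proof (intro allI impI)
    fix X :: "nat \<Rightarrow> real" assume X: "\<forall>i. X i \<in> S - {t}" "X \<longlonglongrightarrow> t"
    have XS: "X i \<in> S" "X i \<noteq> t" for i using X(1) by auto
    have q: "((\<integral>x. f (X i) x \<partial>M) - (\<integral>x. f t x \<partial>M)) / (X i - t) = (\<integral>x. (f (X i) x - f t x) / (X i - t) \<partial>M)" for i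
      using int[OF XS(1)] int[OF S(3)] by (simp add: Bochner_Integration.integral_diff)
    show "(\<lambda>i. ((\<integral>x. f (X i) x \<partial>M) - (\<integral>x. f t x \<partial>M)) / (X i - t)) \<longlonglongrightarrow> (\<integral>x. f' t x \<partial>M)"
      unfolding q
    proof (rule integral_dominated_convergence[OF m _ B])
      show "(\<lambda>x. (f (X i) x - f t x) / (X i - t)) \<in> borel_measurable M" for i
        using borel_measurable_integrable[OF int[OF XS(1)], of i] borel_measurable_integrable[OF int[OF S(3)]]
        by measurable
      show "AE x in M. (\<lambda>i. (f (X i) x - f t x) / (X i - t)) \<longlonglongrightarrow> f' t x"
      proof (rule AE_I2)
        fix x
        have "((\<lambda>s. f s x) has_real_derivative f' t x) (at t within S)"
          using der[OF S(3)] by (rule has_field_derivative_at_within)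
        then show "(\<lambda>i. (f (X i) x - f t x) / (X i - t)) \<longlonglongrightarrow> f' t x"
          unfolding has_field_derivative_iff tendsto_at_iff_sequentially comp_def using X by blast
      qed
      show "AE x in M. norm ((f (X i) x - f t x) / (X i - t)) \<le> B x" for i
      proof (rule AE_I2)
        fix x
        have "norm (f (X i) x - f t x) \<le> B x * norm (X i - t)"
          using S(2) by (rule field_differentiable_bound[where f' = "\<lambda>s. f' s x"])
            (use der bd XS(1) S(3) in \<open>auto intro: has_field_derivative_at_within\<close>)
        then show "norm ((f (X i) x - f t x) / (X i - t)) \<le> B x"
          using XS(2)[of i] by (simp add: divide_le_eq)
      qed
    qed
  qed
  then show ?thesis using at_within_open[OF S(3,1)] by simp
qed

lemma mult_exp_minus_le_one: "(z::real) * exp (- z) \<le> 1"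
proof -
  have "z \<le> exp z" using exp_ge_add_one_self[of z] by linarith
  then show ?thesis by (simp add: exp_minus divide_simps)
qed

text \<open>The estimate z exp(-z) <= 1 at z = k q absorbs the polynomial factors. The three
  resulting bounds 1, 2 k + 2 and 6 k are all covered by 3 + 8 k.\<close>

lemma gaussian_C2_weight:
  fixes x0 :: "'a::euclidean_space"
  assumes k: "0 < k"
  defines "q \<equiv> \<lambda>x. (x - x0) \<bullet> (x - x0)"
  shows "C2_weight (\<lambda>x. exp (- k * q x)) (\<lambda>b x. - 2 * k * ((x - x0) \<bullet> b) * exp (- k * q x))
     (\<lambda>b x. (4 * k\<^sup>2 * ((x - x0) \<bullet> b)\<^sup>2 - 2 * k) * exp (- k * q x)) (3 + 8 * k)"
  unfolding C2_weight_def
proof (intro conjI ballI allI)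
  have q0: "0 \<le> q x" for x by (simp add: q_def)
  have qs: "of_real (- k * q x) = (\<Sum>b\<in>Basis. of_real (- k) * ((of_real (x \<bullet> b) - of_real (x0 \<bullet> b)) * (of_real (x \<bullet> b) - of_real (x0 \<bullet> b))) :: complex)" for x
    unfolding q_def by (subst euclidean_inner) (simp add: sum_distrib_left inner_diff_left)
  have "smooth (\<lambda>x. of_real (- k * q x))"
    unfolding qs by (intro smooth_sum smooth_mult smooth_diff smooth_const smooth_inner)
  then show "smooth (\<lambda>x. of_real (exp (- k * q x)))"
    by (rule smooth_compose_family[where F = "\<lambda>_. exp" and i = "()" and s = "\<lambda>_. ()", OF DERIV_exp])
  have d: "((\<lambda>x. exp (- k * q x)) has_derivative (\<lambda>h. - 2 * k * ((x - x0) \<bullet> h) * exp (- k * q x))) (at x)" for x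
    unfolding q_def by (rule has_derivative_eq_rhs, (rule derivative_intros)+) (auto simp: inner_commute algebra_simps)
  have e: "((\<lambda>x. - 2 * k * ((x - x0) \<bullet> b) * exp (- k * q x)) has_derivative
      (\<lambda>h. - 2 * k * ((x - x0) \<bullet> b) * (- 2 * k * ((x - x0) \<bullet> h) * exp (- k * q x)) + - 2 * k * (h \<bullet> b) * exp (- k * q x))) (at x)" for b x
    by (rule has_derivative_eq_rhs, rule has_derivative_mult[OF _ d], (rule derivative_intros)+) (auto simp: algebra_simps)
  fix b :: 'a assume b: "b \<in> Basis"
  show "partial_deriv b (\<lambda>x. of_real (exp (- k * q x))) = (\<lambda>x. of_real (- 2 * k * ((x - x0) \<bullet> b) * exp (- k * q x)))"
    by (rule ext) (rule partial_deriv_eqI[OF has_derivative_of_real[OF d]])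
  show "partial_deriv b (\<lambda>x. of_real (- 2 * k * ((x - x0) \<bullet> b) * exp (- k * q x)))
      = (\<lambda>x. of_real ((4 * k\<^sup>2 * ((x - x0) \<bullet> b)\<^sup>2 - 2 * k) * exp (- k * q x)))"
    by (rule ext, subst partial_deriv_eqI[OF has_derivative_of_real[OF e]])
      (use b in \<open>simp add: algebra_simps power2_eq_square\<close>)
next
  fix x
  have q0: "0 \<le> q x" by (simp add: q_def)
  have G: "0 < exp (- k * q x)" "exp (- k * q x) \<le> 1" using k q0 by auto
  have kG: "k * q x * exp (- k * q x) \<le> 1" using mult_exp_minus_le_one[of "k * q x"] by simp
  show "\<bar>exp (- k * q x)\<bar> \<le> 3 + 8 * k" unfolding abs_exp_cancel using G(2) k by linarith
  fix b :: 'a assume b: "b \<in> Basis"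
  have yb: "((x - x0) \<bullet> b)\<^sup>2 \<le> q x"
    using Cauchy_Schwarz_ineq[of "x - x0" b] b by (simp add: q_def inner_Basis)
  have y1: "\<bar>(x - x0) \<bullet> b\<bar> \<le> 1 + q x"
  proof -
    have "2 * \<bar>(x - x0) \<bullet> b\<bar> * 1 \<le> \<bar>(x - x0) \<bullet> b\<bar>\<^sup>2 + 1\<^sup>2" by (rule sum_squares_bound)
    then show ?thesis using yb by simp
  qed
  have "\<bar>- 2 * k * ((x - x0) \<bullet> b) * exp (- k * q x)\<bar> = 2 * k * exp (- k * q x) * \<bar>(x - x0) \<bullet> b\<bar>"
    using k by (simp add: abs_mult)
  also have "\<dots> \<le> 2 * k * exp (- k * q x) * (1 + q x)" using k y1 by (intro mult_left_mono) auto
  also have "\<dots> = 2 * k * exp (- k * q x) + 2 * (k * q x * exp (- k * q x))" by (simp add: algebra_simps)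
  also have "\<dots> \<le> 2 * k * 1 + 2 * 1" using k G kG by (intro add_mono mult_left_mono) auto
  also have "\<dots> \<le> 3 + 8 * k" using k by simp
  finally show "\<bar>- 2 * k * ((x - x0) \<bullet> b) * exp (- k * q x)\<bar> \<le> 3 + 8 * k" .
  have "\<bar>(4 * k\<^sup>2 * ((x - x0) \<bullet> b)\<^sup>2 - 2 * k) * exp (- k * q x)\<bar>
      \<le> (4 * k\<^sup>2 * q x + 2 * k) * exp (- k * q x)"
    unfolding abs_mult abs_exp_cancel
  proof (intro mult_right_mono)
    have "0 \<le> 4 * k\<^sup>2 * ((x - x0) \<bullet> b)\<^sup>2" "4 * k\<^sup>2 * ((x - x0) \<bullet> b)\<^sup>2 \<le> 4 * k\<^sup>2 * q x"
      using yb by (auto intro: mult_left_mono)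
    then show "\<bar>4 * k\<^sup>2 * ((x - x0) \<bullet> b)\<^sup>2 - 2 * k\<bar> \<le> 4 * k\<^sup>2 * q x + 2 * k" using k by linarith
  qed simp
  also have "\<dots> = 4 * k * (k * q x * exp (- k * q x)) + 2 * k * exp (- k * q x)"
    by (simp add: algebra_simps power2_eq_square)
  also have "\<dots> \<le> 4 * k * 1 + 2 * k * 1" using k G kG by (intro add_mono mult_left_mono) auto
  also have "\<dots> \<le> 3 + 8 * k" using k by simp
  finally show "\<bar>(4 * k\<^sup>2 * ((x - x0) \<bullet> b)\<^sup>2 - 2 * k) * exp (- k * q x)\<bar> \<le> 3 + 8 * k" .
qed

lemma integrable_bounded_continuous_mult:
  fixes W g :: "'a::euclidean_space \<Rightarrow> real"
  assumes W: "integrable lebesgue W" and g: "continuous_on UNIV g" "\<And>x. \<bar>g x\<bar> \<le> C"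
  shows "integrable lebesgue (\<lambda>x. W x * g x)"
proof (rule Bochner_Integration.integrable_bound)
  have gm: "g \<in> borel_measurable lebesgue"
    using borel_measurable_continuous_onI[OF g(1)] by (simp add: measurable_completion)
  show "integrable lebesgue (\<lambda>x. C * W x)" using W by simp
  show "(\<lambda>x. W x * g x) \<in> borel_measurable lebesgue"
    by (intro borel_measurable_times borel_measurable_integrable[OF W] gm)
  have "\<bar>W x\<bar> * \<bar>g x\<bar> \<le> \<bar>W x\<bar> * \<bar>C\<bar>" for x
    using g(2)[of x] by (intro mult_left_mono) auto
  then show "AE x in lebesgue. norm (W x * g x) \<le> norm (C * W x)"
    by (intro AE_I2) (simp add: abs_mult mult.commute)
qed

text \<open>
  The Gaussian average at \<open>x0\<close> with heat time \<open>r\<^sup>2\<close>, weighted by \<open>exp (2 * l * r\<^sup>2)\<close>, is nondecreasing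
  in \<open>r\<close>, because the heat kernel turns the derivative in \<open>r\<close> into the tested differential inequality.
\<close>

lemma gaussian_average_mono:
  fixes W :: "'a::euclidean_space \<Rightarrow> real" and x0 :: 'a
  assumes W: "integrable lebesgue W" and l: "0 \<le> l"
    and sub: "\<And>\<psi> D E C. C2_weight \<psi> D E C \<Longrightarrow> (\<And>x. 0 \<le> \<psi> x) \<Longrightarrow>
        0 \<le> (LINT x|lebesgue. W x * ((\<Sum>b\<in>Basis. E b x) + 2 * l * \<psi> x))"
    and r: "0 < r" "r \<le> 1"
  defines "P \<equiv> \<lambda>r x. exp (2 * l * r\<^sup>2 - (x - x0) \<bullet> (x - x0) / (4 * r\<^sup>2)) / r ^ DIM('a)"
  shows "(LINT x|lebesgue. W x * P r x) \<le> (LINT x|lebesgue. W x * P 1 x)"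
proof -
  define q where "q x = (x - x0) \<bullet> (x - x0)" for x
  have q0: "0 \<le> q x" for x by (simp add: q_def)
  have qc: "continuous_on UNIV q" unfolding q_def by (intro continuous_intros)
  \<comment> \<open>The bracket is the logarithmic derivative of P in r; its last term comes from
    the normalisation r^(-d).\<close>
  define P' where "P' r x = P r x * (4 * l * r + q x / (2 * r ^ 3) - DIM('a) / r)" for r x
  have P: "P s x = exp (2 * l * s\<^sup>2) * exp (- (q x / (4 * s\<^sup>2))) / s ^ DIM('a)" for s x
    unfolding P_def q_def diff_conv_add_uminus exp_add by (rule refl)
  have Pc: "continuous_on UNIV (P s)" if "0 < s" for s
    unfolding P[abs_def] using qc that by (intro continuous_intros) auto
  have P'c: "continuous_on UNIV (P' s)" if "0 < s" for s
    unfolding P'_def[abs_def] using qc Pc[OF that] that by (intro continuous_intros) auto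
  have Pder: "((\<lambda>s. P s x) has_real_derivative P' s x) (at s)" if s: "s > 0" for s x
    unfolding P_def P'_def q_def[symmetric] using s
    by (auto intro!: derivative_eq_intros simp: field_simps power2_eq_square power3_eq_cube
        power_Suc[symmetric] simp del: power_Suc)
  have Pb: "\<bar>P s x\<bar> \<le> exp (8 * l) / a ^ DIM('a)" if s: "0 < a" "a < s" "s < 2" for a s x
  proof -
    have "s\<^sup>2 \<le> 2\<^sup>2" using s by (intro power_mono) auto
    then have "l * s\<^sup>2 \<le> l * 4" using l by (intro mult_left_mono) auto
    moreover have "0 \<le> q x / (4 * s\<^sup>2)" using q0[of x] by simp
    ultimately have "2 * l * s\<^sup>2 - q x / (4 * s\<^sup>2) \<le> 8 * l" by linarith
    then have "exp (2 * l * s\<^sup>2 - q x / (4 * s\<^sup>2)) \<le> exp (8 * l)" by simp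
    moreover have "a ^ DIM('a) \<le> s ^ DIM('a)" using s by (intro power_mono) auto
    ultimately show ?thesis unfolding P_def q_def[symmetric] using s by (simp add: frac_le)
  qed
  have P'b: "\<bar>P' s x\<bar> \<le> exp (8 * l) / a ^ DIM('a) * (8 * l + 2 / a + DIM('a) / a)" 
    if s: "0 < a" "a < s" "s < 2" for a s x
  proof -
    define g where "g = exp (2 * l * s\<^sup>2) / s ^ DIM('a)"
    define z where "z = q x / (4 * s\<^sup>2)"
    have z: "0 \<le> z" using q0[of x] by (simp add: z_def)
    have "s\<^sup>2 \<le> 2\<^sup>2" using s by (intro power_mono) auto
    then have "l * s\<^sup>2 \<le> l * 4" using l by (intro mult_left_mono) auto
    then have "exp (2 * l * s\<^sup>2) \<le> exp (8 * l)" by simp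
    moreover have "a ^ DIM('a) \<le> s ^ DIM('a)" using s by (intro power_mono) auto
    ultimately have g: "0 \<le> g" "g \<le> exp (8 * l) / a ^ DIM('a)" using s by (auto simp: g_def frac_le)
    \<comment> \<open>In terms of z the growing factor appears as z exp(-z) <= 1, so the bound is
      uniform in x.\<close>
    have "q x / (2 * s ^ 3) = 2 * z / s" using s by (simp add: z_def field_simps power2_eq_square power3_eq_cube)
    then have "P' s x = (g * exp (- z)) * (4 * l * s + 2 / s * z - DIM('a) / s)"
      unfolding P'_def P g_def z_def[symmetric] by simp
    also have "\<dots> = g * (exp (- z) * (4 * l * s) + 2 / s * (z * exp (- z)) - exp (- z) * (DIM('a) / s))"
      unfolding right_diff_distrib distrib_left by (simp only: ac_simps)
    finally have P'eq: "P' s x = g * (exp (- z) * (4 * l * s) + 2 / s * (z * exp (- z)) - exp (- z) * (DIM('a) / s))" .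
    have "\<bar>P' s x\<bar> = g * \<bar>exp (- z) * (4 * l * s) + 2 / s * (z * exp (- z)) - exp (- z) * (DIM('a) / s)\<bar>"
      unfolding P'eq using g by (simp add: abs_mult)
    also have "\<dots> \<le> g * (8 * l + 2 / a + DIM('a) / a)"
    proof (intro mult_left_mono g(1))
      have e: "0 \<le> exp (- z)" "exp (- z) \<le> 1" using z by auto
      have "exp (- z) * (4 * l * s) \<le> 1 * (4 * l * 2)" using e l s by (intro mult_mono) auto
      moreover have "2 / s * (z * exp (- z)) \<le> 2 / a * 1"
        using s z mult_exp_minus_le_one[of z] by (intro mult_mono) (auto simp: frac_le)
      moreover have "exp (- z) * (DIM('a) / s) \<le> 1 * (DIM('a) / a)"
        using e s by (intro mult_mono) (auto simp: frac_le)
      moreover have "0 \<le> exp (- z) * (4 * l * s)" "0 \<le> 2 / s * (z * exp (- z))" "0 \<le> exp (- z) * (DIM('a) / s)"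
        using e l s z by auto
      ultimately show "\<bar>exp (- z) * (4 * l * s) + 2 / s * (z * exp (- z)) - exp (- z) * (DIM('a) / s)\<bar> \<le> 8 * l + 2 / a + DIM('a) / a"
        by linarith
    qed
    also have "\<dots> \<le> exp (8 * l) / a ^ DIM('a) * (8 * l + 2 / a + DIM('a) / a)"
      using g l s by (intro mult_right_mono) auto
    finally show ?thesis .
  qed
  have der: "((\<lambda>s. LINT x|lebesgue. W x * P s x) has_real_derivative (LINT x|lebesgue. W x * P' t x)) (at t)"
    if t: "0 < t" "t < 2" for t
  proof -
    \<comment> \<open>Staying above t/2 keeps the dominating constant away from the singularity at
      0; the upper end 2 leaves room around the final radius 1.\<close>
    define a where "a = t / 2"
    have a: "0 < a" "a < t" using t by (auto simp: a_def)
    define K where "K = exp (8 * l) / a ^ DIM('a) * (8 * l + 2 / a + DIM('a) / a)"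
    show ?thesis
    proof (rule has_real_derivative_integral[where S = "{a<..<2}" and B = "\<lambda>x. \<bar>W x\<bar> * K"])
      show "integrable lebesgue (\<lambda>x. W x * P s x)" if "s \<in> {a<..<2}" for s
        using that a by (intro integrable_bounded_continuous_mult[OF W Pc Pb[of a]]) auto
      show "((\<lambda>s. W x * P s x) has_real_derivative W x * P' s x) (at s)" if "s \<in> {a<..<2}" for s x
        using that a by (intro DERIV_cmult Pder) auto
      show "\<bar>W x * P' s x\<bar> \<le> \<bar>W x\<bar> * K" if "s \<in> {a<..<2}" for s x
        unfolding abs_mult K_def using that a by (intro mult_left_mono P'b) auto
      show "integrable lebesgue (\<lambda>x. \<bar>W x\<bar> * K)" using W by simp
      show "(\<lambda>x. W x * P' t x) \<in> borel_measurable lebesgue"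
        using borel_measurable_integrable[OF W] borel_measurable_continuous_onI[OF P'c[OF t(1)]]
        by (intro borel_measurable_times) (simp_all add: measurable_completion)
    qed (use t a in auto)
  qed
  have nonneg: "0 \<le> (LINT x|lebesgue. W x * P' t x)" if t: "0 < t" for t
  proof -
    define k where "k = 1 / (4 * t\<^sup>2)"
    have k: "k > 0" using t by (simp add: k_def)
    \<comment> \<open>The factor 2 t is the derivative of the heat time t^2. The heat equation turns
      P' into c times the Laplacian plus 2 l, applied to the Gaussian with this k.\<close>
    define c where "c = 2 * t * exp (2 * l * t\<^sup>2) / t ^ DIM('a)"
    have c: "c \<ge> 0" using t by (simp add: c_def)
    have eq: "P' t x = c * ((\<Sum>b\<in>Basis. (4 * k\<^sup>2 * ((x - x0) \<bullet> b)\<^sup>2 - 2 * k) * exp (- k * q x)) + 2 * l * exp (- k * q x))" for x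
    proof -
      have "(\<Sum>b\<in>Basis. (4 * k\<^sup>2 * ((x - x0) \<bullet> b)\<^sup>2 - 2 * k) * exp (- k * q x))
         = (4 * k\<^sup>2 * (\<Sum>b\<in>Basis. ((x - x0) \<bullet> b)\<^sup>2) - 2 * k * DIM('a)) * exp (- k * q x)"
        by (simp add: sum_distrib_right[symmetric] sum_subtractf sum_distrib_left)
      also have "(\<Sum>b\<in>Basis. ((x - x0) \<bullet> b)\<^sup>2) = q x"
        unfolding q_def by (subst euclidean_inner) (simp add: power2_eq_square)
      finally have s: "(\<Sum>b\<in>Basis. (4 * k\<^sup>2 * ((x - x0) \<bullet> b)\<^sup>2 - 2 * k) * exp (- k * q x))
         = (4 * k\<^sup>2 * q x - 2 * k * DIM('a)) * exp (- k * q x)" .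
      have Y: "4 * l * t + q x / (2 * t ^ 3) - DIM('a) / t = 2 * t * (4 * k\<^sup>2 * q x - 2 * k * DIM('a) + 2 * l)"
        using t by (simp add: k_def field_simps power2_eq_square power3_eq_cube)
      have Pt: "P t x = exp (2 * l * t\<^sup>2) / t ^ DIM('a) * exp (- k * q x)"
        unfolding P by (simp add: k_def)
      have "P' t x = c * ((4 * k\<^sup>2 * q x - 2 * k * DIM('a) + 2 * l) * exp (- k * q x))"
        unfolding P'_def Y Pt c_def by simp
      then show ?thesis unfolding s distrib_right .
    qed
    have "0 \<le> (LINT x|lebesgue. W x * ((\<Sum>b\<in>Basis. (4 * k\<^sup>2 * ((x - x0) \<bullet> b)\<^sup>2 - 2 * k) * exp (- k * q x)) + 2 * l * exp (- k * q x)))"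
      unfolding q_def by (rule sub[OF gaussian_C2_weight[OF k]]) simp
    then have "0 \<le> c * (LINT x|lebesgue. W x * ((\<Sum>b\<in>Basis. (4 * k\<^sup>2 * ((x - x0) \<bullet> b)\<^sup>2 - 2 * k) * exp (- k * q x)) + 2 * l * exp (- k * q x)))"
      using c by simp
    also have "\<dots> = (LINT x|lebesgue. W x * P' t x)"
      unfolding eq Bochner_Integration.integral_mult_right_zero[symmetric] by (simp only: mult.left_commute)
    finally show ?thesis .
  qed
  show ?thesis
  proof (rule DERIV_nonneg_imp_nondecreasing[OF r(2)])
    fix t assume "r \<le> t" "t \<le> 1"
    then have "0 < t" "t < 2" using r by auto
    then show "\<exists>y. ((\<lambda>s. LINT x|lebesgue. W x * P s x) has_real_derivative y) (at t) \<and> 0 \<le> y"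
      using der nonneg by blast
  qed
qed

text \<open>On a cube of side h at y one has |x - y|^2 <= d h^2, so the kernel of radius h is at
  least exp(-d/4) / h^d there. The cube average is thus at most exp(d/4) times the Gaussian average,
  which increases up to radius 1, where the kernel is at most exp(2 l). Lebesgue differentiation
  turns the bound K on averages into one on W.\<close>

lemma AE_bounded_of_gaussian_average:
  fixes W :: "'a::euclidean_space \<Rightarrow> real"
  assumes W: "integrable lebesgue W" and W0: "\<And>x. 0 \<le> W x" and l: "0 \<le> l"
    and sub: "\<And>\<psi> D E C. C2_weight \<psi> D E C \<Longrightarrow> (\<And>x. 0 \<le> \<psi> x) \<Longrightarrow>
        0 \<le> (LINT x|lebesgue. W x * ((\<Sum>b\<in>Basis. E b x) + 2 * l * \<psi> x))"
  shows "\<exists>C. AE x in lebesgue. W x \<le> C"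
proof -
  define K where "K = exp (2 * l + DIM('a) / 4) * (LINT x|lebesgue. W x)"
  have Wai: "W absolutely_integrable_on cbox a b" for a b
    unfolding set_integrable_def
    by (rule integrable_mult_indicator[OF _ W]) (simp add: sets_completionI_sets)
  have avg: "integral (cbox y (y + h *\<^sub>R One)) W / h ^ DIM('a) \<le> K" if h: "0 < h" "h \<le> 1" for y h
  proof -
    let ?Q = "cbox y (y + h *\<^sub>R One)"
    define P where "P r x = exp (2 * l * r\<^sup>2 - (x - y) \<bullet> (x - y) / (4 * r\<^sup>2)) / r ^ DIM('a)" for r x
    have Pc: "continuous_on UNIV (P r)" if "0 < r" for r
      unfolding P_def[abs_def] using that by (intro continuous_intros) auto
    have P0: "0 \<le> P r x" if "0 < r" for r x using that by (simp add: P_def)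
    have Pb: "\<bar>P r x\<bar> \<le> exp (2 * l) / r ^ DIM('a)" if r: "0 < r" "r \<le> 1" for r x
    proof -
      have "l * r\<^sup>2 \<le> l * 1" using l r by (intro mult_left_mono) (auto simp: power_le_one)
      moreover have "0 \<le> (x - y) \<bullet> (x - y) / (4 * r\<^sup>2)" by simp
      ultimately have "2 * l * r\<^sup>2 - (x - y) \<bullet> (x - y) / (4 * r\<^sup>2) \<le> 2 * l" by linarith
      then show ?thesis using r by (simp add: P_def divide_right_mono)
    qed
    have "integral ?Q W = (LINT x|lebesgue. indicator ?Q x * W x)"
      using set_lebesgue_integral_eq_integral(2)[OF Wai[of y "y + h *\<^sub>R One"]]
      unfolding set_lebesgue_integral_def by simp
    then have "exp (- (DIM('a) / 4)) * (integral ?Q W / h ^ DIM('a))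
        = (LINT x|lebesgue. exp (- (DIM('a) / 4)) / h ^ DIM('a) * (indicator ?Q x * W x))" by simp
    also have "\<dots> \<le> (LINT x|lebesgue. W x * P h x)"
    proof (rule integral_mono)
      show "integrable lebesgue (\<lambda>x. exp (- (DIM('a) / 4)) / h ^ DIM('a) * (indicator ?Q x * W x))"
        using Wai[of y "y + h *\<^sub>R One"] unfolding set_integrable_def by simp
      show "integrable lebesgue (\<lambda>x. W x * P h x)"
        using h by (intro integrable_bounded_continuous_mult[OF W Pc Pb]) auto
      fix x
      show "exp (- (DIM('a) / 4)) / h ^ DIM('a) * (indicator ?Q x * W x) \<le> W x * P h x"
      proof (cases "x \<in> ?Q")
        case True
        have "(x - y) \<bullet> (x - y) = (\<Sum>b\<in>Basis. ((x - y) \<bullet> b)\<^sup>2)"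
          by (subst euclidean_inner) (simp add: power2_eq_square)
        also have "\<dots> \<le> (\<Sum>b\<in>(Basis::'a set). h\<^sup>2)"
          using True by (intro sum_mono power_mono) (auto simp: mem_box inner_diff_left inner_add_left)
        finally have "(x - y) \<bullet> (x - y) / (4 * h\<^sup>2) \<le> DIM('a) / 4" using h by (simp add: divide_le_eq)
        moreover have "0 \<le> 2 * l * h\<^sup>2" using l by simp
        ultimately have "exp (- (DIM('a) / 4)) \<le> exp (2 * l * h\<^sup>2 - (x - y) \<bullet> (x - y) / (4 * h\<^sup>2))" by simp
        then have "exp (- (DIM('a) / 4)) / h ^ DIM('a) \<le> P h x" using h by (simp add: P_def divide_right_mono)
        from mult_left_mono[OF this W0[of x]] show ?thesis using True by (simp add: mult.commute)
      next
        case False then show ?thesis using W0[of x] P0[OF h(1)] by simp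
      qed
    qed
    also have "\<dots> \<le> (LINT x|lebesgue. W x * P 1 x)"
      unfolding P_def by (rule gaussian_average_mono[OF W l sub h])
    also have "\<dots> \<le> (LINT x|lebesgue. W x * exp (2 * l))"
    proof (rule integral_mono)
      show "integrable lebesgue (\<lambda>x. W x * P 1 x)"
        by (intro integrable_bounded_continuous_mult[OF W Pc Pb]) auto
      show "W x * P 1 x \<le> W x * exp (2 * l)" for x
        using Pb[of 1 x] W0[of x] by (intro mult_left_mono) auto
    qed (use W in simp)
    finally have "exp (DIM('a) / 4) * (exp (- (DIM('a) / 4)) * (integral ?Q W / h ^ DIM('a)))
       \<le> exp (DIM('a) / 4) * ((LINT x|lebesgue. W x) * exp (2 * l))"
      by (intro mult_left_mono) auto
    then show ?thesis unfolding mult.assoc[symmetric] exp_add[symmetric] K_def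
      by (simp add: exp_add mult_ac)
  qed
  have "W integrable_on cbox c d" for c d
    using Wai[of c d] set_lebesgue_integral_eq_integral(1) by blast
  then obtain N where N: "negligible N" "\<And>x e. \<lbrakk>x \<notin> N; 0 < e\<rbrakk> \<Longrightarrow>
      \<exists>d>0. \<forall>h. 0 < h \<and> h < d \<longrightarrow> norm (integral (cbox x (x + h *\<^sub>R One)) W /\<^sub>R h ^ DIM('a) - W x) < e"
    using integrable_ccontinuous_explicit[of W] by metis
  have "W x \<le> K" if x: "x \<notin> N" for x
  proof (rule field_le_epsilon)
    fix e :: real assume e: "0 < e"
    obtain d where d: "d > 0" "\<And>h. 0 < h \<Longrightarrow> h < d \<Longrightarrow>
        norm (integral (cbox x (x + h *\<^sub>R One)) W /\<^sub>R h ^ DIM('a) - W x) < e"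
      using N(2)[OF x e] by auto
    define h where "h = min 1 (d / 2)"
    have h: "0 < h" "h \<le> 1" "h < d" using d(1) by (auto simp: h_def)
    show "W x \<le> K + e" using d(2)[OF h(1,3)] avg[OF h(1,2), of x]
      by (simp add: divide_inverse mult.commute abs_less_iff)
  qed
  moreover have "AE x in lebesgue. x \<notin> N"
    using N(1) by (intro AE_not_in) (simp add: negligible_iff_null_sets)
  ultimately show ?thesis by (intro exI[of _ K]) (auto elim: eventually_mono)
qed

lemma eigenfunction_bounded:
  assumes \<Omega>: "open \<Omega>" and u: "u \<in> eigenspace \<Omega> (dirichlet_laplacian \<Omega>) (of_real l)" and l: "0 \<le> l"
  shows "\<exists>C. AE x in lebesgue_on \<Omega>. norm (u x) \<le> C"
proof -
  have \<Omega>m: "\<Omega> \<in> sets lebesgue" using \<Omega> by (rule open_in_sets_lebesgue)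
  have us: "sq_integrable (lebesgue_on \<Omega>) u" using H1_0_sq_integrable(1)[OF eigenspace_iff(1)[OF u]] .
  define W where "W x = (if x \<in> \<Omega> then (norm (u x))\<^sup>2 else 0)" for x
  have "\<exists>C. AE x in lebesgue. W x \<le> C"
  proof (rule AE_bounded_of_gaussian_average[OF _ _ l])
    show "integrable lebesgue W"
      unfolding W_def[abs_def] using us by (simp add: Lebesgue_Measure.integrable_restrict_UNIV \<Omega>m sq_integrable_def)
    show "0 \<le> W x" for x by (simp add: W_def)
    fix \<psi> :: "'a \<Rightarrow> real" and D E C assume \<psi>: "C2_weight \<psi> D E C" "\<And>x. 0 \<le> \<psi> x"
    have "(LINT x|lebesgue. W x * ((\<Sum>b\<in>Basis. E b x) + 2 * l * \<psi> x))
       = (LINT x|lebesgue. (if x \<in> \<Omega> then ((\<Sum>b\<in>Basis. E b x) + 2 * l * \<psi> x) * (norm (u x))\<^sup>2 else 0))"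
      by (rule Bochner_Integration.integral_cong) (auto simp: W_def)
    also have "\<dots> = (LINT x|lebesgue_on \<Omega>. ((\<Sum>b\<in>Basis. E b x) + 2 * l * \<psi> x) * (norm (u x))\<^sup>2)"
      by (rule Lebesgue_Measure.integral_restrict_UNIV[OF \<Omega>m])
    finally show "0 \<le> (LINT x|lebesgue. W x * ((\<Sum>b\<in>Basis. E b x) + 2 * l * \<psi> x))"
      using square_subsolution[OF \<Omega> u \<psi>] by simp
  qed
  then obtain C where "AE x in lebesgue. W x \<le> C" by blast
  then have "AE x in lebesgue. x \<in> \<Omega> \<longrightarrow> norm (u x) \<le> sqrt C"
    by eventually_elim (auto simp: W_def real_le_rsqrt)
  then show ?thesis using \<Omega>m by (auto simp: AE_restrict_space_iff)
qed

section \<open>Weighted eigenfunctions\<close>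

lemma smooth_one_plus_norm: "smooth (\<lambda>x. of_real (1 + e * (x \<bullet> x)))"
proof -
  have *: "of_real (1 + e * (x \<bullet> x)) = 1 + (\<Sum>b\<in>Basis. of_real e * (of_real (x \<bullet> b) * of_real (x \<bullet> b)) :: complex)" for x :: 'a
    by (subst euclidean_inner) (simp add: sum_distrib_left)
  show ?thesis unfolding * by (intro smooth_add smooth_sum smooth_mult smooth_const smooth_inner)
qed

lemma one_plus_norm_pos: "0 \<le> e \<Longrightarrow> 0 < 1 + e * (x \<bullet> x :: real)"
  by (simp add: add_pos_nonneg)

text \<open>By the inequality of the means, 2 e |x . b| <= 1 + e^2 |x|^2. The scaling by e thus
  makes the logarithmic derivative small uniformly in x.\<close>

lemma log_derivative_bound:
  fixes x :: "'a::euclidean_space"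
  assumes "0 < e" "b \<in> Basis"
  shows "\<bar>2 * e\<^sup>2 * (x \<bullet> b) / (1 + e\<^sup>2 * (x \<bullet> x))\<bar> \<le> e"
proof -
  have p: "0 < 1 + e\<^sup>2 * (x \<bullet> x)" by (rule one_plus_norm_pos) simp
  have "2 * (e * \<bar>x \<bullet> b\<bar>) * 1 \<le> (e * \<bar>x \<bullet> b\<bar>)\<^sup>2 + 1\<^sup>2" by (rule sum_squares_bound)
  also have "\<dots> = 1 + e\<^sup>2 * (x \<bullet> b)\<^sup>2" by (simp add: power_mult_distrib)
  also have "\<dots> \<le> 1 + e\<^sup>2 * (x \<bullet> x)"
    using Cauchy_Schwarz_ineq[of x b] assms by (intro add_left_mono mult_left_mono) (simp_all add: inner_Basis)
  finally have "e * (2 * (e * \<bar>x \<bullet> b\<bar>)) \<le> e * (1 + e\<^sup>2 * (x \<bullet> x))" using assms(1) by (intro mult_left_mono) auto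
  moreover have "\<bar>2 * e\<^sup>2 * (x \<bullet> b) / (1 + e\<^sup>2 * (x \<bullet> x))\<bar> = e * (2 * (e * \<bar>x \<bullet> b\<bar>)) / (1 + e\<^sup>2 * (x \<bullet> x))"
    using p assms(1) by (simp add: abs_mult power2_eq_square)
  ultimately show ?thesis using p by (simp add: divide_le_eq)
qed

text \<open>With a the logarithmic derivative of the quotient, D = k a w and E = ((k a)^2 + k da) w.
  Numerator and denominator contribute at most e each to a and 3 e^2 each to da, so the factors are
  at most 2 k e and 4 k^2 e^2 + 6 k e^2, both below 10 k^2 e. These relative bounds do not depend on
  r.\<close>

lemma decay_weight:
  fixes e r :: real and k :: nat
  assumes er: "0 < r" "r \<le> e" "e \<le> 1" and k: "0 < k"
  defines "w \<equiv> \<lambda>x::'a::euclidean_space. ((1 + e\<^sup>2 * (x \<bullet> x)) / (1 + r\<^sup>2 * (x \<bullet> x))) ^ k"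
  shows "\<exists>D E C. C2_weight w D E C \<and>
    (\<forall>b\<in>Basis. \<forall>x. \<bar>D b x\<bar> \<le> 10 * (real k)\<^sup>2 * e * w x \<and> \<bar>E b x\<bar> \<le> 10 * (real k)\<^sup>2 * e * w x)"
proof -
  define p where "p e x = 1 + e\<^sup>2 * (x \<bullet> x)" for e and x :: 'a
  have p: "0 < p e x" for e x unfolding p_def by (rule one_plus_norm_pos) simp
  define y where "y x = p e x / p r x" for x :: 'a
  have y0: "0 < y x" for x by (simp add: y_def p)
  have w: "w x = y x ^ k" for x by (simp add: w_def y_def p_def)
  have w0: "0 < w x" for x by (simp add: w y0)
  define a where "a h x = 2 * e\<^sup>2 * (x \<bullet> h) / p e x - 2 * r\<^sup>2 * (x \<bullet> h) / p r x" for h x :: 'a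
  define da where "da b h x = (2 * e\<^sup>2 * (h \<bullet> b) / p e x - (2 * e\<^sup>2 * (x \<bullet> h) / p e x) * (2 * e\<^sup>2 * (x \<bullet> b) / p e x))
     - (2 * r\<^sup>2 * (h \<bullet> b) / p r x - (2 * r\<^sup>2 * (x \<bullet> h) / p r x) * (2 * r\<^sup>2 * (x \<bullet> b) / p r x))" for b h x :: 'a
  have dp: "((\<lambda>x. p e x) has_derivative (\<lambda>h. 2 * e\<^sup>2 * (x \<bullet> h))) (at x)" for e x
    unfolding p_def by (rule has_derivative_eq_rhs, (rule derivative_intros)+) (auto simp: inner_commute)
  have dy: "(y has_derivative (\<lambda>h. a h x * y x)) (at x)" for x
  proof -
    have pe: "p e x \<noteq> 0" "p r x \<noteq> 0" using p[of e x] p[of r x] by auto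
    show ?thesis unfolding y_def[abs_def]
      by (rule has_derivative_eq_rhs, rule has_derivative_divide'[OF dp dp pe(2)], rule ext)
        (use pe in \<open>simp add: a_def field_simps\<close>)
  qed
  have dw: "(w has_derivative (\<lambda>h. real k * a h x * w x)) (at x)" for x
  proof -
    have "((\<lambda>x. y x ^ k) has_derivative (\<lambda>h. real k * (a h x * y x) * y x ^ (k - 1))) (at x)"
      using has_derivative_power[OF dy, where n = k] by (simp add: algebra_simps)
    moreover have "real k * (a h x * y x) * y x ^ (k - 1) = real k * a h x * y x ^ k" for h
      using k by (simp add: power_eq_if)
    ultimately show ?thesis unfolding w[abs_def] by (simp only:)
  qed
  have db: "((\<lambda>x. 2 * e\<^sup>2 * (x \<bullet> b) / p e x) has_derivative
      (\<lambda>h. 2 * e\<^sup>2 * (h \<bullet> b) / p e x - (2 * e\<^sup>2 * (x \<bullet> h) / p e x) * (2 * e\<^sup>2 * (x \<bullet> b) / p e x))) (at x)" for e b x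
  proof -
    have pe: "p e x \<noteq> 0" using p[of e x] by auto
    have d1: "((\<lambda>x. 2 * e\<^sup>2 * (x \<bullet> b)) has_derivative (\<lambda>h. 2 * e\<^sup>2 * (h \<bullet> b))) (at x)"
      by (intro derivative_intros)
    show ?thesis
      by (rule has_derivative_eq_rhs, rule has_derivative_divide'[OF d1 dp pe], rule ext)
        (use pe in \<open>simp add: field_simps\<close>)
  qed
  have da: "(a b has_derivative (\<lambda>h. da b h x)) (at x)" for b x
    unfolding a_def[abs_def] da_def by (intro has_derivative_diff db)
  define D where "D b x = real k * a b x * w x" for b x
  define E where "E b x = ((real k * a b x)\<^sup>2 + real k * da b b x) * w x" for b x
  have dD: "(D b has_derivative (\<lambda>h. (real k * a b x) * (real k * a h x * w x) + real k * da b h x * w x)) (at x)" for b x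
    unfolding D_def[abs_def] by (intro has_derivative_mult[OF _ dw] has_derivative_mult_right da)
  have ab: "\<bar>a b x\<bar> \<le> 2 * e" if "b \<in> Basis" for b x
    using log_derivative_bound[of e b x] log_derivative_bound[of r b x] er that
    unfolding a_def p_def by linarith
  have dab: "\<bar>da b b x\<bar> \<le> 6 * e\<^sup>2" if b: "b \<in> Basis" for b x
  proof -
    have *: "\<bar>2 * s\<^sup>2 * (b \<bullet> b) / p s x - (2 * s\<^sup>2 * (x \<bullet> b) / p s x) * (2 * s\<^sup>2 * (x \<bullet> b) / p s x)\<bar> \<le> 3 * e\<^sup>2"
      if s: "0 < s" "s \<le> e" for s
    proof -
      have s2: "s\<^sup>2 \<le> e\<^sup>2" using s by (intro power_mono) auto
      define A where "A = 2 * s\<^sup>2 * (b \<bullet> b) / p s x"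
      define B where "B = 2 * s\<^sup>2 * (x \<bullet> b) / p s x"
      have "1 \<le> p s x" by (simp add: p_def)
      then have "2 * s\<^sup>2 / p s x \<le> 2 * s\<^sup>2 / 1" by (intro divide_left_mono) auto
      then have "A \<le> 2 * s\<^sup>2" using b by (simp add: A_def inner_Basis)
      moreover have "0 \<le> A" using p[of s x] by (simp add: A_def)
      moreover have "B\<^sup>2 \<le> s\<^sup>2"
        using log_derivative_bound[OF s(1) b, of x] s(1) unfolding B_def p_def
        by (subst abs_le_square_iff[symmetric]) simp
      moreover have "0 \<le> B\<^sup>2" by simp
      ultimately have "\<bar>A - B\<^sup>2\<bar> \<le> 3 * e\<^sup>2" using s2 by linarith
      then show ?thesis unfolding A_def B_def power2_eq_square[of "_ / _"] .
    qed
    have "0 < e" using er by linarith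
    from abs_triangle_ineq4[THEN order_trans, OF add_mono[OF *[OF this order_refl] *[OF er(1,2)]]]
    show ?thesis unfolding da_def by simp
  qed
  have k1: "1 \<le> real k" using k by simp
  have kk: "real k \<le> (real k)\<^sup>2" using k1 by (simp add: power2_eq_square)
  have ee: "e\<^sup>2 \<le> e" using er by (simp add: power2_eq_square mult_left_le)
  have Db: "\<bar>D b x\<bar> \<le> 10 * (real k)\<^sup>2 * e * w x" if b: "b \<in> Basis" for b x
  proof -
    have "real k * \<bar>a b x\<bar> \<le> real k * (2 * e)" using ab[OF b] by (intro mult_left_mono) auto
    also have "\<dots> \<le> (real k)\<^sup>2 * (10 * e)" using kk er by (intro mult_mono) auto
    finally have "real k * \<bar>a b x\<bar> * w x \<le> (real k)\<^sup>2 * (10 * e) * w x" using w0[of x] by (intro mult_right_mono) auto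
    then show ?thesis using w0[of x] by (simp add: D_def abs_mult mult_ac)
  qed
  have Eb: "\<bar>E b x\<bar> \<le> 10 * (real k)\<^sup>2 * e * w x" if b: "b \<in> Basis" for b x
  proof -
    have "(real k * a b x)\<^sup>2 \<le> (real k * (2 * e))\<^sup>2"
      using ab[OF b, of x] er by (subst abs_le_square_iff[symmetric]) (simp add: abs_mult mult_left_mono)
    also have "\<dots> = 4 * ((real k)\<^sup>2 * e\<^sup>2)" by (simp add: power_mult_distrib)
    finally have 1: "(real k * a b x)\<^sup>2 \<le> 4 * ((real k)\<^sup>2 * e\<^sup>2)" .
    have "real k * \<bar>da b b x\<bar> \<le> (real k)\<^sup>2 * (6 * e\<^sup>2)" using dab[OF b] kk by (intro mult_mono) auto
    then have "\<bar>real k * da b b x\<bar> \<le> 6 * ((real k)\<^sup>2 * e\<^sup>2)" by (simp add: abs_mult)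
    with 1 have "\<bar>(real k * a b x)\<^sup>2 + real k * da b b x\<bar> \<le> 10 * ((real k)\<^sup>2 * e\<^sup>2)"
      using zero_le_power2[of "real k * a b x"] by linarith
    also have "\<dots> \<le> 10 * ((real k)\<^sup>2 * e)" using ee by (intro mult_left_mono) auto
    finally have "\<bar>(real k * a b x)\<^sup>2 + real k * da b b x\<bar> * w x \<le> 10 * ((real k)\<^sup>2 * e) * w x"
      using w0[of x] by (intro mult_right_mono) auto
    then show ?thesis using w0[of x] by (simp add: E_def abs_mult mult_ac)
  qed
  \<comment> \<open>Here r enters: w <= (e/r)^(2 k), and the second factor makes c dominate w and
    the bound for its derivatives at the same time.\<close>
  define c where "c = ((e\<^sup>2 / r\<^sup>2) ^ k) * (1 + 10 * (real k)\<^sup>2 * e)"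
  have wb: "w x \<le> (e\<^sup>2 / r\<^sup>2) ^ k" for x
    unfolding w
  proof (rule power_mono)
    have "r\<^sup>2 \<le> e\<^sup>2" using er by (intro power_mono) auto
    then have "r\<^sup>2 * p e x \<le> e\<^sup>2 * p r x" by (simp add: p_def algebra_simps)
    then show "y x \<le> e\<^sup>2 / r\<^sup>2" using er p[of r x] by (simp add: y_def divide_simps mult_ac)
  qed (use y0[of x] in simp)
  have cb: "w x \<le> c" "10 * (real k)\<^sup>2 * e * w x \<le> c" for x
  proof -
    define R where "R = (e\<^sup>2 / r\<^sup>2) ^ k"
    define h where "h = 10 * (real k)\<^sup>2 * e"
    have R: "0 \<le> R" "w x \<le> R" using wb by (simp_all add: R_def)
    have h: "0 \<le> h" using er by (simp add: h_def)
    have c: "c = R + h * R" by (simp add: c_def R_def h_def algebra_simps)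
    have "h * w x \<le> h * R" "0 \<le> h * R" using R h by (auto intro: mult_left_mono)
    then show "w x \<le> c" "10 * (real k)\<^sup>2 * e * w x \<le> c"
      using R unfolding c h_def[symmetric] by linarith+
  qed
  have "C2_weight w D E c"
    unfolding C2_weight_def
  proof (intro conjI ballI allI)
    have "of_real (w x) = (of_real (p e x) * inverse (of_real (p r x)) :: complex) ^ k" for x
      by (simp add: w y_def divide_inverse)
    moreover have "smooth (\<lambda>x. (of_real (p e x) * inverse (of_real (p r x)) :: complex) ^ k)"
      using p by (intro smooth_power smooth_mult smooth_inverse)
        (auto simp: p_def less_imp_neq[THEN not_sym] simp del: of_real_add intro!: smooth_one_plus_norm)
    ultimately show "smooth (\<lambda>x. of_real (w x))" by simp
    show "\<bar>w x\<bar> \<le> c" for x using cb[of x] w0[of x] by simp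
    fix b :: 'a assume b: "b \<in> Basis"
    show "partial_deriv b (\<lambda>x. of_real (w x)) = (\<lambda>x. of_real (D b x))"
      unfolding D_def by (rule ext) (rule partial_deriv_eqI[OF has_derivative_of_real[OF dw]])
    show "partial_deriv b (\<lambda>x. of_real (D b x)) = (\<lambda>x. of_real (E b x))"
      by (rule ext, subst partial_deriv_eqI[OF has_derivative_of_real[OF dD]])
        (simp add: E_def algebra_simps power2_eq_square)
    show "\<bar>D b x\<bar> \<le> c" "\<bar>E b x\<bar> \<le> c" for x using Db[OF b, of x] Eb[OF b, of x] cb(2)[of x] by auto
  qed
  then show ?thesis using Db Eb by blast
qed

section \<open>The equation of a weighted eigenfunction\<close>

lemma L2_inner_add_left:
  assumes "sq_integrable (lebesgue_on S) f" "sq_integrable (lebesgue_on S) g" "sq_integrable (lebesgue_on S) h"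
  shows "L2_inner S (\<lambda>x. f x + g x) h = L2_inner S f h + L2_inner S g h"
  unfolding L2_inner_def distrib_right
  by (intro Bochner_Integration.integral_add sq_integrable_mult_cnj_integrable assms)

lemma L2_inner_add_right:
  assumes "sq_integrable (lebesgue_on S) f" "sq_integrable (lebesgue_on S) g" "sq_integrable (lebesgue_on S) h"
  shows "L2_inner S h (\<lambda>x. f x + g x) = L2_inner S h f + L2_inner S h g"
  using L2_inner_add_left[OF assms] by (metis (no_types, lifting) L2_inner_cnj complex_cnj_add)

lemma L2_inner_sum_left:
  assumes "\<And>i. i \<in> I \<Longrightarrow> sq_integrable (lebesgue_on S) (f i)" "sq_integrable (lebesgue_on S) h"
  shows "L2_inner S (\<lambda>x. \<Sum>i\<in>I. f i x) h = (\<Sum>i\<in>I. L2_inner S (f i) h)"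
  unfolding L2_inner_def sum_distrib_right
  by (intro Bochner_Integration.integral_sum sq_integrable_mult_cnj_integrable assms)

lemma L2_inner_scale_left: "L2_inner S (\<lambda>x. c * f x) h = c * L2_inner S f h"
  unfolding L2_inner_def by (simp add: mult.assoc)

lemma L2_inner_real_mult_swap: "L2_inner S (\<lambda>x. of_real (\<psi> x) * f x) g = L2_inner S f (\<lambda>x. of_real (\<psi> x) * g x)"
  unfolding L2_inner_def by (intro Bochner_Integration.integral_cong refl) simp

lemma L2_inner_cong_AE:
  assumes "sq_integrable (lebesgue_on S) f" "sq_integrable (lebesgue_on S) g"
    "sq_integrable (lebesgue_on S) f'" "sq_integrable (lebesgue_on S) g'"
    "AE x in lebesgue_on S. f x = f' x" "AE x in lebesgue_on S. g x = g' x"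
  shows "L2_inner S f g = L2_inner S f' g'"
  unfolding L2_inner_def
proof (rule integral_cong_AE)
  show "AE x in lebesgue_on S. f x * cnj (g x) = f' x * cnj (g' x)"
    using assms(5,6) by eventually_elim simp
qed (use assms in \<open>auto intro!: borel_measurable_integrable sq_integrable_mult_cnj_integrable\<close>)

text \<open>F is the commutator of H with w applied to u. In the form, w is moved over to v, where w
  v is admissible in the equation for u. Two cross terms with the gradient of w remain; the one
  containing grad v is integrated by parts, which produces the second derivatives and doubles the
  first-order term.\<close>

lemma weighted_eigenfunction:
  assumes \<Omega>: "open \<Omega>" and u: "u \<in> eigenspace \<Omega> (dirichlet_laplacian \<Omega>) (of_real l)"
    and W: "C2_weight w D E C"
  defines "F \<equiv> \<lambda>x. \<Sum>b\<in>Basis. - (2 * (of_real (D b x) * weak_partial \<Omega> b u x) + of_real (E b x) * u x)"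
  shows "((\<lambda>x. of_real (w x) * u x), (\<lambda>x. of_real l * (of_real (w x) * u x) + F x)) \<in> dirichlet_laplacian \<Omega>"
    and "sq_integrable (lebesgue_on \<Omega>) F"
proof -
  have \<Omega>m: "\<Omega> \<in> sets lebesgue" using \<Omega> by (rule open_in_sets_lebesgue)
  note W = C2_weightD[OF W]
  note uH = eigenspace_iff(1)[OF u]
  note us = H1_0_sq_integrable[OF uH]
  have wm: "w \<in> borel_measurable (lebesgue_on \<Omega>)" by (rule smooth_real_measurable[OF W(1) \<Omega>m])
  have Dm: "D b \<in> borel_measurable (lebesgue_on \<Omega>)" if "b \<in> Basis" for b by (rule smooth_real_measurable[OF W(3)[OF that] \<Omega>m])
  have Em: "E b \<in> borel_measurable (lebesgue_on \<Omega>)" if "b \<in> Basis" for b by (rule smooth_real_measurable[OF W(4)[OF that] \<Omega>m])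
  have ws: "sq_integrable (lebesgue_on \<Omega>) (\<lambda>x. of_real (w x) * f x)" if "sq_integrable (lebesgue_on \<Omega>) f" for f
    by (rule sq_integrable_bounded_mult[OF that, of _ C]) (use wm W(2) in auto)
  have Ds: "sq_integrable (lebesgue_on \<Omega>) (\<lambda>x. of_real (D b x) * f x)"
    if "sq_integrable (lebesgue_on \<Omega>) f" "b \<in> Basis" for f b
    by (rule sq_integrable_bounded_mult[OF that(1), of _ C]) (use Dm W(7) that in auto)
  have Es: "sq_integrable (lebesgue_on \<Omega>) (\<lambda>x. of_real (E b x) * f x)"
    if "sq_integrable (lebesgue_on \<Omega>) f" "b \<in> Basis" for f b
    by (rule sq_integrable_bounded_mult[OF that(1), of _ C]) (use Em W(8) that in auto)
  let ?Fb = "\<lambda>b x. - (2 * (of_real (D b x) * weak_partial \<Omega> b u x) + of_real (E b x) * u x)"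
  have Fb: "sq_integrable (lebesgue_on \<Omega>) (?Fb b)" if b: "b \<in> Basis" for b
    by (intro sq_integrable_minus sq_integrable_add sq_integrable_cmult Ds Es us b)
  show F: "sq_integrable (lebesgue_on \<Omega>) F"
    unfolding F_def by (intro sq_integrable_sum Fb)
  have H: "(\<lambda>x. of_real (w x) * v x) \<in> H1_0 \<Omega>"
    "b \<in> Basis \<Longrightarrow> AE x in lebesgue_on \<Omega>. weak_partial \<Omega> b (\<lambda>x. of_real (w x) * v x) x
       = of_real (w x) * weak_partial \<Omega> b v x + of_real (D b x) * v x" if v: "v \<in> H1_0 \<Omega>" for v b
    using H1_0_mult[OF \<Omega> v W(1), of C] W by auto
  show "((\<lambda>x. of_real (w x) * u x), (\<lambda>x. of_real l * (of_real (w x) * u x) + F x)) \<in> dirichlet_laplacian \<Omega>"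
    unfolding dirichlet_laplacian_def
  proof (intro CollectI case_prodI conjI ballI H uH)
    show "(\<lambda>x. of_real l * (of_real (w x) * u x) + F x) \<in> Lp_space \<Omega> 2"
      unfolding Lp_space_2_iff by (intro sq_integrable_add sq_integrable_cmult ws us F)
    fix v assume v: "v \<in> H1_0 \<Omega>"
    note vs = H1_0_sq_integrable[OF v]
    have trm: "L2_inner \<Omega> (weak_partial \<Omega> b (\<lambda>x. of_real (w x) * u x)) (weak_partial \<Omega> b v)
        = L2_inner \<Omega> (weak_partial \<Omega> b u) (weak_partial \<Omega> b (\<lambda>x. of_real (w x) * v x)) + L2_inner \<Omega> (?Fb b) v"
      if b: "b \<in> Basis" for b
    proof -
      let ?u = "weak_partial \<Omega> b u" and ?v = "weak_partial \<Omega> b v"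
      have "L2_inner \<Omega> (weak_partial \<Omega> b (\<lambda>x. of_real (w x) * u x)) ?v
          = L2_inner \<Omega> (\<lambda>x. of_real (w x) * ?u x + of_real (D b x) * u x) ?v"
        using H(2)[OF uH b] by (intro L2_inner_cong_AE H1_0_sq_integrable(2)[OF H(1)[OF uH] b] vs b
            sq_integrable_add ws Ds us) auto
      also have "\<dots> = L2_inner \<Omega> ?u (\<lambda>x. of_real (w x) * ?v x) + L2_inner \<Omega> (\<lambda>x. of_real (D b x) * u x) ?v"
        by (simp add: L2_inner_add_left ws Ds us vs b L2_inner_real_mult_swap)
      also have "L2_inner \<Omega> (\<lambda>x. of_real (D b x) * u x) ?v
          = - L2_inner \<Omega> (\<lambda>x. of_real (D b x) * ?u x + of_real (E b x) * u x) v"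
      proof (rule weak_integration_by_parts[OF \<Omega> Ds[OF us(1) b] _ _ v b])
        show "sq_integrable (lebesgue_on \<Omega>) (\<lambda>x. of_real (D b x) * ?u x + of_real (E b x) * u x)"
          by (intro sq_integrable_add Ds Es us b)
        show "has_weak_partial \<Omega> b (\<lambda>x. of_real (D b x) * u x) (\<lambda>x. of_real (D b x) * ?u x + of_real (E b x) * u x)"
          using has_weak_partial_mult[OF \<Omega> us(1) us(2)[OF b] us(3)[OF b] W(3)[OF b] b] by (simp add: W(6)[OF b])
      qed
      also have "L2_inner \<Omega> (\<lambda>x. of_real (D b x) * ?u x + of_real (E b x) * u x) v
          = L2_inner \<Omega> (\<lambda>x. of_real (D b x) * ?u x) v + L2_inner \<Omega> (\<lambda>x. of_real (E b x) * u x) v"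
        by (simp add: L2_inner_add_left Ds Es us vs b)
      finally have 1: "L2_inner \<Omega> (weak_partial \<Omega> b (\<lambda>x. of_real (w x) * u x)) ?v
         = L2_inner \<Omega> ?u (\<lambda>x. of_real (w x) * ?v x)
           - (L2_inner \<Omega> (\<lambda>x. of_real (D b x) * ?u x) v + L2_inner \<Omega> (\<lambda>x. of_real (E b x) * u x) v)" by simp
      have "L2_inner \<Omega> ?u (weak_partial \<Omega> b (\<lambda>x. of_real (w x) * v x))
          = L2_inner \<Omega> ?u (\<lambda>x. of_real (w x) * ?v x + of_real (D b x) * v x)"
        using H(2)[OF v b] by (intro L2_inner_cong_AE H1_0_sq_integrable(2)[OF H(1)[OF v] b] us b
            sq_integrable_add ws Ds vs) auto
      also have "\<dots> = L2_inner \<Omega> ?u (\<lambda>x. of_real (w x) * ?v x) + L2_inner \<Omega> (\<lambda>x. of_real (D b x) * ?u x) v"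
        by (simp add: L2_inner_add_right ws Ds us vs b L2_inner_real_mult_swap)
      finally have 2: "L2_inner \<Omega> ?u (weak_partial \<Omega> b (\<lambda>x. of_real (w x) * v x))
         = L2_inner \<Omega> ?u (\<lambda>x. of_real (w x) * ?v x) + L2_inner \<Omega> (\<lambda>x. of_real (D b x) * ?u x) v" .
      have "L2_inner \<Omega> (?Fb b) v = L2_inner \<Omega> (\<lambda>x. (-2) * (of_real (D b x) * ?u x) + (-1) * (of_real (E b x) * u x)) v"
        by simp
      also have "\<dots> = (-2) * L2_inner \<Omega> (\<lambda>x. of_real (D b x) * ?u x) v + (-1) * L2_inner \<Omega> (\<lambda>x. of_real (E b x) * u x) v"
        by (subst L2_inner_add_left) (auto simp only: L2_inner_scale_left intro!: sq_integrable_cmult Ds Es us vs b)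
      finally show ?thesis unfolding 1 2 by simp
    qed
    have "dirichlet_form \<Omega> (\<lambda>x. of_real (w x) * u x) v
       = (\<Sum>b\<in>Basis. L2_inner \<Omega> (weak_partial \<Omega> b u) (weak_partial \<Omega> b (\<lambda>x. of_real (w x) * v x)) + L2_inner \<Omega> (?Fb b) v)"
      unfolding dirichlet_form_eq[OF H(1)[OF uH] v] by (intro sum.cong refl trm)
    also have "\<dots> = dirichlet_form \<Omega> u (\<lambda>x. of_real (w x) * v x) + L2_inner \<Omega> F v"
      unfolding sum.distrib dirichlet_form_eq[OF uH H(1)[OF v]] F_def by (subst L2_inner_sum_left[OF Fb vs(1)]) auto
    also have "dirichlet_form \<Omega> u (\<lambda>x. of_real (w x) * v x) = of_real l * L2_inner \<Omega> (\<lambda>x. of_real (w x) * u x) v"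
      unfolding eigenspace_iff(2)[OF u H(1)[OF v]] L2_inner_real_mult_swap ..
    also have "\<dots> + L2_inner \<Omega> F v = L2_inner \<Omega> (\<lambda>x. of_real l * (of_real (w x) * u x) + F x) v"
      by (subst L2_inner_add_left) (auto simp only: L2_inner_scale_left intro!: sq_integrable_cmult ws us vs F)
    finally show "dirichlet_form \<Omega> (\<lambda>x. of_real (w x) * u x) v
        = L2_inner \<Omega> (\<lambda>x. of_real l * (of_real (w x) * u x) + F x) v" .
  qed
qed

text \<open>Caccioppoli's inequality is the energy identity with the weight w^2; it bounds the
  weighted gradient by (2 l + 4 d) N. Pointwise |F|^2 is at most d times the sum of 8 \<eta>^2 w^2
  |grad u|^2 and of 2 \<eta>^2 w^2 |u|^2 over the d directions. Together 8 (2 l + 4 d) + 2 d = 16 l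
  + 34 d.\<close>

lemma weighted_eigenfunction_bound:
  fixes \<Omega> :: "'a::euclidean_space set" and l :: real
  assumes \<Omega>: "open \<Omega>" and u: "u \<in> eigenspace \<Omega> (dirichlet_laplacian \<Omega>) (of_real l)" and l: "0 \<le> l"
    and W: "C2_weight w D E C" and w0: "\<And>x. 0 \<le> w x" and \<eta>: "0 \<le> \<eta>" "\<eta> \<le> 1"
    and DE: "\<And>b x. b \<in> Basis \<Longrightarrow> \<bar>D b x\<bar> \<le> \<eta> * w x" "\<And>b x. b \<in> Basis \<Longrightarrow> \<bar>E b x\<bar> \<le> \<eta> * w x"
  defines "F \<equiv> \<lambda>x. \<Sum>b\<in>Basis. - (2 * (of_real (D b x) * weak_partial \<Omega> b u x) + of_real (E b x) * u x)"
  shows "L2_norm \<Omega> F \<le> \<eta> * sqrt (real DIM('a) * (16 * l + 34 * real DIM('a))) * L2_norm \<Omega> (\<lambda>x. of_real (w x) * u x)"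
proof -
  have \<Omega>m: "\<Omega> \<in> sets lebesgue" using \<Omega> by (rule open_in_sets_lebesgue)
  note Wd = C2_weightD[OF W]
  note uH = eigenspace_iff(1)[OF u]
  note us = H1_0_sq_integrable[OF uH]
  let ?M = "lebesgue_on \<Omega>"
  let ?d = "real DIM('a)"
  have wm: "w \<in> borel_measurable ?M" by (rule smooth_real_measurable[OF Wd(1) \<Omega>m])
  have wf: "sq_integrable ?M (\<lambda>x. of_real (w x) * f x)" if "sq_integrable ?M f" for f
    by (rule sq_integrable_bounded_mult[OF that, of _ C]) (use wm Wd(2) in auto)
  have ig: "integrable ?M (\<lambda>x. (w x)\<^sup>2 * (norm (f x))\<^sup>2)" if "sq_integrable ?M f" for f
    using wf[OF that] by (simp add: sq_integrable_def norm_mult power_mult_distrib)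
  define N where "N = (LINT x|?M. (w x)\<^sup>2 * (norm (u x))\<^sup>2)"
  define G where "G b = (LINT x|?M. (w x)\<^sup>2 * (norm (weak_partial \<Omega> b u x))\<^sup>2)" for b
  have N0: "0 \<le> N" unfolding N_def by (rule Bochner_Integration.integral_nonneg) simp
  have \<eta>2: "\<eta>\<^sup>2 \<le> 1" using \<eta> by (simp add: power_le_one)
  have C: "0 \<le> C" using Wd(2)[of undefined] by linarith
  have gradient: "(\<Sum>b\<in>Basis. G b) \<le> (2 * l + 4 * ?d) * N"
  proof -
    let ?D = "\<lambda>b x. 2 * w x * D b x"
    have sm: "smooth (\<lambda>x. of_real ((w x)\<^sup>2))"
      using smooth_mult[OF Wd(1) Wd(1)] by (simp add: power2_eq_square)
    have pd: "partial_deriv b (\<lambda>x. of_real ((w x)\<^sup>2)) = (\<lambda>x. of_real (?D b x))" if b: "b \<in> Basis" for b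
      using partial_deriv_mult[OF smooth_differentiable[OF Wd(1)] smooth_differentiable[OF Wd(1)], of b]
      by (simp add: power2_eq_square Wd(5)[OF b] algebra_simps)
    have b1: "\<bar>(w x)\<^sup>2\<bar> \<le> 2 * (C * C)" for x
    proof -
      have "\<bar>w x\<bar> * \<bar>w x\<bar> \<le> C * C" using Wd(2)[of x] C by (intro mult_mono) auto
      moreover have "0 \<le> C * C" using C by simp
      ultimately show ?thesis unfolding power2_eq_square abs_mult by linarith
    qed
    have b2: "\<bar>?D b x\<bar> \<le> 2 * (C * C)" if b: "b \<in> Basis" for b x
      using mult_mono[OF Wd(2) Wd(7)[OF b], of x x] C by (simp add: abs_mult)
    have "l * N = (\<Sum>b\<in>Basis. G b + Re (L2_inner \<Omega> (\<lambda>x. of_real (?D b x) * weak_partial \<Omega> b u x) u))"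
      unfolding N_def G_def by (rule weighted_energy_identity[OF \<Omega> u sm pd b1 b2])
    \<comment> \<open>The cross term is split so that half of the gradient can be absorbed on the
      left.\<close>
    moreover have "- (1/2 * G b + 2 * N) \<le> Re (L2_inner \<Omega> (\<lambda>x. of_real (?D b x) * weak_partial \<Omega> b u x) u)"
      if b: "b \<in> Basis" for b
    proof -
      let ?u = "weak_partial \<Omega> b u"
      have "\<bar>Re (L2_inner \<Omega> (\<lambda>x. of_real (?D b x) * ?u x) u)\<bar> \<le> norm (L2_inner \<Omega> (\<lambda>x. of_real (?D b x) * ?u x) u)"
        by (rule abs_Re_le_cmod)
      also have "\<dots> \<le> (LINT x|?M. norm (of_real (?D b x) * ?u x * cnj (u x)))"
        unfolding L2_inner_def by (rule integral_norm_bound)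
      also have "\<dots> \<le> (LINT x|?M. 1/2 * ((w x)\<^sup>2 * (norm (?u x))\<^sup>2) + 2 * ((w x)\<^sup>2 * (norm (u x))\<^sup>2))"
      proof (rule integral_mono')
        show "integrable ?M (\<lambda>x. 1/2 * ((w x)\<^sup>2 * (norm (?u x))\<^sup>2) + 2 * ((w x)\<^sup>2 * (norm (u x))\<^sup>2))"
          using ig[OF us(1)] ig[OF us(2)[OF b]] by simp
        fix x
        have "norm (of_real (?D b x) * ?u x * cnj (u x)) = 2 * w x * \<bar>D b x\<bar> * norm (?u x) * norm (u x)"
          using w0[of x] by (simp add: norm_mult abs_mult)
        also have "\<dots> \<le> 2 * w x * (1 * w x) * norm (?u x) * norm (u x)"
          using DE(1)[OF b, of x] mult_right_mono[OF \<eta>(2) w0[of x]] w0[of x]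
          by (intro mult_right_mono mult_left_mono) auto
        \<comment> \<open>The factors 1/sqrt 2 and sqrt 2 give the coefficients 1/2 and 2 in the
          inequality of the means.\<close>
        also have "\<dots> = 2 * (w x * norm (?u x) / sqrt 2) * (sqrt 2 * (w x * norm (u x)))" by simp
        also have "\<dots> \<le> (w x * norm (?u x) / sqrt 2)\<^sup>2 + (sqrt 2 * (w x * norm (u x)))\<^sup>2"
          by (rule sum_squares_bound)
        also have "\<dots> = 1/2 * ((w x)\<^sup>2 * (norm (?u x))\<^sup>2) + 2 * ((w x)\<^sup>2 * (norm (u x))\<^sup>2)"
          by (simp add: power_mult_distrib power_divide)
        finally show "norm (of_real (?D b x) * ?u x * cnj (u x)) \<le> 1/2 * ((w x)\<^sup>2 * (norm (?u x))\<^sup>2) + 2 * ((w x)\<^sup>2 * (norm (u x))\<^sup>2)" .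
      qed simp
      also have "\<dots> = 1/2 * G b + 2 * N"
        unfolding G_def N_def using ig[OF us(1)] ig[OF us(2)[OF b]] by simp
      finally show ?thesis by simp
    qed
    ultimately have "l * N \<ge> (\<Sum>b\<in>Basis. G b + - (1/2 * G b + 2 * N))"
      by (simp only:) (intro sum_mono add_left_mono)
    also have "(\<Sum>b\<in>Basis. G b + - (1/2 * G b + 2 * N)) = (\<Sum>b\<in>Basis. 1/2 * G b) - (\<Sum>b\<in>(Basis::'a set). 2 * N)"
      unfolding sum_subtractf[symmetric] by (rule sum.cong) auto
    also have "\<dots> = 1/2 * (\<Sum>b\<in>Basis. G b) - 2 * ?d * N"
      by (simp add: sum_distrib_left)
    finally show ?thesis by (simp add: algebra_simps)
  qed
  have "(LINT x|?M. (norm (F x))\<^sup>2) \<le> (LINT x|?M. ?d * (\<Sum>b\<in>Basis. 8 * \<eta>\<^sup>2 * ((w x)\<^sup>2 * (norm (weak_partial \<Omega> b u x))\<^sup>2) + 2 * \<eta>\<^sup>2 * ((w x)\<^sup>2 * (norm (u x))\<^sup>2)))"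
  proof (rule integral_mono')
    show "integrable ?M (\<lambda>x. ?d * (\<Sum>b\<in>Basis. 8 * \<eta>\<^sup>2 * ((w x)\<^sup>2 * (norm (weak_partial \<Omega> b u x))\<^sup>2) + 2 * \<eta>\<^sup>2 * ((w x)\<^sup>2 * (norm (u x))\<^sup>2)))"
      using ig[OF us(1)] ig[OF us(2)] by (intro Bochner_Integration.integrable_mult_right Bochner_Integration.integrable_sum Bochner_Integration.integrable_add) auto
    fix x
    let ?f = "\<lambda>b. 2 * (\<bar>D b x\<bar> * norm (weak_partial \<Omega> b u x)) + \<bar>E b x\<bar> * norm (u x)"
    have "norm (F x) \<le> (\<Sum>b\<in>Basis. ?f b)"
      unfolding F_def
    proof (rule sum_norm_le)
      fix b :: 'a
      show "norm (- (2 * (of_real (D b x) * weak_partial \<Omega> b u x) + of_real (E b x) * u x)) \<le> ?f b"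
        unfolding norm_minus_cancel by (rule order_trans[OF norm_triangle_ineq]) (simp add: norm_mult)
    qed
    then have "(norm (F x))\<^sup>2 \<le> (\<Sum>b\<in>Basis. 1 * ?f b)\<^sup>2" by (intro power_mono) auto
    \<comment> \<open>Cauchy-Schwarz over the d directions produces the outer factor d.\<close>
    also have "\<dots> \<le> (\<Sum>b\<in>(Basis::'a set). 1\<^sup>2) * (\<Sum>b\<in>Basis. (?f b)\<^sup>2)" by (rule Cauchy_Schwarz_ineq_sum)
    also have "\<dots> = ?d * (\<Sum>b\<in>Basis. (?f b)\<^sup>2)" by simp
    also have "\<dots> \<le> ?d * (\<Sum>b\<in>Basis. 8 * \<eta>\<^sup>2 * ((w x)\<^sup>2 * (norm (weak_partial \<Omega> b u x))\<^sup>2) + 2 * \<eta>\<^sup>2 * ((w x)\<^sup>2 * (norm (u x))\<^sup>2))"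
    proof (intro mult_left_mono sum_mono)
      fix b :: 'a assume b: "b \<in> Basis"
      let ?A = "\<eta> * w x * norm (weak_partial \<Omega> b u x)" and ?B = "\<eta> * w x * norm (u x)"
      have "?f b \<le> 2 * ?A + ?B"
        using mult_right_mono[OF DE(1)[OF b, of x], of "norm (weak_partial \<Omega> b u x)"]
          mult_right_mono[OF DE(2)[OF b, of x], of "norm (u x)"] by simp
      then have "(?f b)\<^sup>2 \<le> (2 * ?A + ?B)\<^sup>2" by (intro power_mono) auto
      also have "\<dots> \<le> 2 * (2 * ?A)\<^sup>2 + 2 * ?B\<^sup>2"
        using sum_squares_bound[of "2 * ?A" ?B] by (simp add: power2_sum)
      also have "\<dots> = 8 * \<eta>\<^sup>2 * ((w x)\<^sup>2 * (norm (weak_partial \<Omega> b u x))\<^sup>2) + 2 * \<eta>\<^sup>2 * ((w x)\<^sup>2 * (norm (u x))\<^sup>2)"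
        by (simp add: power_mult_distrib)
      finally show "(?f b)\<^sup>2 \<le> 8 * \<eta>\<^sup>2 * ((w x)\<^sup>2 * (norm (weak_partial \<Omega> b u x))\<^sup>2) + 2 * \<eta>\<^sup>2 * ((w x)\<^sup>2 * (norm (u x))\<^sup>2)" .
    qed simp
    finally show "(norm (F x))\<^sup>2 \<le> ?d * (\<Sum>b\<in>Basis. 8 * \<eta>\<^sup>2 * ((w x)\<^sup>2 * (norm (weak_partial \<Omega> b u x))\<^sup>2) + 2 * \<eta>\<^sup>2 * ((w x)\<^sup>2 * (norm (u x))\<^sup>2))" .
  qed (intro mult_nonneg_nonneg sum_nonneg add_nonneg_nonneg, auto)
  also have "\<dots> = ?d * (\<Sum>b\<in>Basis. 8 * \<eta>\<^sup>2 * G b + 2 * \<eta>\<^sup>2 * N)"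
    unfolding G_def N_def using ig[OF us(1)] ig[OF us(2)]
    by (simp add: Bochner_Integration.integral_sum)
  also have "\<dots> = ?d * \<eta>\<^sup>2 * (8 * (\<Sum>b\<in>Basis. G b) + 2 * ?d * N)"
    unfolding sum.distrib sum_distrib_left[symmetric] by (simp add: algebra_simps)
  also have "\<dots> \<le> ?d * \<eta>\<^sup>2 * (8 * ((2 * l + 4 * ?d) * N) + 2 * ?d * N)"
    using gradient by (intro mult_left_mono add_right_mono) auto
  also have "\<dots> = \<eta>\<^sup>2 * (?d * (16 * l + 34 * ?d)) * N" by (simp add: algebra_simps)
  finally have "L2_norm \<Omega> F \<le> sqrt (\<eta>\<^sup>2 * (?d * (16 * l + 34 * ?d)) * N)"
    unfolding L2_norm_def by (rule real_sqrt_le_mono)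
  also have "\<dots> = \<eta> * sqrt (?d * (16 * l + 34 * ?d)) * sqrt N"
    using \<eta>(1) by (simp only: real_sqrt_mult real_sqrt_abs abs_of_nonneg)
  also have "sqrt N = L2_norm \<Omega> (\<lambda>x. of_real (w x) * u x)"
    unfolding N_def L2_norm_def by (simp add: norm_mult power_mult_distrib)
  finally show ?thesis .
qed

section \<open>The spectral gap of the Dirichlet Laplacian\<close>

lemma test_functions_add:
  assumes "\<phi> \<in> test_functions \<Omega>" "\<psi> \<in> test_functions \<Omega>"
  shows "(\<lambda>x. \<phi> x + \<psi> x) \<in> test_functions \<Omega>"
proof -
  let ?S = "\<lambda>f. closure {x. f x \<noteq> 0}"
  have "?S (\<lambda>x. \<phi> x + \<psi> x) \<subseteq> closure ({x. \<phi> x \<noteq> 0} \<union> {x. \<psi> x \<noteq> 0})"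
    by (intro closure_mono) auto
  then have sub: "?S (\<lambda>x. \<phi> x + \<psi> x) \<subseteq> ?S \<phi> \<union> ?S \<psi>" by (simp only: closure_Un)
  have K: "compact (?S \<phi> \<union> ?S \<psi>)" "?S \<phi> \<union> ?S \<psi> \<subseteq> \<Omega>"
    using assms by (auto simp: test_functions_def intro: compact_Un)
  have "compact (?S (\<lambda>x. \<phi> x + \<psi> x))"
    using compact_Int_closed[OF K(1) closed_closure[of "{x. \<phi> x + \<psi> x \<noteq> 0}"]] sub
    by (simp only: Int_absorb1)
  then show ?thesis using sub K(2) smooth_add[OF test_functions_smooth[OF assms(1)] test_functions_smooth[OF assms(2)]]
    unfolding test_functions_def smooth_def by blast
qed

lemma H1_0_add:
  assumes \<Omega>: "open \<Omega>" and u: "u \<in> H1_0 \<Omega>" and v: "v \<in> H1_0 \<Omega>"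
  shows "(\<lambda>x. u x + v x) \<in> H1_0 \<Omega>"
    and "b \<in> Basis \<Longrightarrow> AE x in lebesgue_on \<Omega>.
      weak_partial \<Omega> b (\<lambda>x. u x + v x) x = weak_partial \<Omega> b u x + weak_partial \<Omega> b v x"
proof -
  have \<Omega>m: "\<Omega> \<in> sets lebesgue" using \<Omega> by (rule open_in_sets_lebesgue)
  note us = H1_0_sq_integrable[OF u] and vs = H1_0_sq_integrable[OF v]
  let ?D = "\<lambda>b x. weak_partial \<Omega> b u x + weak_partial \<Omega> b v x"
  have sqD: "sq_integrable (lebesgue_on \<Omega>) (?D b)" if "b \<in> Basis" for b
    by (intro sq_integrable_add us vs that)
  have wD: "has_weak_partial \<Omega> b (\<lambda>x. u x + v x) (?D b)" if b: "b \<in> Basis" for b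
    unfolding has_weak_partial_def
  proof
    fix \<phi> assume \<phi>: "\<phi> \<in> test_functions \<Omega>"
    note \<phi>s = test_functions_sq_integrable[OF \<phi> \<Omega>m]
    note i = sq_integrable_mult_integrable[OF us(1) \<phi>s(2)[OF b]] sq_integrable_mult_integrable[OF vs(1) \<phi>s(2)[OF b]]
      sq_integrable_mult_integrable[OF us(2)[OF b] \<phi>s(1)] sq_integrable_mult_integrable[OF vs(2)[OF b] \<phi>s(1)]
    show "(LINT x|lebesgue_on \<Omega>. (u x + v x) * partial_deriv b \<phi> x) = - (LINT x|lebesgue_on \<Omega>. ?D b x * \<phi> x)"
      using us(3)[OF b] vs(3)[OF b] \<phi> i unfolding has_weak_partial_def distrib_right by simp
  qed
  have AE: "AE x in lebesgue_on \<Omega>. weak_partial \<Omega> b (\<lambda>x. u x + v x) x = ?D b x" if "b \<in> Basis" for b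
    by (rule weak_partial_AE_eq[OF \<Omega> sqD[OF that] wD[OF that]])
  then show "b \<in> Basis \<Longrightarrow> AE x in lebesgue_on \<Omega>. weak_partial \<Omega> b (\<lambda>x. u x + v x) x = ?D b x" .
  have H1: "(\<lambda>x. u x + v x) \<in> H1 \<Omega>"
    unfolding H1_def
  proof (intro CollectI conjI ballI)
    show "\<exists>g\<in>Lp_space \<Omega> 2. has_weak_partial \<Omega> b (\<lambda>x. u x + v x) g" if "b \<in> Basis" for b
      using sqD[OF that] wD[OF that] by (intro bexI[of _ "?D b"]) (simp_all add: Lp_space_2_iff)
  qed (simp add: Lp_space_2_iff sq_integrable_add us vs)
  obtain \<phi> where \<phi>: "\<And>n. \<phi> n \<in> test_functions \<Omega>"
    "(\<lambda>n. L2_norm \<Omega> (\<lambda>x. \<phi> n x - u x)) \<longlonglongrightarrow> 0"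
    "\<And>b. b \<in> Basis \<Longrightarrow> (\<lambda>n. L2_norm \<Omega> (\<lambda>x. partial_deriv b (\<phi> n) x - weak_partial \<Omega> b u x)) \<longlonglongrightarrow> 0"
    using u unfolding H1_0_def by blast
  obtain \<psi> where \<psi>: "\<And>n. \<psi> n \<in> test_functions \<Omega>"
    "(\<lambda>n. L2_norm \<Omega> (\<lambda>x. \<psi> n x - v x)) \<longlonglongrightarrow> 0"
    "\<And>b. b \<in> Basis \<Longrightarrow> (\<lambda>n. L2_norm \<Omega> (\<lambda>x. partial_deriv b (\<psi> n) x - weak_partial \<Omega> b v x)) \<longlonglongrightarrow> 0"
    using v unfolding H1_0_def by blast
  note \<phi>s = test_functions_sq_integrable[OF \<phi>(1) \<Omega>m] and \<psi>s = test_functions_sq_integrable[OF \<psi>(1) \<Omega>m]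
  have lim: "(\<lambda>n. L2_norm \<Omega> (h n)) \<longlonglongrightarrow> 0"
    if f: "(\<lambda>n. L2_norm \<Omega> (\<lambda>x. f n x)) \<longlonglongrightarrow> 0" and g: "(\<lambda>n. L2_norm \<Omega> (\<lambda>x. g n x)) \<longlonglongrightarrow> 0"
      and sq: "\<And>n. sq_integrable (lebesgue_on \<Omega>) (f n)" "\<And>n. sq_integrable (lebesgue_on \<Omega>) (g n)"
      and h: "\<And>n. h n \<in> borel_measurable (lebesgue_on \<Omega>)" "\<And>n. AE x in lebesgue_on \<Omega>. h n x = f n x + g n x"
    for f g h :: "nat \<Rightarrow> 'a \<Rightarrow> complex"
  proof (rule Lim_null_comparison)
    show "(\<lambda>n. L2_norm \<Omega> (f n) + L2_norm \<Omega> (g n)) \<longlonglongrightarrow> 0"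
      using tendsto_add[OF f g] by simp
    have "L2_norm \<Omega> (h n) = L2_norm \<Omega> (\<lambda>x. f n x + g n x)" for n
      by (rule L2_norm_cong_AE[OF h(1) _ h(2)]) (intro sq_integrable_measurable sq_integrable_add sq)
    then show "\<forall>\<^sub>F n in sequentially. norm (L2_norm \<Omega> (h n)) \<le> L2_norm \<Omega> (f n) + L2_norm \<Omega> (g n)"
      using L2_norm_triangle[OF \<Omega>m sq(1) sq(2)] by simp
  qed
  show "(\<lambda>x. u x + v x) \<in> H1_0 \<Omega>"
    unfolding H1_0_def
  proof (intro CollectI conjI H1 exI[of _ "\<lambda>n x. \<phi> n x + \<psi> n x"] allI ballI)
    show "(\<lambda>x. \<phi> n x + \<psi> n x) \<in> test_functions \<Omega>" for n by (rule test_functions_add[OF \<phi>(1) \<psi>(1)])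
    show "(\<lambda>n. L2_norm \<Omega> (\<lambda>x. \<phi> n x + \<psi> n x - (u x + v x))) \<longlonglongrightarrow> 0"
    proof (rule lim[OF \<phi>(2) \<psi>(2)])
      show "(\<lambda>x. \<phi> n x + \<psi> n x - (u x + v x)) \<in> borel_measurable (lebesgue_on \<Omega>)" for n
        by (intro sq_integrable_measurable sq_integrable_diff sq_integrable_add \<phi>s \<psi>s us vs)
    qed (auto intro!: sq_integrable_diff \<phi>s \<psi>s us vs)
    fix b :: 'a assume b: "b \<in> Basis"
    have pd: "partial_deriv b (\<lambda>x. \<phi> n x + \<psi> n x) = (\<lambda>x. partial_deriv b (\<phi> n) x + partial_deriv b (\<psi> n) x)" for n
      by (intro partial_deriv_add smooth_differentiable test_functions_smooth[OF \<phi>(1)] test_functions_smooth[OF \<psi>(1)])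
    show "(\<lambda>n. L2_norm \<Omega> (\<lambda>x. partial_deriv b (\<lambda>x. \<phi> n x + \<psi> n x) x - weak_partial \<Omega> b (\<lambda>x. u x + v x) x)) \<longlonglongrightarrow> 0"
      unfolding pd
    proof (rule lim[OF \<phi>(3)[OF b] \<psi>(3)[OF b]])
      show "(\<lambda>x. partial_deriv b (\<phi> n) x + partial_deriv b (\<psi> n) x - weak_partial \<Omega> b (\<lambda>x. u x + v x) x)
          \<in> borel_measurable (lebesgue_on \<Omega>)" for n
        by (intro sq_integrable_measurable sq_integrable_diff sq_integrable_add \<phi>s \<psi>s b H1_weak_partial(1)[OF H1])
      show "AE x in lebesgue_on \<Omega>. partial_deriv b (\<phi> n) x + partial_deriv b (\<psi> n) x - weak_partial \<Omega> b (\<lambda>x. u x + v x) x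
        = partial_deriv b (\<phi> n) x - weak_partial \<Omega> b u x + (partial_deriv b (\<psi> n) x - weak_partial \<Omega> b v x)" for n
        using AE[OF b] by eventually_elim simp
    qed (intro sq_integrable_diff \<phi>s \<psi>s us vs b)+
  qed
qed

lemma H1_0_cmult:
  assumes \<Omega>: "open \<Omega>" and u: "u \<in> H1_0 \<Omega>"
  shows "(\<lambda>x. c * u x) \<in> H1_0 \<Omega>"
    and "b \<in> Basis \<Longrightarrow> AE x in lebesgue_on \<Omega>. weak_partial \<Omega> b (\<lambda>x. c * u x) x = c * weak_partial \<Omega> b u x"
  using H1_0_mult[OF \<Omega> u smooth_const[of c], of "norm c"] by (simp_all add: partial_deriv_const)

lemma dirichlet_laplacian_add:
  assumes \<Omega>: "open \<Omega>" and uf: "(u, f) \<in> dirichlet_laplacian \<Omega>" and vg: "(v, g) \<in> dirichlet_laplacian \<Omega>"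
  shows "((\<lambda>x. u x + v x), (\<lambda>x. f x + g x)) \<in> dirichlet_laplacian \<Omega>"
proof -
  have H: "u \<in> H1_0 \<Omega>" "v \<in> H1_0 \<Omega>" and s: "sq_integrable (lebesgue_on \<Omega>) f" "sq_integrable (lebesgue_on \<Omega>) g"
    and eq: "\<And>w. w \<in> H1_0 \<Omega> \<Longrightarrow> dirichlet_form \<Omega> u w = L2_inner \<Omega> f w"
      "\<And>w. w \<in> H1_0 \<Omega> \<Longrightarrow> dirichlet_form \<Omega> v w = L2_inner \<Omega> g w"
    using uf vg by (auto simp: dirichlet_laplacian_def Lp_space_2_iff)
  note us = H1_0_sq_integrable[OF H(1)] and vs = H1_0_sq_integrable[OF H(2)]
  have "dirichlet_form \<Omega> (\<lambda>x. u x + v x) w = L2_inner \<Omega> (\<lambda>x. f x + g x) w" if w: "w \<in> H1_0 \<Omega>" for w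
  proof -
    note ws = H1_0_sq_integrable[OF w]
    have "L2_inner \<Omega> (weak_partial \<Omega> b (\<lambda>x. u x + v x)) (weak_partial \<Omega> b w)
       = L2_inner \<Omega> (weak_partial \<Omega> b u) (weak_partial \<Omega> b w) + L2_inner \<Omega> (weak_partial \<Omega> b v) (weak_partial \<Omega> b w)"
      if b: "b \<in> Basis" for b
      using L2_inner_cong_AE[OF H1_0_sq_integrable(2)[OF H1_0_add(1)[OF \<Omega> H] b] ws(2)[OF b]
          sq_integrable_add[OF us(2)[OF b] vs(2)[OF b]] ws(2)[OF b] H1_0_add(2)[OF \<Omega> H b]]
      by (simp add: L2_inner_add_left us vs ws b)
    then have "dirichlet_form \<Omega> (\<lambda>x. u x + v x) w = dirichlet_form \<Omega> u w + dirichlet_form \<Omega> v w"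
      using H w H1_0_add(1)[OF \<Omega> H] by (simp add: dirichlet_form_eq sum.distrib)
    then show ?thesis using w by (simp add: eq L2_inner_add_left s ws)
  qed
  then show ?thesis using H1_0_add(1)[OF \<Omega> H] s
    by (simp add: dirichlet_laplacian_def Lp_space_2_iff sq_integrable_add)
qed

lemma dirichlet_laplacian_cmult:
  assumes \<Omega>: "open \<Omega>" and uf: "(u, f) \<in> dirichlet_laplacian \<Omega>"
  shows "((\<lambda>x. c * u x), (\<lambda>x. c * f x)) \<in> dirichlet_laplacian \<Omega>"
proof -
  have H: "u \<in> H1_0 \<Omega>" and s: "sq_integrable (lebesgue_on \<Omega>) f"
    and eq: "\<And>w. w \<in> H1_0 \<Omega> \<Longrightarrow> dirichlet_form \<Omega> u w = L2_inner \<Omega> f w"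
    using uf by (auto simp: dirichlet_laplacian_def Lp_space_2_iff)
  note us = H1_0_sq_integrable[OF H]
  have "dirichlet_form \<Omega> (\<lambda>x. c * u x) w = L2_inner \<Omega> (\<lambda>x. c * f x) w" if w: "w \<in> H1_0 \<Omega>" for w
  proof -
    note ws = H1_0_sq_integrable[OF w]
    have "L2_inner \<Omega> (weak_partial \<Omega> b (\<lambda>x. c * u x)) (weak_partial \<Omega> b w)
       = c * L2_inner \<Omega> (weak_partial \<Omega> b u) (weak_partial \<Omega> b w)" if b: "b \<in> Basis" for b
      using L2_inner_cong_AE[OF H1_0_sq_integrable(2)[OF H1_0_cmult(1)[OF \<Omega> H] b] ws(2)[OF b]
          sq_integrable_cmult[OF us(2)[OF b]] ws(2)[OF b] H1_0_cmult(2)[OF \<Omega> H b]]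
      by (simp add: L2_inner_scale_left)
    then have "dirichlet_form \<Omega> (\<lambda>x. c * u x) w = c * dirichlet_form \<Omega> u w"
      using H w H1_0_cmult(1)[OF \<Omega> H] by (simp add: dirichlet_form_eq sum_distrib_left)
    then show ?thesis using w by (simp add: eq L2_inner_scale_left)
  qed
  then show ?thesis using H1_0_cmult(1)[OF \<Omega> H] s
    by (simp add: dirichlet_laplacian_def Lp_space_2_iff sq_integrable_cmult)
qed

lemma dirichlet_laplacian_symmetric:
  assumes "(u, f) \<in> dirichlet_laplacian \<Omega>" "(v, g) \<in> dirichlet_laplacian \<Omega>"
  shows "L2_inner \<Omega> f v = L2_inner \<Omega> u g"
proof -
  have "L2_inner \<Omega> f v = dirichlet_form \<Omega> u v" "dirichlet_form \<Omega> v u = L2_inner \<Omega> g u"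
    and H: "u \<in> H1_0 \<Omega>" "v \<in> H1_0 \<Omega>"
    using assms by (auto simp: dirichlet_laplacian_def)
  then show ?thesis using dirichlet_form_cnj[OF H] L2_inner_cnj[of \<Omega> u g] by (metis complex_cnj_cnj)
qed

lemma dirichlet_laplacian_sq_integrable:
  assumes "(u, f) \<in> dirichlet_laplacian \<Omega>"
  shows "sq_integrable (lebesgue_on \<Omega>) u" "sq_integrable (lebesgue_on \<Omega>) f"
  using assms H1_0_sq_integrable(1) by (auto simp: dirichlet_laplacian_def Lp_space_2_iff)

section \<open>Multiplication operators on L_2\<close>

definition bounded_multiplier :: "('a::euclidean_space \<Rightarrow> real) \<Rightarrow> bool" where
  "bounded_multiplier \<psi> \<longleftrightarrow> \<psi> \<in> borel_measurable lebesgue \<and> bounded (range \<psi>)"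

lemma bounded_multiplierI:
  "\<psi> \<in> borel_measurable lebesgue \<Longrightarrow> (\<And>x. \<bar>\<psi> x\<bar> \<le> C) \<Longrightarrow> bounded_multiplier \<psi>"
  by (auto simp: bounded_multiplier_def bounded_iff)

lemma bounded_multiplier_sq_integrable:
  assumes "bounded_multiplier \<psi>" "sq_integrable lebesgue f"
  shows "sq_integrable lebesgue (\<lambda>x. of_real (\<psi> x) * f x)"
proof -
  obtain C where "\<And>x. \<bar>\<psi> x\<bar> \<le> C" using assms(1) by (auto simp: bounded_multiplier_def bounded_iff)
  then show ?thesis
    using assms by (intro sq_integrable_bounded_mult[where C = C]) (auto simp: bounded_multiplier_def)
qed

lemma mult_l2_linear:
  assumes "bounded_multiplier \<psi>"
  shows "mult_l2 \<psi> (x + y) = mult_l2 \<psi> x + mult_l2 \<psi> y" "mult_l2 \<psi> (r *\<^sub>R x) = r *\<^sub>R mult_l2 \<psi> x"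
proof -
  obtain f g where fg: "sq_integrable lebesgue f" "x = abs_l2 f" "sq_integrable lebesgue g" "y = abs_l2 g"
    by (meson abs_l2_cases)
  note m = mult_l2_abs[of _ \<psi>] bounded_multiplier_sq_integrable[OF assms]
  show "mult_l2 \<psi> (x + y) = mult_l2 \<psi> x + mult_l2 \<psi> y"
    using assms fg by (simp add: m sq_integrable_add bounded_multiplier_def distrib_left flip: abs_l2_add)
  show "mult_l2 \<psi> (r *\<^sub>R x) = r *\<^sub>R mult_l2 \<psi> x"
    using assms fg by (simp add: m sq_integrable_cmult bounded_multiplier_def mult.left_commute flip: abs_l2_scaleR)
qed

lemma mult_l2_inner_swap:
  assumes "bounded_multiplier \<psi>"
  shows "mult_l2 \<psi> x \<bullet> y = x \<bullet> mult_l2 \<psi> y"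
proof -
  obtain f g where fg: "sq_integrable lebesgue f" "x = abs_l2 f" "sq_integrable lebesgue g" "y = abs_l2 g"
    by (meson abs_l2_cases)
  note m = mult_l2_abs[of _ \<psi>] bounded_multiplier_sq_integrable[OF assms]
  have "(\<lambda>x. of_real (\<psi> x) * f x * cnj (g x)) = (\<lambda>x. f x * cnj (of_real (\<psi> x) * g x))" by auto
  then show ?thesis using assms fg by (simp add: m bounded_multiplier_def abs_l2_inner)
qed

lemma mult_l2_norm_mono:
  assumes "bounded_multiplier \<psi>" "bounded_multiplier \<theta>" "\<And>x. \<bar>\<psi> x\<bar> \<le> \<bar>\<theta> x\<bar>"
  shows "norm (mult_l2 \<psi> v) \<le> norm (mult_l2 \<theta> v)"
proof -
  obtain f where f: "sq_integrable lebesgue f" "v = abs_l2 f" by (meson abs_l2_cases)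
  note s = bounded_multiplier_sq_integrable[OF assms(1) f(1)] bounded_multiplier_sq_integrable[OF assms(2) f(1)]
  have "norm (abs_l2 (\<lambda>x. of_real (\<psi> x) * f x)) \<le> norm (abs_l2 (\<lambda>x. of_real (\<theta> x) * f x))"
    unfolding abs_l2_norm[OF s(1)] abs_l2_norm[OF s(2)]
  proof (intro real_sqrt_le_mono integral_mono)
    show "(norm (of_real (\<psi> x) * f x))\<^sup>2 \<le> (norm (of_real (\<theta> x) * f x))\<^sup>2" for x
      using assms(3)[of x] by (intro power_mono) (auto simp: norm_mult intro: mult_right_mono)
  qed (use s in \<open>auto simp: sq_integrable_def\<close>)
  then show ?thesis using f assms by (simp add: mult_l2_abs bounded_multiplier_def)
qed

lemma mult_l2_diff_id:
  assumes "bounded_multiplier \<psi>"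
  shows "mult_l2 (\<lambda>x. 1 - \<psi> x) v = v - mult_l2 \<psi> v"
proof -
  obtain f where f: "sq_integrable lebesgue f" "v = abs_l2 f" by (meson abs_l2_cases)
  obtain C where C: "\<And>x. \<bar>\<psi> x\<bar> \<le> C" using assms by (auto simp: bounded_multiplier_def bounded_iff)
  have "\<bar>1 - \<psi> x\<bar> \<le> 1 + C" for x using C[of x] by linarith
  then have "bounded_multiplier (\<lambda>x. 1 - \<psi> x)"
    using assms by (intro bounded_multiplierI[where C = "1 + C"]) (auto simp: bounded_multiplier_def)
  then show ?thesis using f assms
    by (simp add: mult_l2_abs bounded_multiplier_def left_diff_distrib bounded_multiplier_sq_integrable flip: abs_l2_diff)
qed

text \<open>Dominated convergence with majorant |f|^2. As the multipliers converge only pointwise,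
  this is strong convergence, not convergence in operator norm; uniformity comes later from finite
  dimension.\<close>

lemma mult_l2_tendsto_0:
  assumes m: "\<And>n. \<psi> n \<in> borel_measurable lebesgue" and b: "\<And>n x. \<bar>\<psi> n x\<bar> \<le> 1"
    and lim: "\<And>x. (\<lambda>n. \<psi> n x) \<longlonglongrightarrow> 0"
  shows "(\<lambda>n. mult_l2 (\<psi> n) v) \<longlonglongrightarrow> 0"
proof -
  obtain f where f: "sq_integrable lebesgue f" "v = abs_l2 f" by (meson abs_l2_cases)
  have bm: "bounded_multiplier (\<psi> n)" for n using m b by (rule bounded_multiplierI)
  have s: "sq_integrable lebesgue (\<lambda>x. of_real (\<psi> n x) * f x)" for n
    by (rule bounded_multiplier_sq_integrable[OF bm f(1)])
  have fm: "f \<in> borel_measurable lebesgue" using f(1) by (rule sq_integrable_measurable)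
  have "(\<lambda>n. LINT x|lebesgue. (norm (of_real (\<psi> n x) * f x))\<^sup>2) \<longlonglongrightarrow> (LINT x|(lebesgue::'a measure). 0)"
  proof (rule integral_dominated_convergence[where w = "\<lambda>x. (norm (f x))\<^sup>2"])
    show "integrable lebesgue (\<lambda>x. (norm (f x))\<^sup>2)" using f(1) by (simp add: sq_integrable_def)
    show "(\<lambda>x. (norm (of_real (\<psi> n x) * f x))\<^sup>2) \<in> borel_measurable lebesgue" for n
      using s[of n] by (simp add: sq_integrable_def borel_measurable_integrable)
    show "AE x in lebesgue. (\<lambda>n. (norm (of_real (\<psi> n x) * f x))\<^sup>2) \<longlonglongrightarrow> 0"
    proof (rule AE_I2)
      fix x
      have "(\<lambda>n. (norm (of_real (\<psi> n x) * f x))\<^sup>2) \<longlonglongrightarrow> (norm (of_real 0 * f x))\<^sup>2"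
        by (intro tendsto_intros lim)
      then show "(\<lambda>n. (norm (of_real (\<psi> n x) * f x))\<^sup>2) \<longlonglongrightarrow> 0" by simp
    qed
    show "AE x in lebesgue. norm ((norm (of_real (\<psi> n x) * f x))\<^sup>2) \<le> (norm (f x))\<^sup>2" for n
    proof (rule AE_I2)
      fix x
      have "norm (of_real (\<psi> n x) * f x) \<le> 1 * norm (f x)"
        unfolding norm_mult using b[of n x] by (intro mult_right_mono) auto
      then show "norm ((norm (of_real (\<psi> n x) * f x))\<^sup>2) \<le> (norm (f x))\<^sup>2"
        by (simp add: power_mono)
    qed
  qed simp
  then have "(\<lambda>n. sqrt (LINT x|lebesgue. (norm (of_real (\<psi> n x) * f x))\<^sup>2)) \<longlonglongrightarrow> sqrt 0"
    by (intro tendsto_real_sqrt) simp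
  then have "(\<lambda>n. norm (mult_l2 (\<psi> n) v)) \<longlonglongrightarrow> 0"
    using bm f s by (simp add: mult_l2_abs bounded_multiplier_def abs_l2_norm)
  then show ?thesis by (rule tendsto_norm_zero_cancel)
qed

lemma bounded_multiplier_indicator: "open \<Omega> \<Longrightarrow> bounded_multiplier (indicator \<Omega>)"
  by (rule bounded_multiplierI[where C = 1]) (auto intro!: borel_measurable_indicator open_in_sets_lebesgue simp: indicator_def)

lemma mult_l2_indicator:
  assumes "open \<Omega>" "sq_integrable lebesgue f"
  shows "mult_l2 (indicator \<Omega>) (abs_l2 f) = emb \<Omega> f"
  using assms bounded_multiplier_indicator[OF assms(1)]
  by (subst mult_l2_abs) (auto simp: bounded_multiplier_def emb_def intro!: arg_cong[where f = abs_l2])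

lemma mult_l2_indicator_emb:
  assumes "open \<Omega>" "sq_integrable (lebesgue_on \<Omega>) f"
  shows "mult_l2 (indicator \<Omega>) (emb \<Omega> f) = emb \<Omega> f"
  using assms bounded_multiplier_indicator[OF assms(1)]
  by (subst mult_l2_emb) (auto simp: bounded_multiplier_def emb_def open_in_sets_lebesgue intro!: arg_cong[where f = abs_l2])

text \<open>
  The operator is extended by the identity on functions vanishing on \<open>\<Omega>\<close>, so that the type \<open>l2\<close> can
  serve as the underlying Hilbert space; this does not affect the eigenspace at \<open>l\<close>.
\<close>

lemma dirichlet_laplacian_gap:
  fixes \<Omega> :: "'a::euclidean_space set" and l :: real
  defines "A \<equiv> dirichlet_laplacian \<Omega>"
  assumes \<Omega>: "open \<Omega>" and iso: "of_real l isolated_in spectrum \<Omega> A" and ev: "eigenvalue \<Omega> A (of_real l)"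
  shows "\<exists>c>0. \<forall>u f. (u, f) \<in> A \<longrightarrow> (\<forall>e\<in>eigenspace \<Omega> A (of_real l). emb \<Omega> u \<bullet> emb \<Omega> e = 0) \<longrightarrow>
     c * norm (emb \<Omega> u) \<le> norm (emb \<Omega> (\<lambda>x. f x - of_real l * u x))"
proof -
  have \<Omega>m: "\<Omega> \<in> sets lebesgue" using \<Omega> by (rule open_in_sets_lebesgue)
  let ?P = "mult_l2 (indicator \<Omega>) :: 'a l2 \<Rightarrow> 'a l2"
  note bm = bounded_multiplier_indicator[OF \<Omega>]
  note Plin = mult_l2_linear[OF bm]
  have P0: "?P 0 = 0" using Plin(2)[of 0 0] by simp
  have Pd: "?P (x - y) = ?P x - ?P y" for x y using Plin(1)[of "x - y" y] by (simp add: algebra_simps)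
  let ?B = "\<lambda>f u. emb \<Omega> (\<lambda>x. f x - of_real l * u x)"
  have As: "sq_integrable (lebesgue_on \<Omega>) u" "sq_integrable (lebesgue_on \<Omega>) f"
    "sq_integrable (lebesgue_on \<Omega>) (\<lambda>x. f x - c * u x)" if "(u, f) \<in> A" for u f c
    using dirichlet_laplacian_sq_integrable[of u f \<Omega>] that
    by (auto simp: A_def intro!: sq_integrable_diff sq_integrable_cmult)
  define A' where "A' = {(emb \<Omega> u + z, ?B f u + z) | u f z. (u, f) \<in> A \<and> ?P z = 0}"
  have A'I: "(u, f) \<in> A \<Longrightarrow> ?P z = 0 \<Longrightarrow> U = emb \<Omega> u + z \<Longrightarrow> F = ?B f u + z \<Longrightarrow> (U, F) \<in> A'" for u f z U F
    unfolding A'_def by blast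
  have A'E: "\<exists>u f z. (u, f) \<in> A \<and> ?P z = 0 \<and> U = emb \<Omega> u + z \<and> F = ?B f u + z" if "(U, F) \<in> A'" for U F
    using that unfolding A'_def by blast
  have orth: "emb \<Omega> f \<bullet> z = 0" "z \<bullet> emb \<Omega> f = 0" if "sq_integrable (lebesgue_on \<Omega>) f" "?P z = 0" for f z
    using mult_l2_inner_swap[OF bm, of "emb \<Omega> f" z] mult_l2_indicator_emb[OF \<Omega> that(1)] that(2)
    by (simp_all add: inner_commute)
  obtain \<epsilon> where \<epsilon>: "\<epsilon> > 0" "\<And>z. z \<in> spectrum \<Omega> A \<Longrightarrow> dist (of_real l) z < \<epsilon> \<Longrightarrow> z = of_real l"
    using iso unfolding isolated_in_dist_Ex_iff by blast
  \<comment> \<open>The bound 1/2 separates t from 1, the value that the identity on the complement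
    contributes.\<close>
  define \<delta> where "\<delta> = min \<epsilon> (1/2)"
  have \<delta>: "0 < \<delta>" "\<delta> \<le> \<epsilon>" "\<delta> \<le> 1/2" using \<epsilon>(1) by (auto simp: \<delta>_def)
  have res: "of_real (l + t) \<in> resolvent_set \<Omega> A" if "0 < \<bar>t\<bar>" "\<bar>t\<bar> < \<delta>" for t
  proof (rule ccontr)
    assume "of_real (l + t) \<notin> resolvent_set \<Omega> A"
    then have "of_real (l + t) \<in> spectrum \<Omega> A" by (simp add: spectrum_def)
    moreover have "dist (of_real l) (of_real (l + t) :: complex) < \<epsilon>"
      using that \<delta> by (simp add: dist_norm)
    ultimately show False using \<epsilon>(2) that by force
  qed
  have "\<exists>c>0. \<forall>U F. (U, F) \<in> A' \<longrightarrow> (\<forall>e. (e, 0) \<in> A' \<longrightarrow> U \<bullet> e = 0) \<longrightarrow> c * norm U \<le> norm F"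
  proof (rule symmetric_relation_gap[OF _ _ \<delta>(1)])
    show "subspace A'"
      unfolding subspace_def
    proof (intro conjI ballI allI)
      \<comment> \<open>The eigenvalue supplies some element of the graph; scaled by 0 it gives the
        zero pair.\<close>
      obtain u f where uf: "(u, f) \<in> A" using ev by (auto simp: eigenvalue_def eigenspace_def)
      have "((\<lambda>x. 0 * u x), (\<lambda>x. 0 * f x)) \<in> A" using dirichlet_laplacian_cmult[OF \<Omega>] uf unfolding A_def by blast
      then show "0 \<in> A'" unfolding zero_prod_def by (rule A'I[where z = 0]) (simp_all add: P0 emb_zero)
      fix X assume "X \<in> A'"
      then obtain u f z where 1: "(u, f) \<in> A" "?P z = 0" "X = (emb \<Omega> u + z, ?B f u + z)" unfolding A'_def by blast
      {
        fix Y assume "Y \<in> A'"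
        then obtain v g y where 2: "(v, g) \<in> A" "?P y = 0" "Y = (emb \<Omega> v + y, ?B g v + y)" unfolding A'_def by blast
        have 3: "((\<lambda>x. u x + v x), (\<lambda>x. f x + g x)) \<in> A" using dirichlet_laplacian_add[OF \<Omega>] 1(1) 2(1) unfolding A_def by blast
        have "?B (\<lambda>x. f x + g x) (\<lambda>x. u x + v x) = ?B f u + ?B g v"
          using emb_add[OF \<Omega>m As(3)[OF 1(1)] As(3)[OF 2(1)], of "of_real l" "of_real l"] by (simp add: algebra_simps)
        moreover have "emb \<Omega> (\<lambda>x. u x + v x) = emb \<Omega> u + emb \<Omega> v" by (rule emb_add[OF \<Omega>m As(1)[OF 1(1)] As(1)[OF 2(1)]])
        ultimately show "X + Y \<in> A'" unfolding 1(3) 2(3) plus_prod_def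
          by (intro A'I[OF 3, of "z + y"]) (simp_all add: Plin 1(2) 2(2))
      }
      fix r :: real
      have 3: "((\<lambda>x. of_real r * u x), (\<lambda>x. of_real r * f x)) \<in> A" using dirichlet_laplacian_cmult[OF \<Omega>] 1(1) unfolding A_def by blast
      have "?B (\<lambda>x. of_real r * f x) (\<lambda>x. of_real r * u x) = r *\<^sub>R ?B f u"
        using emb_scaleR[OF \<Omega>m As(3)[OF 1(1)], of r "of_real l"] by (simp add: algebra_simps)
      moreover have "emb \<Omega> (\<lambda>x. of_real r * u x) = r *\<^sub>R emb \<Omega> u" by (rule emb_scaleR[OF \<Omega>m As(1)[OF 1(1)]])
      ultimately show "r *\<^sub>R X \<in> A'" unfolding 1(3) scaleR_prod_def
        by (intro A'I[OF 3, of "r *\<^sub>R z"]) (simp_all add: Plin 1(2) scaleR_add_right)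
    qed
    show "F \<bullet> V = U \<bullet> G" if UF: "(U, F) \<in> A'" and VG: "(V, G) \<in> A'" for U F V G
    proof -
      obtain u f z where 1: "(u, f) \<in> A" "?P z = 0" "U = emb \<Omega> u + z" "F = ?B f u + z" using A'E[OF UF] by blast
      obtain v g y where 2: "(v, g) \<in> A" "?P y = 0" "V = emb \<Omega> v + y" "G = ?B g v + y" using A'E[OF VG] by blast
      note s1 = As[OF 1(1)] and s2 = As[OF 2(1)]
      have e: "?B f u = emb \<Omega> f - l *\<^sub>R emb \<Omega> u" "?B g v = emb \<Omega> g - l *\<^sub>R emb \<Omega> v"
        using s1 s2 by (simp_all add: emb_diff \<Omega>m sq_integrable_cmult emb_scaleR)
      have "emb \<Omega> f \<bullet> emb \<Omega> v = emb \<Omega> u \<bullet> emb \<Omega> g"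
        using dirichlet_laplacian_symmetric[of u f \<Omega> v g] 1(1) 2(1) s1 s2 by (simp add: emb_inner \<Omega>m A_def)
      then show ?thesis
        using orth[OF s1(1) 2(2)] orth[OF s2(1) 1(2)] orth[OF s1(2) 2(2)] orth[OF s2(2) 1(2)]
        unfolding 1(3,4) 2(3,4) e by (simp add: inner_simps)
    qed
    fix t assume t: "0 < \<bar>t\<bar>" "\<bar>t\<bar> < \<delta>"
    note R = res[OF t, unfolded resolvent_set_def]
    have t1: "1 - t \<ge> 1/2" using t \<delta> by linarith
    show "\<exists>U. (U, G + t *\<^sub>R U) \<in> A'" for G
    proof -
      obtain g where g: "sq_integrable lebesgue g" "G = abs_l2 g" by (meson abs_l2_cases)
      have gs: "sq_integrable (lebesgue_on \<Omega>) g"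
        unfolding sq_integrable_extend[OF \<Omega>m, symmetric]
      proof (rule sq_integrable_bound[OF g(1), where C = 1])
        show "(\<lambda>x. if x \<in> \<Omega> then g x else 0) \<in> borel_measurable lebesgue"
          using sq_integrable_measurable[OF g(1)] \<Omega>m by (intro borel_measurable_if_I measurable_restrict_space1)
      qed simp
      then obtain u f where uf: "(u, f) \<in> A" "AE x in lebesgue_on \<Omega>. f x - of_real (l + t) * u x = g x"
        using R by (force simp: Lp_space_2_iff)
      have PG: "?P G = emb \<Omega> g" unfolding g(2) by (rule mult_l2_indicator[OF \<Omega> g(1)])
      \<comment> \<open>On the complement the equation F = G + t U reads z = (G - P G) + t
        z.\<close>
      define z where "z = (1 / (1 - t)) *\<^sub>R (G - ?P G)"
      have PP: "?P (?P G) = ?P G" unfolding PG by (rule mult_l2_indicator_emb[OF \<Omega> gs])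
      have Pz: "?P z = 0" unfolding z_def by (simp add: Plin Pd PP)
      have "?B f u = emb \<Omega> (\<lambda>x. (f x - of_real (l + t) * u x) + of_real t * u x)" by (simp add: algebra_simps)
      also have "\<dots> = emb \<Omega> (\<lambda>x. f x - of_real (l + t) * u x) + t *\<^sub>R emb \<Omega> u"
        using As[OF uf(1)] by (simp add: emb_add \<Omega>m sq_integrable_cmult emb_scaleR)
      also have "emb \<Omega> (\<lambda>x. f x - of_real (l + t) * u x) = ?P G"
        unfolding PG using emb_eq_iff[OF \<Omega>m As(3)[OF uf(1)] gs] uf(2) by blast
      finally have Bfu: "?B f u = ?P G + t *\<^sub>R emb \<Omega> u" .
      have "(1 - t) *\<^sub>R z = G - ?P G" using t1 by (simp add: z_def)
      then have "G + t *\<^sub>R (emb \<Omega> u + z) = ?B f u + z"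
        unfolding Bfu by (simp add: algebra_simps)
      then show ?thesis using A'I[OF uf(1) Pz refl] by metis
    qed
    obtain C where C: "\<And>u f. (u, f) \<in> A \<Longrightarrow> L2_norm \<Omega> u \<le> C * L2_norm \<Omega> (\<lambda>x. f x - of_real (l + t) * u x)"
      using R by blast
    \<comment> \<open>The component on \<open>\<Omega>\<close> contributes the resolvent constant C,
      the complement contributes 2 as a bound for 1/(1 - t). Orthogonality bounds each component of
      F - t U by the whole.\<close>
    have "norm U \<le> (\<bar>C\<bar> + 2) * norm (F - t *\<^sub>R U)" if UF: "(U, F) \<in> A'" for U F
    proof -
      obtain u f z where 1: "(u, f) \<in> A" "?P z = 0" "U = emb \<Omega> u + z" "F = ?B f u + z" using A'E[OF UF] by blast
      note s = As[OF 1(1)]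
      define X where "X = emb \<Omega> (\<lambda>x. f x - of_real (l + t) * u x)"
      have "?B f u = emb \<Omega> (\<lambda>x. (f x - of_real (l + t) * u x) + of_real t * u x)" by (simp add: algebra_simps)
      also have "\<dots> = X + t *\<^sub>R emb \<Omega> u"
        using s by (simp add: X_def emb_add \<Omega>m sq_integrable_cmult emb_scaleR)
      finally have F: "F - t *\<^sub>R U = X + (1 - t) *\<^sub>R z" unfolding 1 by (simp add: algebra_simps)
      have Xz: "X \<bullet> z = 0" unfolding X_def by (rule orth[OF s(3) 1(2)])
      have n: "(norm (F - t *\<^sub>R U))\<^sup>2 = (norm X)\<^sup>2 + (norm ((1 - t) *\<^sub>R z))\<^sup>2"
        unfolding F by (rule norm_add_Pythagorean) (simp add: orthogonal_def Xz)
      have "norm X \<le> norm (F - t *\<^sub>R U)" by (rule power2_le_imp_le) (simp_all add: n)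
      moreover have "norm ((1 - t) *\<^sub>R z) \<le> norm (F - t *\<^sub>R U)" by (rule power2_le_imp_le) (simp_all add: n)
      moreover have "norm (emb \<Omega> u) \<le> \<bar>C\<bar> * norm X"
        using C[OF 1(1)] mult_right_mono[OF abs_ge_self[of C] norm_ge_zero[of X]] s
        by (simp add: emb_norm \<Omega>m X_def)
      moreover have "norm z \<le> 2 * norm ((1 - t) *\<^sub>R z)"
        using mult_right_mono[OF t1 norm_ge_zero[of z]] t1 by simp
      moreover have "norm U \<le> norm (emb \<Omega> u) + norm z" unfolding 1 by (rule norm_triangle_ineq)
      moreover have "\<bar>C\<bar> * norm X \<le> \<bar>C\<bar> * norm (F - t *\<^sub>R U)" using calculation(1) by (intro mult_left_mono) auto
      ultimately show ?thesis by (simp add: distrib_right)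
    qed
    then show "\<exists>C. \<forall>U F. (U, F) \<in> A' \<longrightarrow> norm U \<le> C * norm (F - t *\<^sub>R U)" by blast
  qed
  then obtain c where c: "c > 0" "\<And>U F. (U, F) \<in> A' \<Longrightarrow> (\<And>e. (e, 0) \<in> A' \<Longrightarrow> U \<bullet> e = 0) \<Longrightarrow> c * norm U \<le> norm F"
    by blast
  have "c * norm (emb \<Omega> u) \<le> norm (?B f u)"
    if uf: "(u, f) \<in> A" and perp: "\<And>e. e \<in> eigenspace \<Omega> A (of_real l) \<Longrightarrow> emb \<Omega> u \<bullet> emb \<Omega> e = 0" for u f
  proof (rule c(2))
    show "(emb \<Omega> u, ?B f u) \<in> A'" by (rule A'I[OF uf P0]) simp_all
    fix e' assume "(e', 0) \<in> A'"
    then obtain e g z where 1: "(e, g) \<in> A" "?P z = 0" "e' = emb \<Omega> e + z" "0 = ?B g e + z" using A'E by blast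
    note s = As[OF 1(1)]
    \<comment> \<open>Projecting the second component 0 to \<open>\<Omega>\<close> separates the two
      parts: H - l annihilates e, and z = 0. So the kernel of A' is the embedded eigenspace.\<close>
    have "?P (?B g e + z) = ?B g e" by (simp add: Plin 1(2) mult_l2_indicator_emb[OF \<Omega> s(3)])
    then have B0: "?B g e = 0" using 1(4) P0 by metis
    then have z0: "z = 0" using 1(4) by simp
    have "AE x in lebesgue_on \<Omega>. g x - of_real l * e x = 0"
      using emb_eq_iff[OF \<Omega>m s(3) sq_integrable_zero] B0 by (simp add: emb_zero)
    then have "e \<in> eigenspace \<Omega> A (of_real l)" using 1(1) unfolding eigenspace_def by auto
    then show "emb \<Omega> u \<bullet> e' = 0" using perp by (simp add: 1(3) z0)
  qed
  then show ?thesis using c(1) by blast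
qed

section \<open>Integrability of eigenfunctions\<close>

text \<open>The orthogonal projection onto the span of an orthogonal family that need not be
  normalised; a zero vector in C contributes 0.\<close>

definition ortho_proj :: "'h::real_inner set \<Rightarrow> 'h \<Rightarrow> 'h" where
  "ortho_proj C v = (\<Sum>e\<in>C. (v \<bullet> e / (e \<bullet> e)) *\<^sub>R e)"

lemma ortho_proj:
  assumes C: "finite C" "pairwise orthogonal C"
  shows "ortho_proj C v \<in> span C" "x \<in> span C \<Longrightarrow> (v - ortho_proj C v) \<bullet> x = 0"
    "norm (ortho_proj C v) \<le> norm v" "v \<in> span C \<Longrightarrow> ortho_proj C v = v"
proof -
  show sp: "ortho_proj C v \<in> span C"
    unfolding ortho_proj_def by (intro span_sum span_scale span_base)
  have e: "(v - ortho_proj C v) \<bullet> e = 0" if "e \<in> C" for v e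
  proof -
    have "ortho_proj C v \<bullet> e = (\<Sum>f\<in>C. if f = e then v \<bullet> e else 0)"
      unfolding ortho_proj_def inner_sum_left
      using C(2) that by (intro sum.cong) (auto simp: pairwise_def orthogonal_def)
    also have "\<dots> = v \<bullet> e" using C(1) that by simp
    finally show ?thesis by (simp add: inner_diff_left)
  qed
  have orth: "(v - ortho_proj C v) \<bullet> x = 0" if "x \<in> span C" for v x
    using that by (induction rule: span_induct_alt) (simp_all add: inner_add_right e)
  then show "x \<in> span C \<Longrightarrow> (v - ortho_proj C v) \<bullet> x = 0" .
  have "(norm v)\<^sup>2 = (norm ((v - ortho_proj C v) + ortho_proj C v))\<^sup>2" by simp
  also have "\<dots> = (norm (v - ortho_proj C v))\<^sup>2 + (norm (ortho_proj C v))\<^sup>2"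
    by (rule norm_add_Pythagorean) (simp add: orthogonal_def orth sp)
  finally have "(norm (ortho_proj C v))\<^sup>2 \<le> (norm v)\<^sup>2" by simp
  then show "norm (ortho_proj C v) \<le> norm v" by (rule power2_le_imp_le) simp
  assume v: "v \<in> span C"
  have "(v - ortho_proj C v) \<bullet> (v - ortho_proj C v) = 0" by (rule orth) (intro span_diff v sp)
  then show "ortho_proj C v = v" by simp
qed

text \<open>The coefficient of p at e is at most |p| / |e|, so convergence to 0 on the finitely many
  vectors of C is uniform on the unit ball of their span.\<close>

lemma uniformly_small_on_span:
  fixes T :: "nat \<Rightarrow> 'h::real_inner \<Rightarrow> 'h"
  assumes C: "finite C" "pairwise orthogonal C"
    and lin: "\<And>n. linear (T n)" and lim: "\<And>e. e \<in> C \<Longrightarrow> (\<lambda>n. T n e) \<longlonglongrightarrow> 0" and \<kappa>: "0 < \<kappa>"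
  shows "\<exists>n. \<forall>p\<in>span C. norm (T n p) \<le> \<kappa> * norm p"
proof -
  have "(\<lambda>n. \<Sum>e\<in>C. norm (T n e) / norm e) \<longlonglongrightarrow> (\<Sum>e\<in>C. 0)"
    by (intro tendsto_sum tendsto_divide_zero tendsto_norm_zero lim)
  then have "\<forall>\<^sub>F n in sequentially. (\<Sum>e\<in>C. norm (T n e) / norm e) < \<kappa>"
    using \<kappa> by (intro order_tendstoD(2)) auto
  then obtain n where n: "(\<Sum>e\<in>C. norm (T n e) / norm e) < \<kappa>"
    using eventually_happens'[OF sequentially_bot] by blast
  have "norm (T n p) \<le> \<kappa> * norm p" if p: "p \<in> span C" for p
  proof -
    have "T n p = T n (ortho_proj C p)" using ortho_proj(4)[OF C p] by simp
    also have "\<dots> = (\<Sum>e\<in>C. (p \<bullet> e / (e \<bullet> e)) *\<^sub>R T n e)"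
      unfolding ortho_proj_def by (simp add: linear_sum[OF lin] linear_scale[OF lin])
    also have "norm \<dots> \<le> (\<Sum>e\<in>C. norm p * (norm (T n e) / norm e))"
    proof (rule sum_norm_le)
      fix e
      have "\<bar>p \<bullet> e\<bar> / (e \<bullet> e) * norm (T n e) \<le> norm p * norm e / (e \<bullet> e) * norm (T n e)"
        by (intro mult_right_mono divide_right_mono Cauchy_Schwarz_ineq2) auto
      also have "\<dots> = norm p * (norm (T n e) / norm e)"
        by (cases "e = 0") (simp_all add: dot_square_norm power2_eq_square)
      finally show "norm ((p \<bullet> e / (e \<bullet> e)) *\<^sub>R T n e) \<le> norm p * (norm (T n e) / norm e)" by simp
    qed
    also have "\<dots> = norm p * (\<Sum>e\<in>C. norm (T n e) / norm e)" by (simp add: sum_distrib_left)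
    also have "\<dots> \<le> norm p * \<kappa>" using n by (intro mult_left_mono) auto
    finally show ?thesis by (simp add: mult.commute)
  qed
  then show ?thesis by blast
qed

lemma eigenspace_lincomb:
  assumes \<Omega>: "open \<Omega>"
  shows "u \<in> eigenspace \<Omega> (dirichlet_laplacian \<Omega>) z \<Longrightarrow> v \<in> eigenspace \<Omega> (dirichlet_laplacian \<Omega>) z \<Longrightarrow>
      (\<lambda>x. u x + v x) \<in> eigenspace \<Omega> (dirichlet_laplacian \<Omega>) z"
    and "u \<in> eigenspace \<Omega> (dirichlet_laplacian \<Omega>) z \<Longrightarrow> (\<lambda>x. c * u x) \<in> eigenspace \<Omega> (dirichlet_laplacian \<Omega>) z"
proof -
  assume u: "u \<in> eigenspace \<Omega> (dirichlet_laplacian \<Omega>) z"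
  then obtain f where f: "(u, f) \<in> dirichlet_laplacian \<Omega>" "AE x in lebesgue_on \<Omega>. f x = z * u x"
    by (auto simp: eigenspace_def)
  have "AE x in lebesgue_on \<Omega>. c * f x = z * (c * u x)" using f(2) by eventually_elim simp
  then show "(\<lambda>x. c * u x) \<in> eigenspace \<Omega> (dirichlet_laplacian \<Omega>) z"
    using dirichlet_laplacian_cmult[OF \<Omega> f(1), of c] by (auto simp: eigenspace_def)
  assume v: "v \<in> eigenspace \<Omega> (dirichlet_laplacian \<Omega>) z"
  then obtain g where g: "(v, g) \<in> dirichlet_laplacian \<Omega>" "AE x in lebesgue_on \<Omega>. g x = z * v x"
    by (auto simp: eigenspace_def)
  have "AE x in lebesgue_on \<Omega>. f x + g x = z * (u x + v x)"
    using f(2) g(2) by eventually_elim (simp add: distrib_left)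
  then show "(\<lambda>x. u x + v x) \<in> eigenspace \<Omega> (dirichlet_laplacian \<Omega>) z"
    using dirichlet_laplacian_add[OF \<Omega> f(1) g(1)] by (auto simp: eigenspace_def)
qed

text \<open>Spans in \<open>l2\<close> are real while the multiplicity is a complex notion: each
  complex generator w is accompanied by \<i> w, and a coefficient is split into real and imaginary
  part. Gram-Schmidt then makes the generating set orthogonal.\<close>

lemma eigenspace_orthogonal_basis:
  assumes \<Omega>: "open \<Omega>" and ev: "eigenvalue \<Omega> (dirichlet_laplacian \<Omega>) z"
    and fin: "finite_multiplicity \<Omega> (dirichlet_laplacian \<Omega>) z"
  shows "\<exists>C. finite C \<and> pairwise orthogonal C \<and> span C = emb \<Omega> ` eigenspace \<Omega> (dirichlet_laplacian \<Omega>) z"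
proof -
  let ?E = "eigenspace \<Omega> (dirichlet_laplacian \<Omega>) z"
  have \<Omega>m: "\<Omega> \<in> sets lebesgue" using \<Omega> by (rule open_in_sets_lebesgue)
  have s: "sq_integrable (lebesgue_on \<Omega>) u" if "u \<in> ?E" for u
    using H1_0_sq_integrable(1)[OF eigenspace_iff(1)[OF that]] .
  obtain B where B: "finite B" "B \<subseteq> ?E"
    "\<And>u. u \<in> ?E \<Longrightarrow> \<exists>c. AE x in lebesgue_on \<Omega>. u x = (\<Sum>w\<in>B. c w * w x)"
    using fin unfolding finite_multiplicity_def by blast
  define G where "G = emb \<Omega> ` B \<union> (\<lambda>w. emb \<Omega> (\<lambda>x. \<i> * w x)) ` B"
  have E0: "(\<lambda>x. 0) \<in> ?E"
  proof -
    obtain u where "u \<in> ?E" using ev by (auto simp: eigenvalue_def)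
    then show ?thesis using eigenspace_lincomb(2)[OF \<Omega>, of u z 0] by simp
  qed
  have sub: "subspace (emb \<Omega> ` ?E)"
    unfolding subspace_def
  proof (intro conjI ballI allI)
    show "0 \<in> emb \<Omega> ` ?E" using E0 by (intro image_eqI[of _ _ "\<lambda>x. 0"]) (simp_all add: emb_zero)
    fix x assume "x \<in> emb \<Omega> ` ?E"
    then obtain u where u: "u \<in> ?E" "x = emb \<Omega> u" by blast
    show "r *\<^sub>R x \<in> emb \<Omega> ` ?E" for r
      using eigenspace_lincomb(2)[OF \<Omega> u(1)] emb_scaleR[OF \<Omega>m s[OF u(1)]] u(2) by (metis imageI)
    fix y assume "y \<in> emb \<Omega> ` ?E"
    then obtain v where v: "v \<in> ?E" "y = emb \<Omega> v" by blast
    show "x + y \<in> emb \<Omega> ` ?E"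
      using eigenspace_lincomb(1)[OF \<Omega> u(1) v(1)] emb_add[OF \<Omega>m s[OF u(1)] s[OF v(1)]] u(2) v(2) by (metis imageI)
  qed
  have "span G = emb \<Omega> ` ?E"
  proof (rule span_subspace[OF _ _ sub])
    show "G \<subseteq> emb \<Omega> ` ?E"
      unfolding G_def using B(2) eigenspace_lincomb(2)[OF \<Omega>] by blast
    show "emb \<Omega> ` ?E \<subseteq> span G"
    proof
      fix x assume "x \<in> emb \<Omega> ` ?E"
      then obtain u where u: "u \<in> ?E" "x = emb \<Omega> u" by blast
      obtain c where c: "AE x in lebesgue_on \<Omega>. u x = (\<Sum>w\<in>B. c w * w x)" using B(3)[OF u(1)] by blast
      have part: "sq_integrable (lebesgue_on \<Omega>) (\<lambda>x. \<Sum>w\<in>B'. c w * w x) \<and> emb \<Omega> (\<lambda>x. \<Sum>w\<in>B'. c w * w x) \<in> span G"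
        if "B' \<subseteq> B" for B'
        using finite_subset[OF that B(1)] that
      proof (induction B' rule: finite_induct)
        case empty then show ?case by (simp add: emb_zero span_zero)
      next
        case (insert w B')
        have w: "w \<in> B" "sq_integrable (lebesgue_on \<Omega>) w" using insert.prems B(2) s by auto
        have "(\<lambda>x. c w * w x) = (\<lambda>x. of_real (Re (c w)) * w x + of_real (Im (c w)) * (\<i> * w x))"
          by (rule ext, subst complex_eq[of "c w"]) (simp add: algebra_simps)
        then have "emb \<Omega> (\<lambda>x. c w * w x) = Re (c w) *\<^sub>R emb \<Omega> w + Im (c w) *\<^sub>R emb \<Omega> (\<lambda>x. \<i> * w x)"
          by (simp add: emb_add emb_scaleR \<Omega>m sq_integrable_cmult w)
        moreover have "emb \<Omega> w \<in> span G" "emb \<Omega> (\<lambda>x. \<i> * w x) \<in> span G"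
          using w(1) by (auto simp: G_def intro!: span_base)
        ultimately have "emb \<Omega> (\<lambda>x. c w * w x) \<in> span G" by (simp add: span_add span_scale)
        then show ?case using insert w
          by (simp add: sq_integrable_add sq_integrable_cmult emb_add \<Omega>m span_add)
      qed
      have "x = emb \<Omega> (\<lambda>x. \<Sum>w\<in>B. c w * w x)"
        unfolding u(2) using emb_eq_iff[OF \<Omega>m s[OF u(1)]] part[OF order_refl] c by blast
      then show "x \<in> span G" using part[OF order_refl] by simp
    qed
  qed
  moreover have "finite G" using B(1) by (simp add: G_def)
  ultimately show ?thesis using basis_orthogonal[of G] by metis
qed

text \<open>
  With \<open>p\<close> the projection of \<open>w u\<close> to the eigenspace, the gap controls \<open>w u - p\<close>, and
  \<open>\<langle>w u, p\<rangle> = \<langle>w u, (1 - 1/w) p\<rangle> + \<langle>u, p\<rangle>\<close>, where \<open>(1 - 1/w) p\<close> is small uniformly on the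
  finite-dimensional eigenspace.
\<close>

lemma weighted_eigenfunction_uniform_bound:
  fixes \<Omega> :: "'a::euclidean_space set" and l :: real
  defines "A \<equiv> dirichlet_laplacian \<Omega>"
  assumes \<Omega>: "open \<Omega>" and iso: "of_real l isolated_in spectrum \<Omega> A" and ev: "eigenvalue \<Omega> A (of_real l)"
    and fin: "finite_multiplicity \<Omega> A (of_real l)" and u: "u \<in> eigenspace \<Omega> A (of_real l)" and k: "0 < k"
  shows "\<exists>e. 0 < e \<and> e \<le> 1 \<and> (\<forall>r. 0 < r \<longrightarrow> r \<le> e \<longrightarrow>
    L2_norm \<Omega> (\<lambda>x. of_real (((1 + e\<^sup>2 * (x \<bullet> x)) / (1 + r\<^sup>2 * (x \<bullet> x))) ^ k) * u x) \<le> 2 * L2_norm \<Omega> u)"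
proof -
  have \<Omega>m: "\<Omega> \<in> sets lebesgue" using \<Omega> by (rule open_in_sets_lebesgue)
  let ?E = "eigenspace \<Omega> A (of_real l)"
  have l: "0 \<le> l" using eigenvalue_nonneg_real(2)[of \<Omega> "of_real l"] ev by (simp add: A_def)
  obtain c where c: "c > 0" "\<And>u f. (u, f) \<in> A \<Longrightarrow> (\<And>e. e \<in> ?E \<Longrightarrow> emb \<Omega> u \<bullet> emb \<Omega> e = 0) \<Longrightarrow>
     c * norm (emb \<Omega> u) \<le> norm (emb \<Omega> (\<lambda>x. f x - of_real l * u x))"
    using dirichlet_laplacian_gap[OF \<Omega>] iso ev unfolding A_def by blast
  obtain C where C: "finite C" "pairwise orthogonal C" "span C = emb \<Omega> ` ?E"
    using eigenspace_orthogonal_basis[OF \<Omega>] ev fin unfolding A_def by blast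
  define K where "K = sqrt (real DIM('a) * (16 * l + 34 * real DIM('a)))"
  have K: "0 \<le> K" using l by (simp add: K_def)
  \<comment> \<open>With \<eta> = 10 k^2 e, every e <= e0 satisfies \<eta> <= 1, as the commutator
    estimate requires, and \<eta> K <= c/4, a quarter of the gap constant.\<close>
  define e0 where "e0 = 1 / (1 + 10 * (real k)\<^sup>2 * (1 + 4 * K / c))"
  have den: "0 \<le> 10 * (real k)\<^sup>2 * (1 + 4 * K / c)" using K c by simp
  have e0: "0 < e0" "e0 \<le> 1" using den by (auto simp: e0_def divide_le_eq)
  have e0b: "10 * (real k)\<^sup>2 * e0 \<le> 1" "10 * (real k)\<^sup>2 * e0 * K \<le> c / 4"
  proof -
    have "e0 * (1 + 10 * (real k)\<^sup>2 * (1 + 4 * K / c)) = 1" using den by (simp add: e0_def)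
    then have *: "e0 + 10 * (real k)\<^sup>2 * e0 + 10 * (real k)\<^sup>2 * e0 * K * 4 / c = 1" by (simp add: algebra_simps)
    have "0 \<le> 10 * (real k)\<^sup>2 * e0" "0 \<le> 10 * (real k)\<^sup>2 * e0 * K * 4 / c" using e0 K c by auto
    then show "10 * (real k)\<^sup>2 * e0 \<le> 1" using * e0 by linarith
    have "10 * (real k)\<^sup>2 * e0 * K * 4 / c \<le> 1" using * e0 \<open>0 \<le> 10 * (real k)\<^sup>2 * e0\<close> by linarith
    then show "10 * (real k)\<^sup>2 * e0 * K \<le> c / 4" using c by (simp add: divide_le_eq)
  qed
  define p where "p e x = 1 + e\<^sup>2 * (x \<bullet> x)" for e and x :: 'a
  have p1: "1 \<le> p e x" for e x by (simp add: p_def)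
  have pc: "continuous_on UNIV (p e)" for e unfolding p_def[abs_def] by (intro continuous_intros)
  have cm: "f \<in> borel_measurable lebesgue" if "continuous_on UNIV f" for f :: "'a \<Rightarrow> real"
    using borel_measurable_continuous_onI[OF that] by (simp add: measurable_completion)
  define \<epsilon> where "\<epsilon> n = e0 / real (Suc n)" for n
  have \<epsilon>: "0 < \<epsilon> n" "\<epsilon> n \<le> e0" for n using e0 by (auto simp: \<epsilon>_def divide_le_eq)
  \<comment> \<open>Since w is at most (1 + e^2 |x|^2)^k, this is a majorant of 1 - 1/w that does
    not involve r, so that e can be fixed before r is given.\<close>
  define \<theta> where "\<theta> n x = 1 - (1 / p (\<epsilon> n) x) ^ k" for n x
  have \<theta>b: "0 \<le> \<theta> n x" "\<theta> n x \<le> 1" for n x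
    using p1[of "\<epsilon> n" x] by (auto simp: \<theta>_def power_le_one divide_le_eq)
  have \<theta>m: "\<theta> n \<in> borel_measurable lebesgue" for n
  proof (rule cm)
    show "continuous_on UNIV (\<theta> n)" unfolding \<theta>_def[abs_def]
      using pc p1 by (intro continuous_intros) (auto, metis not_one_le_zero)
  qed
  have \<theta>bm: "bounded_multiplier (\<theta> n)" for n using \<theta>m \<theta>b by (intro bounded_multiplierI[where C = 1]) auto
  have \<theta>lim: "(\<lambda>n. \<theta> n x) \<longlonglongrightarrow> 0" for x
  proof -
    have "\<epsilon> \<longlonglongrightarrow> 0" unfolding \<epsilon>_def[abs_def] using LIMSEQ_Suc[OF lim_const_over_n[of e0]] by simp
    then have "(\<lambda>n. 1 - (1 / (1 + (\<epsilon> n)\<^sup>2 * (x \<bullet> x))) ^ k) \<longlonglongrightarrow> 1 - (1 / (1 + 0\<^sup>2 * (x \<bullet> x))) ^ k"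
      by (intro tendsto_intros) auto
    then show ?thesis by (simp add: \<theta>_def p_def)
  qed
  have "\<exists>n. \<forall>q\<in>span C. norm (mult_l2 (\<theta> n) q) \<le> 1/4 * norm q"
  proof (rule uniformly_small_on_span[OF C(1,2)])
    show "linear (mult_l2 (\<theta> n))" for n by (simp add: linear_iff mult_l2_linear[OF \<theta>bm])
    show "(\<lambda>n. mult_l2 (\<theta> n) v) \<longlonglongrightarrow> 0" for v
      using \<theta>b by (intro mult_l2_tendsto_0 \<theta>m \<theta>lim) simp
  qed simp
  then obtain n where n: "\<And>q. q \<in> span C \<Longrightarrow> norm (mult_l2 (\<theta> n) q) \<le> 1/4 * norm q" by blast
  define e where "e = \<epsilon> n"
  have e: "0 < e" "e \<le> e0" "e \<le> 1" using \<epsilon>[of n] e0 by (auto simp: e_def)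
  have us: "sq_integrable (lebesgue_on \<Omega>) u"
    using H1_0_sq_integrable(1)[OF eigenspace_iff(1)] u unfolding A_def by blast
  have "L2_norm \<Omega> (\<lambda>x. of_real (((1 + e\<^sup>2 * (x \<bullet> x)) / (1 + r\<^sup>2 * (x \<bullet> x))) ^ k) * u x) \<le> 2 * L2_norm \<Omega> u"
    if r: "0 < r" "r \<le> e" for r
  proof -
    define w where "w x = ((1 + e\<^sup>2 * (x \<bullet> x)) / (1 + r\<^sup>2 * (x \<bullet> x))) ^ k" for x :: 'a
    have wp: "w x = (p e x / p r x) ^ k" for x by (simp add: w_def p_def)
    define \<eta> where "\<eta> = 10 * (real k)\<^sup>2 * e"
    have \<eta>e: "\<eta> \<le> 10 * (real k)\<^sup>2 * e0" unfolding \<eta>_def using e by (intro mult_left_mono) auto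
    have "\<eta> * K \<le> 10 * (real k)\<^sup>2 * e0 * K" using \<eta>e K by (rule mult_right_mono)
    then have \<eta>: "0 \<le> \<eta>" "\<eta> \<le> 1" "\<eta> * K \<le> c / 4"
      using \<eta>e e0b e by (auto simp: \<eta>_def)
    obtain D E C' where W: "C2_weight w D E C'"
      and DE: "\<And>b x. b \<in> Basis \<Longrightarrow> \<bar>D b x\<bar> \<le> \<eta> * w x" "\<And>b x. b \<in> Basis \<Longrightarrow> \<bar>E b x\<bar> \<le> \<eta> * w x"
      using decay_weight[OF r e(3) k, where 'a = 'a] unfolding w_def[symmetric, abs_def] \<eta>_def by blast
    have "r\<^sup>2 \<le> e\<^sup>2" using r by (intro power_mono) auto
    then have "p r x \<le> p e x" for x by (simp add: p_def mult_right_mono)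
    then have "1 \<le> p e x / p r x" for x using p1[of r x] by (simp add: le_divide_eq)
    then have w1: "1 \<le> w x" for x unfolding wp by (rule one_le_power)
    have w0: "0 \<le> w x" for x using w1[of x] by linarith
    have wm: "bounded_multiplier w"
      using smooth_real_measurable[OF C2_weightD(1)[OF W], of UNIV] C2_weightD(2)[OF W]
      by (intro bounded_multiplierI[where C = C']) (simp_all add: lebesgue_on_UNIV_eq)
    define F where "F x = (\<Sum>b\<in>Basis. - (2 * (of_real (D b x) * weak_partial \<Omega> b u x) + of_real (E b x) * u x))" for x
    have uE: "u \<in> eigenspace \<Omega> (dirichlet_laplacian \<Omega>) (of_real l)" using u by (simp add: A_def)
    have wA: "((\<lambda>x. of_real (w x) * u x), (\<lambda>x. of_real l * (of_real (w x) * u x) + F x)) \<in> A"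
      and Fs: "sq_integrable (lebesgue_on \<Omega>) F"
      using weighted_eigenfunction[OF \<Omega> uE W] unfolding A_def F_def[symmetric, abs_def] by blast+
    have ws: "sq_integrable (lebesgue_on \<Omega>) (\<lambda>x. of_real (w x) * u x)"
      using dirichlet_laplacian_sq_integrable(1) wA unfolding A_def by blast
    define V where "V = emb \<Omega> (\<lambda>x. of_real (w x) * u x)"
    have nF: "norm (emb \<Omega> F) \<le> c / 4 * norm V"
    proof -
      have "L2_norm \<Omega> F \<le> \<eta> * K * L2_norm \<Omega> (\<lambda>x. of_real (w x) * u x)"
        unfolding K_def F_def[abs_def]
        by (rule weighted_eigenfunction_bound[OF \<Omega> uE l W w0 \<eta>(1,2)]) (rule DE, assumption)+
      then have "norm (emb \<Omega> F) \<le> \<eta> * K * norm V"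
        unfolding V_def emb_norm[OF \<Omega>m Fs] emb_norm[OF \<Omega>m ws] .
      also have "\<dots> \<le> c / 4 * norm V" using \<eta>(3) by (intro mult_right_mono) auto
      finally show ?thesis .
    qed
    define q where "q = ortho_proj C V"
    have qC: "q \<in> span C" unfolding q_def by (rule ortho_proj(1)[OF C(1,2)])
    have qV: "norm q \<le> norm V" unfolding q_def by (rule ortho_proj(3)[OF C(1,2)])
    obtain g where g: "g \<in> ?E" "q = emb \<Omega> g" using qC C(3) by blast
    obtain h where h: "(g, h) \<in> A" "AE x in lebesgue_on \<Omega>. h x = of_real l * g x"
      using g(1) by (auto simp: eigenspace_def)
    have gs: "sq_integrable (lebesgue_on \<Omega>) g" "sq_integrable (lebesgue_on \<Omega>) h"
      using dirichlet_laplacian_sq_integrable h(1) unfolding A_def by blast+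
    have 1: "c * norm (V - q) \<le> norm (emb \<Omega> F)"
    proof -
      \<comment> \<open>w u - g lies in the domain and is orthogonal to the eigenspace. As g is an
        eigenfunction, H - l still maps it to F.\<close>
      let ?v = "\<lambda>x. of_real (w x) * u x + (-1) * g x" and ?f = "\<lambda>x. (of_real l * (of_real (w x) * u x) + F x) + (-1) * h x"
      have vA: "(?v, ?f) \<in> A"
        using dirichlet_laplacian_add[OF \<Omega> _ dirichlet_laplacian_cmult[OF \<Omega>]] wA h(1) unfolding A_def by blast
      have ev: "emb \<Omega> ?v = V - q"
        using emb_diff[OF \<Omega>m ws gs(1)] by (simp add: V_def g(2))
      have "emb \<Omega> ?v \<bullet> emb \<Omega> e' = 0" if "e' \<in> ?E" for e'
        unfolding ev q_def by (rule ortho_proj(2)[OF C(1,2)]) (use that C(3) in blast)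
      from c(2)[OF vA this] have "c * norm (V - q) \<le> norm (emb \<Omega> (\<lambda>x. ?f x - of_real l * ?v x))"
        unfolding ev .
      also have "emb \<Omega> (\<lambda>x. ?f x - of_real l * ?v x) = emb \<Omega> F"
      proof (subst emb_eq_iff[OF \<Omega>m _ Fs])
        show "sq_integrable (lebesgue_on \<Omega>) (\<lambda>x. ?f x - of_real l * ?v x)"
          by (intro sq_integrable_diff sq_integrable_add sq_integrable_cmult ws gs Fs)
        show "AE x in lebesgue_on \<Omega>. ?f x - of_real l * ?v x = F x"
          using h(2) by eventually_elim (simp add: algebra_simps)
      qed
      finally show ?thesis .
    qed
    have "c * norm (V - q) \<le> c * (1/4 * norm V)" using 1 nF by simp
    then have 2: "norm (V - q) \<le> 1/4 * norm V" using c(1) by (simp only: mult_le_cancel_left_pos)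
    have winv: "bounded_multiplier (\<lambda>x. 1 / w x)"
    proof (rule bounded_multiplierI[where C = 1])
      show "(\<lambda>x. 1 / w x) \<in> borel_measurable lebesgue"
        using wm by (intro borel_measurable_divide) (auto simp: bounded_multiplier_def)
      show "\<bar>1 / w x\<bar> \<le> 1" for x using w1[of x] by (simp add: divide_le_eq)
    qed
    have 3: "norm (q - mult_l2 (\<lambda>x. 1 / w x) q) \<le> 1/4 * norm V"
    proof -
      have "norm (q - mult_l2 (\<lambda>x. 1 / w x) q) = norm (mult_l2 (\<lambda>x. 1 - 1 / w x) q)"
        by (simp add: mult_l2_diff_id[OF winv])
      also have "\<dots> \<le> norm (mult_l2 (\<theta> n) q)"
      proof (rule mult_l2_norm_mono[OF _ \<theta>bm])
        have b: "0 \<le> 1 - 1 / w x" "1 - 1 / w x \<le> \<theta> n x" for x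
        proof -
          show "0 \<le> 1 - 1 / w x" using w1[of x] by (simp add: divide_le_eq)
          have "w x \<le> p e x ^ k"
            unfolding wp using p1[of r x] p1[of e x] by (intro power_mono) (auto simp: divide_le_eq)
          then have "1 / p e x ^ k \<le> 1 / w x" using w1[of x] by (intro divide_left_mono) auto
          then show "1 - 1 / w x \<le> \<theta> n x" by (simp add: \<theta>_def e_def power_one_over)
        qed
        then show "\<bar>1 - 1 / w x\<bar> \<le> \<bar>\<theta> n x\<bar>" for x using b[of x] by linarith
        show "bounded_multiplier (\<lambda>x. 1 - 1 / w x)"
        proof (rule bounded_multiplierI[where C = 1])
          show "(\<lambda>x. 1 - 1 / w x) \<in> borel_measurable lebesgue"
            using winv by (intro borel_measurable_diff) (auto simp: bounded_multiplier_def)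
          show "\<bar>1 - 1 / w x\<bar> \<le> 1" for x using b[of x] \<theta>b[of n x] by linarith
        qed
      qed
      also have "\<dots> \<le> 1/4 * norm q" by (rule n[OF qC])
      also have "\<dots> \<le> 1/4 * norm V" using qV by simp
      finally show ?thesis .
    qed
    have "mult_l2 (\<lambda>x. 1 / w x) V = emb \<Omega> (\<lambda>x. of_real (1 / w x) * (of_real (w x) * u x))"
      unfolding V_def using winv by (intro mult_l2_emb[OF \<Omega>m ws]) (auto simp: bounded_multiplier_def)
    also have "(\<lambda>x. of_real (1 / w x) * (of_real (w x) * u x)) = u"
    proof
      fix x show "of_real (1 / w x) * (of_real (w x) * u x) = u x" using w1[of x] by simp
    qed
    finally have wV: "mult_l2 (\<lambda>x. 1 / w x) V = emb \<Omega> u" .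
    \<comment> \<open>The first two terms are each at most a quarter of |V|^2. The last one is <u,
      q>, because division by w is symmetric and turns V = w u back into u. Half of |V|^2 is
      absorbed, whence the factor 2.\<close>
    have "(norm V)\<^sup>2 = V \<bullet> (V - q) + V \<bullet> (q - mult_l2 (\<lambda>x. 1 / w x) q) + V \<bullet> mult_l2 (\<lambda>x. 1 / w x) q"
      by (simp add: inner_diff_right power2_norm_eq_inner)
    also have "V \<bullet> mult_l2 (\<lambda>x. 1 / w x) q = emb \<Omega> u \<bullet> q"
      using mult_l2_inner_swap[OF winv, of V q] wV by simp
    also have "V \<bullet> (V - q) + V \<bullet> (q - mult_l2 (\<lambda>x. 1 / w x) q) + emb \<Omega> u \<bullet> q
       \<le> norm V * norm (V - q) + norm V * norm (q - mult_l2 (\<lambda>x. 1 / w x) q) + norm (emb \<Omega> u) * norm q"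
      by (intro add_mono norm_cauchy_schwarz)
    also have "\<dots> \<le> norm V * (1/4 * norm V) + norm V * (1/4 * norm V) + norm (emb \<Omega> u) * norm V"
      using 2 3 qV by (intro add_mono mult_left_mono) auto
    finally have "norm V * norm V \<le> (2 * norm (emb \<Omega> u)) * norm V" by (simp add: power2_eq_square algebra_simps)
    then have "norm V \<le> 2 * norm (emb \<Omega> u)"
      by (cases "norm V = 0") (auto simp: mult_le_cancel_right)
    then have "L2_norm \<Omega> (\<lambda>x. of_real (w x) * u x) \<le> 2 * L2_norm \<Omega> u"
      unfolding V_def emb_norm[OF \<Omega>m ws] emb_norm[OF \<Omega>m us] .
    then show ?thesis unfolding w_def .
  qed
  then show ?thesis using e by blast
qed

text \<open>The bound 2 |u| is the same for all small r, so Fatou's lemma lets r tend to 0 and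
  removes the denominator of the weight.\<close>

lemma weighted_eigenfunction_sq_integrable:
  fixes \<Omega> :: "'a::euclidean_space set" and l :: real
  defines "A \<equiv> dirichlet_laplacian \<Omega>"
  assumes \<Omega>: "open \<Omega>" and iso: "of_real l isolated_in spectrum \<Omega> A" and ev: "eigenvalue \<Omega> A (of_real l)"
    and fin: "finite_multiplicity \<Omega> A (of_real l)" and u: "u \<in> eigenspace \<Omega> A (of_real l)" and k: "0 < k"
  shows "\<exists>e. 0 < e \<and> e \<le> 1 \<and> sq_integrable (lebesgue_on \<Omega>) (\<lambda>x. of_real ((1 + e\<^sup>2 * (x \<bullet> x)) ^ k) * u x)"
proof -
  have \<Omega>m: "\<Omega> \<in> sets lebesgue" using \<Omega> by (rule open_in_sets_lebesgue)
  have us: "sq_integrable (lebesgue_on \<Omega>) u"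
    using H1_0_sq_integrable(1)[OF eigenspace_iff(1)] u unfolding A_def by blast
  have um: "u \<in> borel_measurable (lebesgue_on \<Omega>)" using us by (rule sq_integrable_measurable)
  obtain e where e: "0 < e" "e \<le> 1" "\<And>r. 0 < r \<Longrightarrow> r \<le> e \<Longrightarrow>
    L2_norm \<Omega> (\<lambda>x. of_real (((1 + e\<^sup>2 * (x \<bullet> x)) / (1 + r\<^sup>2 * (x \<bullet> x))) ^ k) * u x) \<le> 2 * L2_norm \<Omega> u"
    using weighted_eigenfunction_uniform_bound[OF \<Omega>] iso ev fin u k unfolding A_def by blast
  define r where "r n = e / real (Suc n)" for n
  have r: "0 < r n" "r n \<le> e" for n using e by (auto simp: r_def divide_le_eq)
  define w where "w n x = ((1 + e\<^sup>2 * (x \<bullet> x)) / (1 + (r n)\<^sup>2 * (x \<bullet> x))) ^ k" for n and x :: 'a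
  define w' where "w' x = (1 + e\<^sup>2 * (x \<bullet> x)) ^ k" for x :: 'a
  have ppos: "0 < 1 + s\<^sup>2 * (x \<bullet> x)" for s and x :: 'a by (rule one_plus_norm_pos) simp
  have cm: "f \<in> borel_measurable (lebesgue_on \<Omega>)" if "continuous_on UNIV f" for f :: "'a \<Rightarrow> real"
    using borel_measurable_continuous_onI[OF that] by (intro measurable_restrict_space1) (simp add: measurable_completion)
  have wm: "w n \<in> borel_measurable (lebesgue_on \<Omega>)" for n
    unfolding w_def[abs_def] using ppos[THEN less_imp_neq, THEN not_sym]
    by (intro cm continuous_intros) auto
  have w'm: "w' \<in> borel_measurable (lebesgue_on \<Omega>)"
    unfolding w'_def[abs_def] by (intro cm continuous_intros)
  have sq: "sq_integrable (lebesgue_on \<Omega>) (\<lambda>x. of_real (w n x) * u x)" for n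
  proof -
    obtain D E C where "C2_weight (w n) D E C" using decay_weight[OF r e(2) k, where 'a = 'a] unfolding w_def by blast
    then show ?thesis using wm by (intro sq_integrable_bounded_mult[OF us, of _ C]) (auto dest: C2_weightD(2))
  qed
  have bound: "(\<integral>\<^sup>+x. ennreal ((norm (of_real (w n x) * u x))\<^sup>2) \<partial>lebesgue_on \<Omega>) \<le> ennreal ((2 * L2_norm \<Omega> u)\<^sup>2)" for n
  proof -
    have "(\<integral>\<^sup>+x. ennreal ((norm (of_real (w n x) * u x))\<^sup>2) \<partial>lebesgue_on \<Omega>)
       = ennreal (LINT x|lebesgue_on \<Omega>. (norm (of_real (w n x) * u x))\<^sup>2)"
      using sq[of n] by (intro nn_integral_eq_integral) (auto simp: sq_integrable_def)
    also have "(LINT x|lebesgue_on \<Omega>. (norm (of_real (w n x) * u x))\<^sup>2) = (L2_norm \<Omega> (\<lambda>x. of_real (w n x) * u x))\<^sup>2"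
      unfolding L2_norm_def by (simp add: Bochner_Integration.integral_nonneg)
    also have "ennreal \<dots> \<le> ennreal ((2 * L2_norm \<Omega> u)\<^sup>2)"
      using e(3)[OF r, of n] by (intro ennreal_leI power_mono) (simp_all add: w_def)
    finally show ?thesis .
  qed
  have lim: "(\<lambda>n. w n x) \<longlonglongrightarrow> w' x" for x
  proof -
    have "r \<longlonglongrightarrow> 0" unfolding r_def[abs_def] using LIMSEQ_Suc[OF lim_const_over_n[of e]] by simp
    then have "(\<lambda>n. w n x) \<longlonglongrightarrow> ((1 + e\<^sup>2 * (x \<bullet> x)) / (1 + 0\<^sup>2 * (x \<bullet> x))) ^ k"
      unfolding w_def by (intro tendsto_intros) auto
    then show ?thesis by (simp add: w'_def)
  qed
  have "(\<integral>\<^sup>+x. ennreal ((norm (of_real (w' x) * u x))\<^sup>2) \<partial>lebesgue_on \<Omega>)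
     = (\<integral>\<^sup>+x. liminf (\<lambda>n. ennreal ((norm (of_real (w n x) * u x))\<^sup>2)) \<partial>lebesgue_on \<Omega>)"
  proof (rule nn_integral_cong)
    fix x
    have "(\<lambda>n. ennreal ((norm (of_real (w n x) * u x))\<^sup>2)) \<longlonglongrightarrow> ennreal ((norm (of_real (w' x) * u x))\<^sup>2)"
      by (intro tendsto_ennrealI tendsto_intros lim)
    then show "ennreal ((norm (of_real (w' x) * u x))\<^sup>2) = liminf (\<lambda>n. ennreal ((norm (of_real (w n x) * u x))\<^sup>2))"
      by (intro lim_imp_Liminf[symmetric]) auto
  qed
  also have "\<dots> \<le> liminf (\<lambda>n. \<integral>\<^sup>+x. ennreal ((norm (of_real (w n x) * u x))\<^sup>2) \<partial>lebesgue_on \<Omega>)"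
    using wm um by (intro nn_integral_liminf) measurable
  also have "\<dots> \<le> ennreal ((2 * L2_norm \<Omega> u)\<^sup>2)"
    by (rule Liminf_le) (use bound in auto)
  finally have "(\<integral>\<^sup>+x. ennreal ((norm (of_real (w' x) * u x))\<^sup>2) \<partial>lebesgue_on \<Omega>) < \<infinity>"
    by (auto simp: less_top[symmetric] top_unique)
  then have "integrable (lebesgue_on \<Omega>) (\<lambda>x. (norm (of_real (w' x) * u x))\<^sup>2)"
    using w'm um by (intro integrableI_nonneg) auto
  then have "sq_integrable (lebesgue_on \<Omega>) (\<lambda>x. of_real (w' x) * u x)"
    using w'm um unfolding sq_integrable_def by (intro conjI borel_measurable_times) auto
  then show ?thesis using e unfolding w'_def by blast
qed

text \<open>The square is at most a n outside the ball of radius n, and the ball of radius n + 1 has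
  volume of order (n + 1)^d. Covering space by these balls leaves the convergent series of (n +
  1)^(d - 4 d).\<close>

lemma polynomial_decay_sq_integrable:
  assumes e: "0 < e" "e \<le> (1::real)"
  shows "sq_integrable lebesgue (\<lambda>x::'a::euclidean_space. of_real (1 / (1 + e\<^sup>2 * (x \<bullet> x)) ^ DIM('a)))"
proof -
  let ?d = "DIM('a)"
  define f where "f x = (1 / (1 + e\<^sup>2 * (x \<bullet> x)) ^ ?d)\<^sup>2" for x :: 'a
  have ppos: "0 < 1 + e\<^sup>2 * (x \<bullet> x)" for x :: 'a by (rule one_plus_norm_pos) simp
  have c: "continuous_on UNIV (\<lambda>x::'a. 1 / (1 + e\<^sup>2 * (x \<bullet> x)) ^ ?d)"
    using ppos[THEN less_imp_neq, THEN not_sym] by (intro continuous_intros) auto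
  have gm: "(\<lambda>x::'a. 1 / (1 + e\<^sup>2 * (x \<bullet> x)) ^ ?d) \<in> borel_measurable lebesgue"
    using borel_measurable_continuous_onI[OF c] by (simp add: measurable_completion)
  then have fm: "f \<in> borel_measurable lebesgue" unfolding f_def[abs_def] by measurable
  \<comment> \<open>From e <= 1 and (n + 1)^2 <= 2 (1 + n^2) follows (e^2/2) (n + 1)^2 <= 1 + e^2
    |x|^2 for |x| >= n; the power 2 d gives K and the exponent 4 d in a n.\<close>
  define K where "K = (2 / e\<^sup>2) ^ (2 * ?d)"
  define a where "a n = K / real (Suc n) ^ (4 * ?d)" for n
  have a0: "0 \<le> a n" for n by (simp add: a_def K_def)
  have fa: "f x \<le> a n" if n: "real n \<le> norm x" for x n
  proof -
    have "(real n)\<^sup>2 \<le> x \<bullet> x" using n by (simp add: dot_square_norm power_mono)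
    then have "e\<^sup>2 * (real n)\<^sup>2 \<le> e\<^sup>2 * (x \<bullet> x)" by (intro mult_left_mono) auto
    moreover have "e\<^sup>2 \<le> 1" using e by (simp add: power_le_one)
    moreover have "(real (Suc n))\<^sup>2 \<le> 2 * (1 + (real n)\<^sup>2)"
      using sum_squares_bound[of "real n" 1] by (simp add: power2_sum)
    then have "e\<^sup>2 * (real (Suc n))\<^sup>2 \<le> e\<^sup>2 * (2 * (1 + (real n)\<^sup>2))" by (intro mult_left_mono) auto
    ultimately have *: "e\<^sup>2 / 2 * (real (Suc n))\<^sup>2 \<le> 1 + e\<^sup>2 * (x \<bullet> x)" by (simp add: algebra_simps)
    have "f x = 1 / (1 + e\<^sup>2 * (x \<bullet> x)) ^ (2 * ?d)"
      by (simp add: f_def power_divide power_mult[symmetric] mult.commute)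
    also have "\<dots> \<le> 1 / (e\<^sup>2 / 2 * (real (Suc n))\<^sup>2) ^ (2 * ?d)"
      using * e by (intro divide_left_mono power_mono) (auto intro!: mult_pos_pos ppos zero_less_power)
    also have "\<dots> = a n"
      by (simp add: a_def K_def power_mult_distrib power_divide power_mult[symmetric])
    finally show ?thesis .
  qed
  define \<omega> where "\<omega> = unit_ball_vol (real ?d)"
  have \<omega>: "0 \<le> \<omega>" by (simp add: \<omega>_def)
  have "(\<integral>\<^sup>+x. ennreal (f x) \<partial>lebesgue) \<le> (\<integral>\<^sup>+x. (\<Sum>n. ennreal (a n) * indicator (cball (0::'a) (real (Suc n))) x) \<partial>lebesgue)"
  proof (rule nn_integral_mono)
    fix x :: 'a
    define m where "m = nat \<lfloor>norm x\<rfloor>"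
    have m: "real m \<le> norm x" "norm x \<le> real (Suc m)" unfolding m_def by (simp_all, linarith)
    \<comment> \<open>The point x lies in the ball of index m, so this single term already dominates
      f x, and the other terms are nonnegative.\<close>
    define g where "g n = ennreal (a n) * indicator (cball 0 (real (Suc n))) x" for n
    have "ennreal (f x) \<le> g m"
      using fa[OF m(1)] m(2) by (simp add: g_def ennreal_leI)
    also have "g m \<le> suminf g"
      using sum_le_suminf[of g "{m}"] by simp
    also have "suminf g = (\<Sum>n. ennreal (a n) * indicator (cball 0 (real (Suc n))) x)"
      unfolding g_def[abs_def] ..
    finally show "ennreal (f x) \<le> (\<Sum>n. ennreal (a n) * indicator (cball 0 (real (Suc n))) x)" .
  qed
  also have "\<dots> = (\<Sum>n. \<integral>\<^sup>+x. ennreal (a n) * indicator (cball (0::'a) (real (Suc n))) x \<partial>lebesgue)"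
    by (rule nn_integral_suminf) (auto intro!: borel_measurable_times_ennreal borel_measurable_indicator sets_completionI_sets)
  also have "\<dots> = (\<Sum>n. ennreal (a n * (\<omega> * real (Suc n) ^ ?d)))"
  proof (rule suminf_cong)
    fix n
    have "(\<integral>\<^sup>+x. ennreal (a n) * indicator (cball 0 (real (Suc n))) (x::'a) \<partial>lebesgue)
        = ennreal (a n) * emeasure lebesgue (cball (0::'a) (real (Suc n)))"
      by (rule nn_integral_cmult_indicator) (simp add: sets_completionI_sets)
    also have "emeasure lebesgue (cball (0::'a) (real (Suc n))) = ennreal (\<omega> * real (Suc n) ^ ?d)"
      using emeasure_cball[of "real (Suc n)" "0::'a"] by (simp add: \<omega>_def)
    finally show "(\<integral>\<^sup>+x. ennreal (a n) * indicator (cball 0 (real (Suc n))) (x::'a) \<partial>lebesgue)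
        = ennreal (a n * (\<omega> * real (Suc n) ^ ?d))"
      using a0[of n] \<omega> by (simp add: ennreal_mult del: of_nat_Suc)
  qed
  also have "\<dots> < \<infinity>"
  proof -
    have "1 \<le> ?d" by (simp add: Suc_leI)
    \<comment> \<open>The comparison is with the series of 1/(n + 1)^2.\<close>
    then have d1: "?d + 2 \<le> 4 * ?d" by linarith
    have "summable (\<lambda>n. a n * (\<omega> * real (Suc n) ^ ?d))"
    proof (rule summable_comparison_test)
      have "norm (a n * (\<omega> * real (Suc n) ^ ?d)) \<le> K * \<omega> * (1 / real (Suc n) ^ 2)" for n
      proof -
        have "real (Suc n) ^ (?d + 2) \<le> real (Suc n) ^ (4 * ?d)" by (rule power_increasing[OF d1]) simp
        then have "real (Suc n) ^ ?d / real (Suc n) ^ (4 * ?d) \<le> 1 / real (Suc n) ^ 2"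
          by (simp add: divide_simps power_add power2_eq_square mult_ac del: of_nat_Suc)
        then have "K * \<omega> * (real (Suc n) ^ ?d / real (Suc n) ^ (4 * ?d)) \<le> K * \<omega> * (1 / real (Suc n) ^ 2)"
          using \<omega> by (intro mult_left_mono) (auto simp: K_def)
        then show ?thesis using a0[of n] \<omega> by (simp add: a_def abs_mult K_def algebra_simps del: of_nat_Suc)
      qed
      then show "\<exists>N. \<forall>n\<ge>N. norm (a n * (\<omega> * real (Suc n) ^ ?d)) \<le> K * \<omega> * (1 / real (Suc n) ^ 2)" by blast
      have "summable (\<lambda>n. 1 / real (Suc n) ^ 2)"
        using inverse_power_summable[of 2, where 'a = real] by (subst summable_Suc_iff) (simp add: divide_inverse)
      then show "summable (\<lambda>n. K * \<omega> * (1 / real (Suc n) ^ 2))" by (rule summable_mult)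
    qed
    then show ?thesis
      using a0 \<omega> by (subst suminf_ennreal2) auto
  qed
  finally have "integrable lebesgue f"
    using fm by (intro integrableI_nonneg) (auto simp: f_def)
  then show ?thesis unfolding sq_integrable_def f_def[abs_def] norm_of_real power2_abs
    by (intro conjI measurable_compose[OF gm borel_measurable_continuous_onI] continuous_intros)
qed

text \<open>u is the product of (1 + e^2 |x|^2)^(-d) and (1 + e^2 |x|^2)^d u, both in L_2: the
  exponent k = d of the weight is chosen for the first factor.\<close>

lemma eigenfunction_integrable:
  fixes \<Omega> :: "'a::euclidean_space set" and l :: real
  defines "A \<equiv> dirichlet_laplacian \<Omega>"
  assumes \<Omega>: "open \<Omega>" and iso: "of_real l isolated_in spectrum \<Omega> A" and ev: "eigenvalue \<Omega> A (of_real l)"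
    and fin: "finite_multiplicity \<Omega> A (of_real l)" and u: "u \<in> eigenspace \<Omega> A (of_real l)"
  shows "integrable (lebesgue_on \<Omega>) u"
proof -
  have \<Omega>m: "\<Omega> \<in> sets lebesgue" using \<Omega> by (rule open_in_sets_lebesgue)
  obtain e where e: "0 < e" "e \<le> 1"
    "sq_integrable (lebesgue_on \<Omega>) (\<lambda>x. of_real ((1 + e\<^sup>2 * (x \<bullet> x)) ^ DIM('a)) * u x)"
    using weighted_eigenfunction_sq_integrable[OF \<Omega>, of l u "DIM('a)"] iso ev fin u unfolding A_def by auto
  let ?g = "\<lambda>x::'a. complex_of_real (1 / (1 + e\<^sup>2 * (x \<bullet> x)) ^ DIM('a))"
  have g: "sq_integrable lebesgue ?g" by (rule polynomial_decay_sq_integrable[OF e(1,2)])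
  have "sq_integrable lebesgue (\<lambda>x. if x \<in> \<Omega> then ?g x else 0)"
  proof (rule sq_integrable_bound[OF g, where C = 1])
    show "(\<lambda>x. if x \<in> \<Omega> then ?g x else 0) \<in> borel_measurable lebesgue"
      using sq_integrable_measurable[OF g] \<Omega>m by (intro borel_measurable_if_I measurable_restrict_space1)
  qed simp
  then have "sq_integrable (lebesgue_on \<Omega>) ?g" by (simp only: sq_integrable_extend[OF \<Omega>m])
  from sq_integrable_mult_integrable[OF this e(3)]
  have "integrable (lebesgue_on \<Omega>) (\<lambda>x. ?g x * (of_real ((1 + e\<^sup>2 * (x \<bullet> x)) ^ DIM('a)) * u x))" .
  moreover have "?g x * (of_real ((1 + e\<^sup>2 * (x \<bullet> x)) ^ DIM('a)) * u x) = u x" for x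
    using one_plus_norm_pos[of "e\<^sup>2" x] by (simp flip: of_real_add of_real_mult of_real_power of_real_divide mult.assoc)
  ultimately show ?thesis by simp
qed

section \<open>From integrable and bounded to all L_p\<close>

lemma Lp_space_of_integrable_bounded:
  assumes u: "integrable (lebesgue_on \<Omega>) u" and C: "AE x in lebesgue_on \<Omega>. norm (u x) \<le> C" and p: "1 \<le> p"
  shows "u \<in> Lp_space \<Omega> p"
proof (cases "p = \<infinity>")
  case True
  then show ?thesis using C borel_measurable_integrable[OF u] by (auto simp: Lp_space_def)
next
  case False
  define s where "s = enn2real p"
  have s: "1 \<le> s" using p False unfolding s_def
    by (metis enn2real_1 enn2real_mono infinity_ennreal_def less_top)
  have um: "u \<in> borel_measurable (lebesgue_on \<Omega>)" using u by (rule borel_measurable_integrable)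
  have "integrable (lebesgue_on \<Omega>) (\<lambda>x. norm (u x) powr s)"
  proof (rule Bochner_Integration.integrable_bound)
    \<comment> \<open>|u|^s <= C^(s-1) |u|; the modulus of C is taken because C may be negative when
      \<open>\<Omega>\<close> is a null set.\<close>
    show "integrable (lebesgue_on \<Omega>) (\<lambda>x. \<bar>C\<bar> powr (s - 1) * norm (u x))" using u by simp
    show "(\<lambda>x. norm (u x) powr s) \<in> borel_measurable (lebesgue_on \<Omega>)" using um by measurable
    show "AE x in lebesgue_on \<Omega>. norm (norm (u x) powr s) \<le> norm (\<bar>C\<bar> powr (s - 1) * norm (u x))"
      using C
    proof eventually_elim
      case (elim x)
      have "norm (u x) powr s = norm (u x) powr (s - 1) * norm (u x)"
        by (cases "u x = 0") (auto simp: powr_mult_base powr_diff)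
      also have "\<dots> \<le> \<bar>C\<bar> powr (s - 1) * norm (u x)"
        using elim s by (intro mult_right_mono powr_mono2) auto
      finally show ?case by simp
    qed
  qed
  then show ?thesis using um False by (simp add: Lp_space_def s_def)
qed

theorem theorem4p1:
  fixes \<Omega> :: "(real ^ 'd) set" and lam :: complex
  assumes "open \<Omega>"
    and "lam isolated_in spectrum \<Omega> (dirichlet_laplacian \<Omega>)"
    and "eigenvalue \<Omega> (dirichlet_laplacian \<Omega>) lam"
    and "finite_multiplicity \<Omega> (dirichlet_laplacian \<Omega>) lam"
  shows "\<forall>p::ennreal. 1 \<le> p \<longrightarrow> eigenspace \<Omega> (dirichlet_laplacian \<Omega>) lam \<subseteq> Lp_space \<Omega> p"
proof (intro allI impI subsetI)
  fix p :: ennreal and u assume p: "1 \<le> p" and u: "u \<in> eigenspace \<Omega> (dirichlet_laplacian \<Omega>) lam"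
  \<comment> \<open>The eigenvalue is real, which is what allows the real Hilbert space structure to
    carry the gap argument.\<close>
  define l where "l = Re lam"
  have lam: "lam = of_real l" and l: "0 \<le> l"
    using eigenvalue_nonneg_real[OF assms(3)] by (simp_all add: l_def)
  have "integrable (lebesgue_on \<Omega>) u"
    by (rule eigenfunction_integrable[OF assms(1)]) (use assms u lam in simp_all)
  moreover obtain C where "AE x in lebesgue_on \<Omega>. norm (u x) \<le> C"
    using eigenfunction_bounded[OF assms(1) _ l] u unfolding lam by blast
  ultimately show "u \<in> Lp_space \<Omega> p" using p by (rule Lp_space_of_integrable_bounded)
qed

end
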